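(* Let $\alpha>0$, $\beta\geq1$ and $p\geq\beta$. Let $\Lambda$ be a quasi-lacunary sequence and $\mu$ a positive Borel measure on $[0,1]$. Assume that the inclusion $\imath_\mu:f\mapsto f$ is of restricted weak type $p$. Then, for any $r>p$, $\imath_\mu$ is of strong type $r$.
   Context: $\Lambda=\{\lambda_k\}_{k\geq 0}$ is an increasing sequence of positive real numbers with $\sum_{k\ge0}1/\lambda_k<\infty$. $M_\Lambda$ is the space of functions on $[0,1]$ of the form $f(t)=\sum_{k=0}^K a_kt^{\lambda_k}$, $a_k\in\mathbb C$, $K\geq 0$. $\Lambda$ is quasi-lacunary if there exist $N\geq1$ and $q_0>1$ such that $\Lambda$ is the disjoint union of blocks $E_k=\{\lambda_{n_k+1},\dots,\lambda_{n_{k+1}}\}$, $k\ge 0$ (with $(n_k)_{k\geq 0}$ a strictly increasing sequence of integers, $n_0=-1$), with $\#E_k\leq N$ and $\lambda_{n_{k+1}}/\lambda_{n_k}>q_0$ for $k$ large enough. Such a decomposition is fixed, and $F_k=\operatorname{Span}\{t^\lambda:\lambda\in E_k\}$. $\mathrm d\nu_{\alpha-1}=(1-x)^{\alpha-1}\mathrm dx$ on $[0,1]$. With $\alpha,\beta,\mu$ given, an operator $T$ acting on $M_\Lambda$ is of restricted weak type $p$ if for every $k\geq0$ there is a constant $C_p(k)>0$ such that for every $f_k\in F_k$ and every $\lambda>0$, $\mu(|Tf_k|>\lambda)\leq C_p(k)^p\lambda^{-p}\|f_k\|^p_{L^{p/\beta}(\mathrm d\nu_{\alpha-1})}$. It is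 of strong type $r$ if there is a constant $C_r>0$ such that $\|Tf\|_{L^r(\mathrm d\mu)}\leq C_r\|f\|_{L^{r/\beta}(\mathrm d\nu_{\alpha-1})}$ for all $f\in M_\Lambda$. Here $T=\imath_\mu$, so $Tf=f$.
   Formalization: The restricted weak type constants C_p(k) are additionally assumed bounded in k; with arbitrary dependence on k the claim fails, e.g. for α=β=p=1, λ_k=2^k with singleton blocks and μ the Dirac mass at 1. *)

theory Defs
  imports "HOL-Analysis.Analysis"
begin

definition muntz_space :: "(nat \<Rightarrow> real) \<Rightarrow> (real \<Rightarrow> complex) set" where
  "muntz_space lam =
     {f. \<exists>(K::nat) (a::nat \<Rightarrow> complex). f = (\<lambda>t. \<Sum>k\<le>K. a k * complex_of_real (t powr lam k))}"

text \<open>The indices \<open>n k\<close> are integers because \<open>n 0 = -1\<close>.\<close>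

definition block :: "(nat \<Rightarrow> real) \<Rightarrow> (nat \<Rightarrow> int) \<Rightarrow> nat \<Rightarrow> real set" where
  "block lam n k = (\<lambda>j. lam (nat j)) ` {n k + 1..n (Suc k)}"

definition block_space :: "(nat \<Rightarrow> real) \<Rightarrow> (nat \<Rightarrow> int) \<Rightarrow> nat \<Rightarrow> (real \<Rightarrow> complex) set" where
  "block_space lam n k =
     {f. \<exists>a::real \<Rightarrow> complex. f = (\<lambda>t. \<Sum>x\<in>block lam n k. a x * complex_of_real (t powr x))}"

text \<open>
  Since \<open>n\<close> is strictly increasing with \<open>n 0 = -1\<close>, the index intervals
  \<open>{n k + 1..n (Suc k)}\<close> partition the natural numbers; for strictly increasing \<open>lam\<close> the blocks
  are therefore a disjoint decomposition of the range of \<open>lam\<close>. In the ratio condition,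
  \<open>nat (n k)\<close> differs from \<open>n k\<close> only for \<open>k = 0\<close>.
\<close>

definition quasi_lacunary_decomposition :: "(nat \<Rightarrow> real) \<Rightarrow> (nat \<Rightarrow> int) \<Rightarrow> bool" where
  "quasi_lacunary_decomposition lam n \<longleftrightarrow>
     strict_mono n \<and> n 0 = -1 \<and>
     (\<exists>(N::nat) (q0::real). N \<ge> 1 \<and> q0 > 1 \<and>
        (\<forall>k. card (block lam n k) \<le> N) \<and>
        (\<forall>\<^sub>F k in sequentially. lam (nat (n (Suc k))) / lam (nat (n k)) > q0))"

text \<open>\<open>weight_measure a\<close> is the measure with density \<open>(1 - x) powr a\<close> on \<open>[0,1]\<close>.\<close>

definition weight_measure :: "real \<Rightarrow> real measure" where
  "weight_measure a =
     density (restrict_space lborel {0..1}) (\<lambda>x. ennreal ((1 - x) powr a))"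

text \<open>Real powers of extended nonnegative reals, for exponents \<open>a > 0\<close>.\<close>

definition ennreal_powr :: "ennreal \<Rightarrow> real \<Rightarrow> ennreal" where
  "ennreal_powr x a = (if x = \<infinity> then \<infinity> else ennreal (enn2real x powr a))"

definition Lp_norm :: "real \<Rightarrow> 'a measure \<Rightarrow> ('a \<Rightarrow> complex) \<Rightarrow> ennreal" where
  "Lp_norm p M f = ennreal_powr (\<integral>\<^sup>+ x. ennreal (cmod (f x) powr p) \<partial>M) (1 / p)"

text \<open>
  The measurability clauses express that \<open>T\<close> takes values in the measurable functions for
  \<open>\<mu>\<close>; without them the measure of a superlevel set and the integral would be junk values.

  The constants \<open>C k\<close> are a parameter of the restricted weak type predicate, so that bounds that
  are uniform in \<open>k\<close> can be expressed. For a finite \<open>\<mu>\<close> and \<open>T f = f\<close>, constants with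
  arbitrary dependence on \<open>k\<close> always exist, as each block space has finite dimension; the
  condition is meaningful only together with a bound on \<open>C\<close>.
\<close>

definition restricted_weak_type ::
  "(nat \<Rightarrow> real) \<Rightarrow> (nat \<Rightarrow> int) \<Rightarrow> real \<Rightarrow> real \<Rightarrow> real measure \<Rightarrow>
   ((real \<Rightarrow> complex) \<Rightarrow> (real \<Rightarrow> complex)) \<Rightarrow> real \<Rightarrow> (nat \<Rightarrow> real) \<Rightarrow> bool" where
  "restricted_weak_type lam n \<alpha> \<beta> \<mu> T p C \<longleftrightarrow>
     (\<forall>k. C k > 0 \<and>
        (\<forall>f\<in>block_space lam n k. T f \<in> borel_measurable \<mu> \<and>
           (\<forall>s>0. emeasure \<mu> {t \<in> space \<mu>. cmod (T f t) > s} \<le>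
              ennreal (C k powr p * s powr (-p)) *
              ennreal_powr (Lp_norm (p / \<beta>) (weight_measure (\<alpha> - 1)) f) p)))"

definition strong_type ::
  "(nat \<Rightarrow> real) \<Rightarrow> real \<Rightarrow> real \<Rightarrow> real measure \<Rightarrow>
   ((real \<Rightarrow> complex) \<Rightarrow> (real \<Rightarrow> complex)) \<Rightarrow> real \<Rightarrow> bool" where
  "strong_type lam \<alpha> \<beta> \<mu> T r \<longleftrightarrow>
     (\<exists>C>0. \<forall>f\<in>muntz_space lam. T f \<in> borel_measurable \<mu> \<and>
        Lp_norm r \<mu> (T f) \<le>
          ennreal C * Lp_norm (r / \<beta>) (weight_measure (\<alpha> - 1)) f)"

end

theory Submission
  imports Defs
begin

text \<open>
  Put \<open>x = - ln t\<close>, so that a generalised polynomial becomes an exponential sum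
  \<open>\<Sum> a j * exp (- lam j * x)\<close>, and put \<open>q = r / \<beta>\<close>, \<open>\<sigma> = \<alpha> / q\<close>.

  The weak type hypothesis is tested on monomials. The norm of \<open>t powr lam j\<close> is a Beta
  integral, so the hypothesis bounds \<open>\<mu> (t powr lam j > s)\<close> by a multiple of
  \<open>lam j powr (- \<alpha> * \<beta>) * s powr (- p)\<close>, and for \<open>\<gamma>' * r > p\<close> the \<open>\<mu>\<close>-integral of
  \<open>t powr (\<gamma>' * r * lam j)\<close> is of order \<open>lam j powr (- \<alpha> * \<beta>)\<close>. The rest of the proof concerns the
  exponents. They are cut into groups of boundedly many exponents with ratios at most
  \<open>\<kappa>\<close> inside a group and at least \<open>\<tau> > 1\<close> between groups (\<open>exponent_groups_exist\<close>); here \<open>\<kappa>\<close> can be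
  taken as close to \<open>1\<close> as \<open>r > p\<close> requires. Let \<open>c i\<close> be the size of the part of \<open>f\<close> carried by the
  group of \<open>i\<close>, multiplied by \<open>lam i powr (- \<sigma>)\<close>. Two estimates carry the proof.

  First, \<open>\<Sum> c i powr q\<close> is bounded by the \<open>q\<close>-th power of the weighted \<open>L^q\<close> norm of \<open>f\<close>
  (\<open>group_sizes_bounded_by_norm\<close>). A group is extracted from \<open>f\<close> by a polynomial in the translation
  by a step comparable to \<open>1 / lam i\<close>. The polynomial reproduces the group, kills the finitely many
  groups at comparable scales, vanishes to high order at \<open>1\<close> to damp the much lower exponents,
  and has no constant term, which damps the much higher ones (\<open>group_extraction\<close>). The
  remaining errors are small enough to be absorbed after summation over all groups. Exponents of
  one group can be arbitrarily close to each other; uniformity in their position comes from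
  Newton interpolation, whose coefficients are controlled by derivatives of the interpolated function
  (\<open>interpolation_poly_exists\<close>).

  Secondly, each group decays like \<open>exp (- \<gamma> * lam i * x)\<close> with \<open>\<gamma> < 1 / \<kappa>\<close> (\<open>group_decay\<close>), so
  \<open>cmod f\<close> is dominated by \<open>\<Sum> c i * lam i powr \<sigma> * exp (- \<gamma> * lam i * x)\<close>. By lacunarity the \<open>r\<close>-th power
  of this sum has a majorant that is a combination of single exponentials of rate
  \<open>\<gamma>' * r * lam i\<close> (\<open>exponential_sum_power_majorant\<close>). Integrating it against \<open>\<mu>\<close> and using
  \<open>\<sigma> * r = \<alpha> * \<beta>\<close> gives a multiple of \<open>\<Sum> c i powr r\<close>, hence of \<open>(\<Sum> c i powr q) powr \<beta>\<close>, as \<open>\<beta> \<ge> 1\<close>.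
\<close>

section \<open>Bounded derivatives\<close>

text \<open>
  One constant bounds \<open>g\<close> and its first \<open>n\<close> derivatives on \<open>I\<close>. With the derivatives existential,
  bounds for sums, products and powers follow by induction on \<open>n\<close> without formulas for higher
  derivatives.
\<close>

primrec deriv_bound :: "nat \<Rightarrow> real set \<Rightarrow> real \<Rightarrow> (real \<Rightarrow> real) \<Rightarrow> bool" where
  "deriv_bound 0 I K g \<longleftrightarrow> (\<forall>u\<in>I. \<bar>g u\<bar> \<le> K)"
| "deriv_bound (Suc n) I K g \<longleftrightarrow> (\<forall>u\<in>I. \<bar>g u\<bar> \<le> K) \<and>
     (\<exists>g'. (\<forall>u\<in>I. (g has_real_derivative g' u) (at u)) \<and> deriv_bound n I K g')"

lemma deriv_bound_SucI:
  assumes "deriv_bound n I K g'" "\<And>u. u \<in> I \<Longrightarrow> \<bar>g u\<bar> \<le> K"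
    and "\<And>u. u \<in> I \<Longrightarrow> (g has_real_derivative g' u) (at u)"
  shows "deriv_bound (Suc n) I K g"
  using assms by auto

lemma deriv_boundD: "deriv_bound n I K g \<Longrightarrow> u \<in> I \<Longrightarrow> \<bar>g u\<bar> \<le> K"
  by (cases n) auto

lemma deriv_bound_SucD: "deriv_bound (Suc n) I K g \<Longrightarrow> deriv_bound n I K g"
proof (induction n arbitrary: g)
  case (Suc n)
  from Suc.prems obtain g' where g': "\<forall>u\<in>I. \<bar>g u\<bar> \<le> K"
    "\<forall>u\<in>I. (g has_real_derivative g' u) (at u)" "deriv_bound (Suc n) I K g'"
    unfolding deriv_bound.simps(2)[of "Suc n"] by blast
  have "deriv_bound n I K g'" by (rule Suc.IH[OF g'(3)])
  then show ?case using g'(1,2) unfolding deriv_bound.simps(2)[of n] by blast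
qed simp

lemma deriv_bound_order_mono: "deriv_bound n I K g \<Longrightarrow> m \<le> n \<Longrightarrow> deriv_bound m I K g"
proof (induction n)
  case (Suc n)
  then show ?case using deriv_bound_SucD by (cases "m = Suc n") auto
qed simp

lemma deriv_bound_mono: "deriv_bound n I K g \<Longrightarrow> K \<le> L \<Longrightarrow> deriv_bound n I L g"
proof (induction n arbitrary: g)
  case 0
  then show ?case by fastforce
next
  case (Suc n)
  then obtain g' where "\<forall>u\<in>I. (g has_real_derivative g' u) (at u)" "deriv_bound n I K g'" by auto
  moreover have "\<forall>u\<in>I. \<bar>g u\<bar> \<le> L" using Suc.prems deriv_boundD by fastforce
  ultimately show ?case using Suc by auto
qed

text \<open>
  Equality on \<open>I\<close> alone would not transfer the derivatives at the end points, hence the open set.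
\<close>

lemma deriv_bound_cong:
  assumes "deriv_bound n I K f" "open S" "I \<subseteq> S" "\<And>u. u \<in> S \<Longrightarrow> f u = g u"
  shows "deriv_bound n I K g"
proof (cases n)
  case 0
  then show ?thesis using assms by fastforce
next
  case (Suc k)
  then obtain f' where f': "\<forall>u\<in>I. (f has_real_derivative f' u) (at u)" "deriv_bound k I K f'"
    using assms by auto
  have "\<forall>u\<in>I. (g has_real_derivative f' u) (at u)"
    using f' assms by (meson has_field_derivative_transform_within_open subsetD)
  moreover have "\<forall>u\<in>I. \<bar>g u\<bar> \<le> K"
    using assms deriv_boundD by (metis subsetD)
  ultimately show ?thesis using f' Suc by auto
qed

lemma deriv_bound_const: "\<bar>c\<bar> \<le> K \<Longrightarrow> deriv_bound n I K (\<lambda>_. c)"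
proof (induction n arbitrary: c)
  case (Suc n)
  have "deriv_bound n I K (\<lambda>_. 0)" using Suc by simp
  then show ?case using Suc.prems by (auto intro!: exI[of _ "\<lambda>_. 0"])
qed auto

lemma deriv_bound_add:
  "deriv_bound n I K f \<Longrightarrow> deriv_bound n I L g \<Longrightarrow> deriv_bound n I (K + L) (\<lambda>u. f u + g u)"
proof (induction n arbitrary: f g)
  case 0
  then show ?case by (force intro: order_trans[OF abs_triangle_ineq] add_mono)
next
  case (Suc n)
  from Suc.prems obtain f' g' where
    d: "\<forall>u\<in>I. (f has_real_derivative f' u) (at u)" "deriv_bound n I K f'"
       "\<forall>u\<in>I. (g has_real_derivative g' u) (at u)" "deriv_bound n I L g'" by auto
  have "\<forall>u\<in>I. ((\<lambda>u. f u + g u) has_real_derivative f' u + g' u) (at u)"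
    using d by (auto intro: DERIV_add)
  moreover have "\<forall>u\<in>I. \<bar>f u + g u\<bar> \<le> K + L"
    using Suc.prems deriv_boundD by (metis abs_triangle_ineq add_mono order_trans)
  ultimately show ?case using Suc.IH[OF d(2,4)] by auto
qed

lemma deriv_bound_cmult:
  "deriv_bound n I K f \<Longrightarrow> deriv_bound n I (\<bar>c\<bar> * K) (\<lambda>u. c * f u)"
proof (induction n arbitrary: f)
  case 0
  then show ?case by (simp add: abs_mult mult_left_mono)
next
  case (Suc n)
  from Suc.prems obtain f' where
    d: "\<forall>u\<in>I. (f has_real_derivative f' u) (at u)" "deriv_bound n I K f'" by auto
  have "\<forall>u\<in>I. ((\<lambda>u. c * f u) has_real_derivative c * f' u) (at u)"
    using d by (auto intro: DERIV_cmult)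
  moreover have "\<forall>u\<in>I. \<bar>c * f u\<bar> \<le> \<bar>c\<bar> * K"
    using Suc.prems by (simp add: abs_mult mult_left_mono)
  ultimately show ?case using Suc.IH[OF d(2)] by auto
qed

lemma deriv_bound_sum:
  assumes "\<And>k. k \<in> A \<Longrightarrow> deriv_bound n I (K k) (f k)"
  shows "deriv_bound n I (\<Sum>k\<in>A. K k) (\<lambda>u. \<Sum>k\<in>A. f k u)"
  using assms
proof (induction A rule: infinite_finite_induct)
  case (insert x F)
  then show ?case by (simp add: deriv_bound_add)
qed (auto intro: deriv_bound_const)

lemma deriv_bound_mult:
  "deriv_bound n I K f \<Longrightarrow> deriv_bound n I L g \<Longrightarrow> 0 \<le> K \<Longrightarrow> 0 \<le> L \<Longrightarrow>
   deriv_bound n I (2 ^ n * K * L) (\<lambda>u. f u * g u)"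
proof (induction n arbitrary: f g)
  case 0
  then show ?case by (simp add: abs_mult mult_mono)
next
  case (Suc n)
  from Suc.prems obtain f' g' where
    d: "\<forall>u\<in>I. (f has_real_derivative f' u) (at u)" "deriv_bound n I K f'"
       "\<forall>u\<in>I. (g has_real_derivative g' u) (at u)" "deriv_bound n I L g'" by auto
  have "\<forall>u\<in>I. ((\<lambda>u. f u * g u) has_real_derivative f u * g' u + f' u * g u) (at u)"
    using d by (auto intro: DERIV_mult')
  moreover have "deriv_bound n I (2 ^ n * K * L + 2 ^ n * K * L) (\<lambda>u. f u * g' u + f' u * g u)"
    using Suc.IH[OF deriv_bound_SucD[OF Suc.prems(1)] d(4) Suc.prems(3,4)]
      Suc.IH[OF d(2) deriv_bound_SucD[OF Suc.prems(2)] Suc.prems(3,4)]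
    by (rule deriv_bound_add)
  then have "deriv_bound n I (2 ^ Suc n * K * L) (\<lambda>u. f u * g' u + f' u * g u)"
    by (simp add: mult.commute mult.left_commute mult.assoc)
  moreover have "\<bar>f u * g u\<bar> \<le> 2 ^ Suc n * K * L" if "u \<in> I" for u
  proof -
    have "\<bar>f u * g u\<bar> \<le> K * L"
      using that Suc.prems by (simp add: abs_mult mult_mono)
    also have "\<dots> \<le> 2 ^ Suc n * (K * L)"
      using mult_right_mono[of 1 "2 ^ Suc n" "K * L"] Suc.prems(3,4) one_le_power[of "2::real" "Suc n"]
      by simp
    finally show ?thesis by (simp add: mult.assoc)
  qed
  ultimately show ?case by auto
qed

lemma deriv_bound_power:
  assumes "deriv_bound n I K f" "0 \<le> K"
  shows "deriv_bound n I ((2 ^ n * K) ^ m) (\<lambda>u. f u ^ m)"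
proof (induction m)
  case 0
  then show ?case by (simp add: deriv_bound_const)
next
  case (Suc m)
  then show ?case using deriv_bound_mult[OF assms(1) Suc assms(2)] assms(2) by (simp add: mult_ac)
qed

lemma deriv_bound_prod_list:
  assumes "\<And>r. r \<in> set rs \<Longrightarrow> deriv_bound n I K (f r)" "0 \<le> K"
  shows "deriv_bound n I ((2 ^ n * K) ^ length rs) (\<lambda>u. \<Prod>r\<leftarrow>rs. f r u)"
  using assms(1)
proof (induction rs)
  case Nil
  then show ?case by (simp add: deriv_bound_const)
next
  case (Cons r rs)
  then have "deriv_bound n I (2 ^ n * K * (2 ^ n * K) ^ length rs) (\<lambda>u. f r u * (\<Prod>r\<leftarrow>rs. f r u))"
    using assms(2) by (intro deriv_bound_mult) auto
  then show ?case by simp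
qed

text \<open>
  Differentiating \<open>(v - r)^(-k)\<close> raises \<open>k\<close> by one and costs the factor \<open>k\<close>, so the bound is stated
  for all \<open>k\<close> at once to make the induction on the order close.
\<close>

lemma deriv_bound_inverse_power:
  assumes "\<And>v. v \<in> I \<Longrightarrow> \<delta> \<le> \<bar>v - r\<bar>" "0 < \<delta>" "\<delta> \<le> 1"
  shows "deriv_bound n I ((real (k + n)) ^ n / \<delta> ^ (k + n)) (\<lambda>v. inverse (v - r) ^ k)"
proof (induction n arbitrary: k)
  have b: "\<bar>inverse (v - r) ^ k\<bar> \<le> 1 / \<delta> ^ k" if "v \<in> I" for v k
  proof -
    have "inverse \<bar>v - r\<bar> \<le> inverse \<delta>" using assms that by (intro le_imp_inverse_le) auto
    then have "inverse \<bar>v - r\<bar> ^ k \<le> inverse \<delta> ^ k" by (intro power_mono) auto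
    then show ?thesis by (simp add: power_abs abs_inverse inverse_eq_divide power_divide)
  qed
  case 0
  then show ?case using b by simp
  case (Suc n)
  have d: "((\<lambda>v. inverse (v - r) ^ k) has_real_derivative - real k * inverse (v - r) ^ Suc k) (at v)"
    if "v \<in> I" for v
  proof -
    have "v - r \<noteq> 0" using assms that by fastforce
    then have "((\<lambda>v. inverse (v - r)) has_real_derivative - (inverse (v - r) ^ 2)) (at v)"
      by (auto intro!: derivative_eq_intros simp: power2_eq_square)
    from DERIV_power[OF this, of k] have
      "((\<lambda>v. inverse (v - r) ^ k) has_real_derivative
         real k * (- (inverse (v - r) ^ 2) * inverse (v - r) ^ (k - Suc 0))) (at v)" .
    moreover have eq: "real k * (- (i ^ 2) * i ^ (k - Suc 0)) = - real k * i ^ Suc k" for i :: real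
      by (cases k) (simp_all add: power2_eq_square algebra_simps)
    ultimately show ?thesis unfolding eq by simp
  qed
  have "deriv_bound n I (real k * ((real (Suc k + n)) ^ n / \<delta> ^ (Suc k + n)))
      (\<lambda>v. - real k * inverse (v - r) ^ Suc k)"
    using deriv_bound_cmult[OF Suc, of "- real k" "Suc k"] by simp
  moreover have "real k * ((real (Suc k + n)) ^ n / \<delta> ^ (Suc k + n))
      \<le> real (k + Suc n) ^ Suc n / \<delta> ^ (k + Suc n)"
    using assms by (auto simp: divide_simps intro!: mult_right_mono)
  ultimately have "deriv_bound n I (real (k + Suc n) ^ Suc n / \<delta> ^ (k + Suc n))
      (\<lambda>v. - real k * inverse (v - r) ^ Suc k)" by (rule deriv_bound_mono)
  moreover have "\<bar>inverse (v - r) ^ k\<bar> \<le> real (k + Suc n) ^ Suc n / \<delta> ^ (k + Suc n)"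
    if "v \<in> I" for v
  proof -
    have "1 / \<delta> ^ k \<le> 1 / \<delta> ^ (k + Suc n)"
      using assms by (intro divide_left_mono power_decreasing) auto
    also have "\<dots> \<le> real (k + Suc n) ^ Suc n / \<delta> ^ (k + Suc n)"
      using assms by (intro divide_right_mono one_le_power) auto
    finally show ?thesis using b[OF that] by (rule order_trans[rotated])
  qed
  ultimately show ?case using d by (rule deriv_bound_SucI)
qed

text \<open>
  The exponent is written \<open>y - i\<close> because the induction lowers it by one at each differentiation,
  while the factor \<open>b powr y\<close> has to survive unchanged: it is the source of the exponential decay in
  \<open>y\<close> when \<open>b < 1\<close>.
\<close>

lemma deriv_bound_powr:
  assumes "I \<subseteq> {a..b}" "0 < a" "a \<le> 1" "0 \<le> y"
  shows "deriv_bound n I ((y + real (i + n)) ^ n * b powr y / a ^ (i + n)) (\<lambda>u. u powr (y - real i))"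
proof (induction n arbitrary: i)
  have b: "\<bar>u powr (y - real i)\<bar> \<le> b powr y / a ^ i" if "u \<in> I" for u i
  proof -
    have u: "a \<le> u" "u \<le> b" using that assms by auto
    have "u powr (y - real i) = u powr y / u ^ i"
      using u assms by (simp add: powr_diff powr_realpow)
    also have "\<dots> \<le> b powr y / a ^ i"
      using u assms by (intro frac_le powr_mono2 power_mono) auto
    finally show ?thesis by simp
  qed
  case 0
  then show ?case using b by simp
  case (Suc n)
  have d: "((\<lambda>u. u powr (y - real i)) has_real_derivative (y - real i) * u powr (y - real (Suc i))) (at u)"
    if "u \<in> I" for u
  proof -
    have "u > 0" using assms that by fastforce
    then show ?thesis
      using has_real_derivative_powr[of u "y - real i"] by (simp add: algebra_simps)
  qed
  have "deriv_bound n I (\<bar>y - real i\<bar> * ((y + real (Suc i + n)) ^ n * b powr y / a ^ (Suc i + n)))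
      (\<lambda>u. (y - real i) * u powr (y - real (Suc i)))"
    by (rule deriv_bound_cmult[OF Suc])
  moreover have "\<bar>y - real i\<bar> * ((y + real (Suc i + n)) ^ n * b powr y / a ^ (Suc i + n))
      \<le> (y + real (i + Suc n)) ^ Suc n * b powr y / a ^ (i + Suc n)"
  proof -
    have "\<bar>y - real i\<bar> * ((y + real (Suc i + n)) ^ n * b powr y / a ^ (Suc i + n))
      \<le> (y + real (i + Suc n)) * ((y + real (Suc i + n)) ^ n * b powr y / a ^ (Suc i + n))"
      using assms by (intro mult_right_mono) auto
    then show ?thesis by (simp add: mult_ac)
  qed
  ultimately have "deriv_bound n I ((y + real (i + Suc n)) ^ Suc n * b powr y / a ^ (i + Suc n))
      (\<lambda>u. (y - real i) * u powr (y - real (Suc i)))" by (rule deriv_bound_mono)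
  moreover have "\<bar>u powr (y - real i)\<bar> \<le> (y + real (i + Suc n)) ^ Suc n * b powr y / a ^ (i + Suc n)"
    if "u \<in> I" for u
  proof -
    have "a ^ (i + Suc n) \<le> a ^ i" using assms by (intro power_decreasing) auto
    then have "b powr y / a ^ i \<le> 1 * b powr y / a ^ (i + Suc n)"
      using assms unfolding mult_1 by (intro divide_left_mono) auto
    also have "\<dots> \<le> (y + real (i + Suc n)) ^ Suc n * b powr y / a ^ (i + Suc n)"
      using assms by (intro divide_right_mono mult_right_mono one_le_power) auto
    finally show ?thesis using b[OF that, of i] by (rule order_trans[rotated])
  qed
  ultimately show ?case using d by (rule deriv_bound_SucI)
qed

section \<open>Polynomial interpolation with bounded coefficients\<close>

lemma Rolle_finite_set:
  fixes f f' :: "real \<Rightarrow> real"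
  assumes "finite V" "card V = Suc n" "\<And>v. v \<in> V \<Longrightarrow> f v = 0"
    and "\<And>v. v \<in> {Min V..Max V} \<Longrightarrow> (f has_real_derivative f' v) (at v)"
  shows "\<exists>W\<subseteq>{Min V..Max V}. finite W \<and> card W = n \<and> (\<forall>w\<in>W. f' w = 0)"
  using assms
proof (induction n arbitrary: V)
  case 0
  then show ?case by (intro exI[of _ "{}"]) auto
next
  case (Suc n)
  define x where "x = Max V"
  define V0 where "V0 = V - {x}"
  have ne: "V \<noteq> {}" using Suc.prems by auto
  have xV: "x \<in> V" unfolding x_def using Suc.prems ne by simp
  have c0: "card V0 = Suc n" "finite V0" using Suc.prems xV by (auto simp: V0_def)
  then have ne0: "V0 \<noteq> {}" by auto
  have mM: "Max V0 \<in> V0" "Min V0 \<in> V0" using c0 ne0 by auto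
  have lt: "Max V0 < x" using mM(1) Suc.prems(1) by (auto simp: V0_def x_def order_less_le)
  have mm: "Min V \<le> Min V0" using mM Suc.prems(1) by (auto simp: V0_def)
  have "\<exists>W\<subseteq>{Min V0..Max V0}. finite W \<and> card W = n \<and> (\<forall>w\<in>W. f' w = 0)"
  proof (rule Suc.IH[OF c0(2,1)])
    show "f v = 0" if "v \<in> V0" for v using Suc.prems that by (auto simp: V0_def)
    show "(f has_real_derivative f' v) (at v)" if "v \<in> {Min V0..Max V0}" for v
      using that mm lt by (intro Suc.prems) (auto simp: x_def)
  qed
  then obtain W where W: "W \<subseteq> {Min V0..Max V0}" "finite W" "card W = n" "\<forall>w\<in>W. f' w = 0" by blast
  have "Min V0 \<le> Max V0" using c0 mM(1) by simp
  then have der: "(f has_real_derivative f' v) (at v)" if "Max V0 \<le> v" "v \<le> x" for v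
    using that mm lt by (intro Suc.prems) (auto simp: x_def)
  have "\<exists>z>Max V0. z < x \<and> f' z = 0"
  proof -
    have "\<exists>z>Max V0. z < x \<and> f x - f (Max V0) = (x - Max V0) * f' z"
      using lt der by (intro MVT2) auto
    then obtain z where z: "Max V0 < z" "z < x" "f x - f (Max V0) = (x - Max V0) * f' z"
      by blast
    moreover have "f x = 0" "f (Max V0) = 0" using xV mM Suc.prems by (auto simp: V0_def)
    ultimately show ?thesis using z by auto
  qed
  then obtain z where z: "z > Max V0" "z < x" "f' z = 0" by blast
  have "z \<notin> W" using W z by fastforce
  then have "finite (insert z W)" "card (insert z W) = Suc n" using W by auto
  moreover have "insert z W \<subseteq> {Min V..Max V}"
    using W z mm \<open>Min V0 \<le> Max V0\<close> by (fastforce simp: x_def)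
  ultimately show ?case using W z by (intro exI[of _ "insert z W"]) auto
qed

text \<open>
  The mean value theorem for divided differences: \<open>g - p\<close> has \<open>n + 1\<close> zeros, so by Rolle its derivative
  has \<open>n\<close> zeros, and so on down to a point where the constant \<open>n!\<close> times the coefficient equals
  the \<open>n\<close>-th derivative of \<open>g\<close>.
\<close>

lemma interpolation_leading_coeff_bound:
  assumes "deriv_bound n {\<alpha>..\<beta>} K g" "degree p \<le> n" "V \<subseteq> {\<alpha>..\<beta>}" "finite V" "card V = Suc n"
    and "\<And>v. v \<in> V \<Longrightarrow> poly p v = g v"
  shows "\<bar>coeff p n\<bar> \<le> K"
proof -
  have "fact n * \<bar>coeff p n\<bar> \<le> K"
    using assms
  proof (induction n arbitrary: g p V)
    case 0
    then obtain v where v: "v \<in> V" by fastforce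
    have "poly p v = coeff p 0" using 0 by (auto elim: degree_eq_zeroE)
    then show ?case using 0 v by fastforce
  next
    case (Suc n)
    from Suc.prems(1) obtain g' where g': "\<forall>u\<in>{\<alpha>..\<beta>}. (g has_real_derivative g' u) (at u)"
      "deriv_bound n {\<alpha>..\<beta>} K g'" by auto
    have ne: "V \<noteq> {}" using Suc.prems by auto
    then have "Min V \<in> {\<alpha>..\<beta>}" "Max V \<in> {\<alpha>..\<beta>}"
      using Suc.prems Min_in Max_in by blast+
    then have sub: "{Min V..Max V} \<subseteq> {\<alpha>..\<beta>}" by auto
    have "\<exists>W\<subseteq>{Min V..Max V}. finite W \<and> card W = Suc n \<and> (\<forall>w\<in>W. poly (pderiv p) w - g' w = 0)"
      using Suc.prems sub g'
      by (intro Rolle_finite_set[where f = "\<lambda>v. poly p v - g v"])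
         (auto intro!: derivative_intros poly_DERIV)
    then obtain W where W: "W \<subseteq> {Min V..Max V}" "finite W" "card W = Suc n"
      "\<forall>w\<in>W. poly (pderiv p) w - g' w = 0" by blast
    have "fact n * \<bar>coeff (pderiv p) n\<bar> \<le> K"
      using W sub Suc.prems(2) by (intro Suc.IH[OF g'(2)]) (auto simp: degree_pderiv)
    then show ?case by (simp add: coeff_pderiv abs_mult mult_ac)
  qed
  moreover have "1 * \<bar>coeff p n\<bar> \<le> fact n * \<bar>coeff p n\<bar>" by (intro mult_right_mono) auto
  ultimately show ?thesis by linarith
qed

text \<open>
  This norm bounds the effect of a polynomial in a translation operator on any function
  norm for which translations are contractions, and it is submultiplicative.
\<close>

definition l1_norm :: "real poly \<Rightarrow> real" where
  "l1_norm p = (\<Sum>i\<le>degree p. \<bar>coeff p i\<bar>)"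

lemma l1_norm_nonneg [simp]: "0 \<le> l1_norm p"
  by (simp add: l1_norm_def sum_nonneg)

lemma l1_norm_eq: "degree p \<le> n \<Longrightarrow> l1_norm p = (\<Sum>i\<le>n. \<bar>coeff p i\<bar>)"
  unfolding l1_norm_def by (rule sum.mono_neutral_left) (auto simp: coeff_eq_0)

lemma l1_norm_0 [simp]: "l1_norm 0 = 0" by (simp add: l1_norm_def)

lemma coeff_le_l1_norm: "\<bar>coeff p k\<bar> \<le> l1_norm p"
proof (cases "k \<le> degree p")
  case True
  then show ?thesis unfolding l1_norm_def by (intro member_le_sum[where f = "\<lambda>i. \<bar>coeff p i\<bar>"]) auto
qed (simp add: coeff_eq_0)

lemma l1_norm_pCons [simp]: "l1_norm (pCons a p) = \<bar>a\<bar> + l1_norm p"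
proof -
  have "l1_norm (pCons a p) = (\<Sum>i\<le>Suc (degree p). \<bar>coeff (pCons a p) i\<bar>)"
    by (rule l1_norm_eq) (simp add: degree_pCons_le)
  then show ?thesis by (simp add: sum.atMost_Suc_shift l1_norm_def del: sum.atMost_Suc)
qed

lemma l1_norm_add: "l1_norm (p + q) \<le> l1_norm p + l1_norm q"
proof -
  let ?n = "max (degree p) (degree q)"
  have "l1_norm (p + q) = (\<Sum>i\<le>?n. \<bar>coeff (p + q) i\<bar>)"
    by (rule l1_norm_eq) (simp add: degree_add_le_max)
  also have "\<dots> \<le> (\<Sum>i\<le>?n. \<bar>coeff p i\<bar> + \<bar>coeff q i\<bar>)"
    by (intro sum_mono) (simp add: abs_triangle_ineq)
  also have "\<dots> = l1_norm p + l1_norm q"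
    by (simp add: sum.distrib l1_norm_eq[of p ?n] l1_norm_eq[of q ?n])
  finally show ?thesis .
qed

lemma l1_norm_smult: "l1_norm (smult c p) = \<bar>c\<bar> * l1_norm p"
  by (simp add: l1_norm_eq[of "smult c p" "degree p", OF degree_smult_le] l1_norm_def
      abs_mult sum_distrib_left)

lemma l1_norm_mult: "l1_norm (p * q) \<le> l1_norm p * l1_norm q"
proof (induction p)
  case (pCons a p)
  have "l1_norm (pCons a p * q) \<le> l1_norm (smult a q) + l1_norm (pCons 0 (p * q))"
    by (simp add: l1_norm_add del: l1_norm_pCons)
  also have "\<dots> \<le> (\<bar>a\<bar> + l1_norm p) * l1_norm q"
    using pCons by (simp add: l1_norm_smult algebra_simps)
  finally show ?case by simp
qed simp

lemma l1_norm_prod_list_linear: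
  "(\<And>r. r \<in> set rs \<Longrightarrow> \<bar>r\<bar> \<le> 1) \<Longrightarrow> l1_norm (\<Prod>r\<leftarrow>rs. [:-r, 1:]) \<le> 2 ^ length rs"
proof (induction rs)
  case Nil
  then show ?case by (simp add: one_pCons)
next
  case (Cons r rs)
  have "l1_norm (\<Prod>r\<leftarrow>(r # rs). [:-r, 1:]) \<le> l1_norm [:-r, 1:] * l1_norm (\<Prod>r\<leftarrow>rs. [:-r, 1:])"
    using l1_norm_mult[of "[:-r, 1:]"] by simp
  also have "\<dots> \<le> 2 * 2 ^ length rs"
    using Cons by (intro mult_mono) auto
  finally show ?case by simp
qed

lemma degree_prod_list_linear: "degree (\<Prod>r\<leftarrow>rs. [:-r, 1::real:]) \<le> length rs"
proof (induction rs)
  case (Cons r rs)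
  have "degree ([:-r, 1:] * (\<Prod>r\<leftarrow>rs. [:-r, 1::real:])) \<le> degree [:-r, 1:] + degree (\<Prod>r\<leftarrow>rs. [:-r, 1::real:])"
    by (rule degree_mult_le)
  then show ?case using Cons by simp
qed simp

lemma poly_prod_list_linear: "poly (\<Prod>r\<leftarrow>rs. [:-r, 1:]) (v::real) = (\<Prod>r\<leftarrow>rs. v - r)"
  by (induction rs) (auto simp: algebra_simps)

text \<open>
  Newton interpolation. The bound does not see the distances between the nodes, since the
  coefficients in the Newton basis are divided differences. This uniformity is what allows several
  exponents to come arbitrarily close to each other.
\<close>

lemma interpolation_poly_exists:
  assumes "deriv_bound n {\<alpha>..\<beta>} K g" "V \<subseteq> {\<alpha>..\<beta>}" "0 \<le> \<alpha>" "\<beta> \<le> 1" "finite V" "card V \<le> Suc n"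
    "0 \<le> K"
  shows "\<exists>p. degree p \<le> n \<and> (\<forall>v\<in>V. poly p v = g v) \<and> l1_norm p \<le> 2 ^ Suc n * K"
proof -
  have "\<exists>p. (p = 0 \<or> degree p < card V) \<and> (\<forall>v\<in>V. poly p v = g v) \<and> l1_norm p \<le> (2 ^ card V) * K"
    using \<open>finite V\<close> assms(2,6)
  proof (induction V)
    case empty
    then show ?case using assms by (intro exI[of _ 0]) auto
  next
    case (insert v V)
    then obtain p where p: "p = 0 \<or> degree p < card V" "\<forall>v\<in>V. poly p v = g v"
      "l1_norm p \<le> 2 ^ card V * K" by auto
    obtain rs where rs: "set rs = V" "length rs = card V"
      using finite_distinct_list[OF insert(1)] distinct_card by metis
    define w where "w = (\<Prod>r\<leftarrow>rs. [:-r, 1::real:])"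
    have wV: "poly w x = 0" if "x \<in> V" for x
      using that rs by (auto simp: w_def poly_prod_list_linear prod_list_zero_iff image_iff)
    have wv: "poly w v \<noteq> 0"
      using rs insert by (auto simp: w_def poly_prod_list_linear prod_list_zero_iff image_iff)
    have wdeg: "degree w \<le> card V" using degree_prod_list_linear rs by (metis w_def)
    have wl: "coeff w (card V) = 1"
    proof -
      have "lead_coeff w = 1 \<and> degree w = length rs"
        unfolding w_def
      proof (induction rs)
        case (Cons r rs)
        let ?P = "\<Prod>r\<leftarrow>rs. [:-r, 1::real:]"
        have "?P \<noteq> 0" using Cons by auto
        then have "degree ([:-r, 1:] * ?P) = Suc (length rs)"
          using Cons by (simp add: degree_mult_eq del: mult_pCons_left)
        moreover have "lead_coeff ([:-r, 1:] * ?P) = 1"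
          unfolding lead_coeff_mult using Cons by auto
        ultimately show ?case by simp
      qed simp
      then show ?thesis using rs by auto
    qed
    define c where "c = (g v - poly p v) / poly w v"
    define p' where "p' = p + smult c w"
    have p'V: "poly p' x = g x" if "x \<in> insert v V" for x
      using that p wV wv by (auto simp: p'_def c_def)
    have p'deg: "degree p' \<le> card V"
      unfolding p'_def using p wdeg degree_smult_le[of c w]
      by (intro degree_add_le) auto
    have "coeff p (card V) = 0" using p by (auto simp: coeff_eq_0)
    then have cc: "coeff p' (card V) = c" by (simp add: p'_def wl)
    have "card V \<le> n" using insert by simp
    then have "\<bar>coeff p' (card V)\<bar> \<le> K"
      using insert p'V p'deg assms(1)
      by (intro interpolation_leading_coeff_bound[where V = "insert v V" and g = g and \<alpha> = \<alpha> and \<beta> = \<beta>])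
         (auto intro: deriv_bound_order_mono)
    then have cK: "\<bar>c\<bar> \<le> K" using cc by simp
    have "l1_norm p' \<le> l1_norm p + \<bar>c\<bar> * l1_norm w"
      unfolding p'_def using l1_norm_add[of p "smult c w"] by (simp add: l1_norm_smult)
    also have "\<dots> \<le> 2 ^ card V * K + K * 2 ^ card V"
    proof -
      have "l1_norm w \<le> 2 ^ card V"
        unfolding w_def rs(2)[symmetric] using rs insert.prems assms(3,4)
        by (intro l1_norm_prod_list_linear) force
      then show ?thesis using p cK assms by (intro add_mono mult_mono) auto
    qed
    finally have "l1_norm p' \<le> 2 ^ card (insert v V) * K" using insert(1,2) by (simp add: mult_ac)
    moreover have "p' = 0 \<or> degree p' < card (insert v V)" using p'deg insert by auto
    ultimately show ?case using p'V by blast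
  qed
  then obtain p where p: "p = 0 \<or> degree p < card V" "\<forall>v\<in>V. poly p v = g v" "l1_norm p \<le> (2 ^ card V) * K"
    by blast
  have "(2::real) ^ card V * K \<le> 2 ^ Suc n * K"
    using assms by (intro mult_right_mono power_increasing) auto
  then show ?thesis using p assms(6) by (intro exI[of _ p]) auto
qed

section \<open>Filter polynomials\<close>

lemma poly_exp_bounded:
  fixes \<epsilon> c :: real
  assumes "0 < \<epsilon>" "0 \<le> c"
  shows "\<exists>C>0. \<forall>y\<ge>0. (y + c) ^ n \<le> C * exp (\<epsilon> * y)"
proof -
  define A where "A = real (Suc n) / \<epsilon> + c"
  have A: "A > 0" using assms by (simp add: A_def add_pos_nonneg)
  have "(y + c) ^ n \<le> A ^ n * exp (\<epsilon> * y)" if "y \<ge> 0" for y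
  proof -
    define e where "e = exp (\<epsilon> * y / real (Suc n))"
    have e1: "1 + \<epsilon> * y / real (Suc n) \<le> e" unfolding e_def by (rule exp_ge_add_one_self)
    have e0: "1 \<le> e" using assms that by (simp add: e_def)
    have "y = real (Suc n) / \<epsilon> * (\<epsilon> * y / real (Suc n))" using assms by simp
    also have "\<dots> \<le> real (Suc n) / \<epsilon> * e"
      using e1 assms by (intro mult_left_mono) auto
    finally have "y + c \<le> A * e"
      using mult_left_mono[OF e0 assms(2)] by (simp add: A_def distrib_right)
    then have "(y + c) ^ n \<le> (A * e) ^ n" using that assms by (intro power_mono) auto
    also have "\<dots> \<le> A ^ n * e ^ Suc n"
      unfolding power_mult_distrib using A e0 by (intro mult_left_mono power_increasing) auto
    also have "e ^ Suc n = exp (\<epsilon> * y)"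
      unfolding e_def exp_of_nat_mult[symmetric] by simp
    finally show ?thesis .
  qed
  then show ?thesis using A by (intro exI[of _ "A ^ n"]) auto
qed

lemma powr_exp_le_inverse_power:
  fixes \<gamma> \<sigma> :: real
  assumes "0 < \<gamma>"
  shows "\<exists>C>0. \<forall>z\<ge>1. exp (- (\<gamma> * z)) * z powr \<sigma> \<le> C * (1 / z) ^ m"
proof -
  define k where "k = nat \<lceil>\<sigma> + real m\<rceil>"
  have k: "\<sigma> + real m \<le> real k" unfolding k_def by linarith
  obtain C where C: "C > 0" "\<And>y. y \<ge> 0 \<Longrightarrow> (y + 0) ^ k \<le> C * exp (\<gamma> * y)"
    using poly_exp_bounded[OF assms, of 0 k] by auto
  have "exp (- (\<gamma> * z)) * z powr \<sigma> \<le> C * (1 / z) ^ m" if z: "z \<ge> 1" for z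
  proof -
    have "z powr \<sigma> * z ^ m = z powr (\<sigma> + real m)" using z by (simp add: powr_add powr_realpow)
    also have "\<dots> \<le> z powr (real k)" using k z by (intro powr_mono) auto
    also have "\<dots> = z ^ k" using z by (simp add: powr_realpow)
    also have "\<dots> \<le> C * exp (\<gamma> * z)" using C(2)[of z] z by simp
    finally have "exp (- (\<gamma> * z)) * (z powr \<sigma> * z ^ m) \<le> exp (- (\<gamma> * z)) * (C * exp (\<gamma> * z))"
      by (intro mult_left_mono) auto
    also have "\<dots> = C" by (simp add: exp_minus field_simps)
    finally show ?thesis using z by (simp add: field_simps)
  qed
  then show ?thesis using C(1) by blast
qed

abbreviation node_interval :: "real \<Rightarrow> real set" where
  "node_interval \<kappa> \<equiv> {exp (- (2 * \<kappa>))..exp (- (1 / \<kappa>))}"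

lemma deriv_bound_powr_decay:
  fixes \<kappa> \<gamma> :: real
  assumes "0 < \<kappa>" "\<gamma> < 1 / \<kappa>"
  shows "\<exists>C>0. \<forall>y\<ge>0. deriv_bound n (node_interval \<kappa>) (C * exp (- (\<gamma> * y))) (\<lambda>u. u powr y)"
proof -
  obtain C where C: "C > 0" "\<And>y. y \<ge> 0 \<Longrightarrow> (y + real n) ^ n \<le> C * exp ((1 / \<kappa> - \<gamma>) * y)"
    using poly_exp_bounded[of "1 / \<kappa> - \<gamma>" "real n" n] assms by auto
  define a where "a = exp (- (2 * \<kappa>))"
  have "deriv_bound n {a..exp (- (1 / \<kappa>))} (C / a ^ n * exp (- (\<gamma> * y))) (\<lambda>u. u powr y)"
    if y: "y \<ge> 0" for y
  proof (rule deriv_bound_mono)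
    show "deriv_bound n {a..exp (- (1 / \<kappa>))}
      ((y + real (0 + n)) ^ n * exp (- (1 / \<kappa>)) powr y / a ^ (0 + n)) (\<lambda>u. u powr y)"
      using deriv_bound_powr[of "{a..exp (- (1 / \<kappa>))}" a "exp (- (1 / \<kappa>))" y n 0] y assms
      by (simp add: a_def)
    have "(y + real n) ^ n * exp (- (1 / \<kappa>)) powr y \<le> C * exp ((1 / \<kappa> - \<gamma>) * y) * exp (- (1 / \<kappa>)) powr y"
      using C(2)[OF y] by (intro mult_right_mono) auto
    also have "\<dots> = C * exp (- (\<gamma> * y))"
      by (simp add: powr_def exp_add[symmetric] algebra_simps)
    finally show "(y + real (0 + n)) ^ n * exp (- (1 / \<kappa>)) powr y / a ^ (0 + n) \<le> C / a ^ n * exp (- (\<gamma> * y))"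
      using divide_right_mono[of _ _ "a ^ n"] by (fastforce simp: a_def)
  qed
  then show ?thesis using C(1) unfolding a_def by (intro exI[of _ "C / exp (- (2 * \<kappa>)) ^ n"]) auto
qed

lemma deriv_bound_powr_minus_one:
  fixes \<kappa> :: real
  assumes "0 < \<kappa>"
  shows "\<exists>C>0. \<forall>y\<in>{0..1}. deriv_bound n (node_interval \<kappa>) (C * y) (\<lambda>u. u powr y - 1)"
proof -
  define a where "a = exp (- (2 * \<kappa>))"
  define b where "b = exp (- (1 / \<kappa>))"
  have a: "0 < a" "a \<le> 1" and b: "b \<le> 1" "0 < b" using assms by (auto simp: a_def b_def)
  have B: "\<bar>u powr y - 1\<bar> \<le> 2 * \<kappa> * y" if "u \<in> {a..b}" "y \<in> {0..1}" for u y
  proof -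
    have u: "0 < u" "u \<le> 1" using that a b by auto
    have "ln a \<le> ln u" using that a by (intro ln_mono) auto
    then have "- ln u \<le> 2 * \<kappa>" by (simp add: a_def)
    then have "y * (- ln u) \<le> y * (2 * \<kappa>)" using that by (intro mult_left_mono) auto
    moreover have "1 + y * ln u \<le> u powr y" using u exp_ge_add_one_self[of "y * ln u"] by (simp add: powr_def)
    moreover have "u powr y \<le> 1" using u that by (intro powr_le1) auto
    ultimately show ?thesis by (simp add: mult_ac)
  qed
  have "\<exists>C>0. \<forall>y\<in>{0..1}. deriv_bound n {a..b} (C * y) (\<lambda>u. u powr y - 1)"
  proof (cases n)
    case 0
    then show ?thesis using B assms by (intro exI[of _ "2 * \<kappa>"]) auto
  next
    case (Suc k)
    define C where "C = 2 * \<kappa> + (2 + real k) ^ k / a ^ (1 + k)"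
    have C: "2 * \<kappa> \<le> C" "(2 + real k) ^ k / a ^ (1 + k) \<le> C" using a assms by (auto simp: C_def)
    have "deriv_bound n {a..b} (C * y) (\<lambda>u. u powr y - 1)" if y: "y \<in> {0..1}" for y
      unfolding Suc
    proof (rule deriv_bound_SucI)
      show "((\<lambda>u. u powr y - 1) has_real_derivative y * u powr (y - real 1)) (at u)" if "u \<in> {a..b}" for u
        using that a by (auto intro!: derivative_eq_intros)
      have "deriv_bound k {a..b} (\<bar>y\<bar> * ((y + real (1 + k)) ^ k * b powr y / a ^ (1 + k)))
        (\<lambda>u. y * u powr (y - real 1))"
        using a b y by (intro deriv_bound_cmult deriv_bound_powr) auto
      moreover have "\<bar>y\<bar> * ((y + real (1 + k)) ^ k * b powr y / a ^ (1 + k)) \<le> C * y"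
      proof -
        have "(y + real (1 + k)) ^ k * b powr y / a ^ (1 + k) \<le> (2 + real k) ^ k * 1 / a ^ (1 + k)"
          using y a b by (intro divide_right_mono mult_mono power_mono powr_le1) auto
        also have "\<dots> \<le> C" using C(2) by simp
        finally have "y * ((y + real (1 + k)) ^ k * b powr y / a ^ (1 + k)) \<le> y * C"
          using y by (intro mult_left_mono) auto
        then show ?thesis using y by (simp only: mult.commute[of C y] abs_of_nonneg atLeastAtMost_iff)
      qed
      ultimately show "deriv_bound k {a..b} (C * y) (\<lambda>u. y * u powr (y - real 1))"
        by (rule deriv_bound_mono)
      show "\<bar>u powr y - 1\<bar> \<le> C * y" if "u \<in> {a..b}" for u
        using B[OF that y] C(1) y by (meson atLeastAtMost_iff mult_right_mono order_trans)
    qed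
    moreover have "C > 0" using C assms by linarith
    ultimately show ?thesis by blast
  qed
  then show ?thesis by (simp add: a_def b_def)
qed

text \<open>
  \<open>kmin\<close> is the order of vanishing of \<open>W\<close> at \<open>0\<close>: with \<open>kmin = 1\<close> the decay of \<open>u powr y\<close> for large \<open>y\<close>
  passes to \<open>W (u powr y)\<close>, which it would not do in the presence of a constant term.
\<close>

lemma deriv_bound_poly_powr:
  assumes I: "I \<subseteq> {0<..}" and K: "\<And>k. kmin \<le> k \<Longrightarrow> deriv_bound n I K (\<lambda>u. u powr (real k * y))"
    and W: "\<And>k. k < kmin \<Longrightarrow> coeff W k = 0"
  shows "deriv_bound n I (l1_norm W * K) (\<lambda>u. poly W (u powr y))"
proof (rule deriv_bound_cong)
  have "deriv_bound n I (\<bar>coeff W k\<bar> * K) (\<lambda>u. coeff W k * u powr (real k * y))" for k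
  proof (cases "kmin \<le> k")
    case True
    then show ?thesis by (intro deriv_bound_cmult K)
  next
    case False
    then show ?thesis using W by (simp add: deriv_bound_const)
  qed
  then have "deriv_bound n I (\<Sum>k\<le>degree W. \<bar>coeff W k\<bar> * K) (\<lambda>u. \<Sum>k\<le>degree W. coeff W k * u powr (real k * y))"
    by (intro deriv_bound_sum)
  then show "deriv_bound n I (l1_norm W * K) (\<lambda>u. \<Sum>k\<le>degree W. coeff W k * u powr (real k * y))"
    by (simp add: l1_norm_def sum_distrib_right)
  show "(\<Sum>k\<le>degree W. coeff W k * u powr (real k * y)) = poly W (u powr y)" if "u \<in> {0<..}" for u
    using that by (simp add: poly_altdef powr_power mult.commute)
qed (use I in auto)

text \<open>
  The polynomial \<open>(X - 1)^m * W\<close> takes the values \<open>v powr y\<close> at the nodes in \<open>V\<close>, vanishes to order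
  \<open>m\<close> at \<open>1\<close> and at least once at \<open>0\<close> and at the points of \<open>vs\<close>. It is the product of the prescribed
  linear factors with a polynomial interpolating \<open>v powr y\<close> divided by these factors; the quotient
  has bounded derivatives as the roots stay away from the interval of the nodes. That the
  coefficients grow only geometrically in the number of roots is essential later.
\<close>

lemma filter_poly_exists:
  fixes a b \<delta> Y :: real
  assumes "0 < a" "a \<le> 1" "b < 1" "0 < \<delta>" "0 \<le> Y"
  shows "\<exists>B\<ge>1. \<forall>m vs \<alpha> \<beta> V y.
    a \<le> \<alpha> \<longrightarrow> \<beta> \<le> b \<longrightarrow> V \<subseteq> {\<alpha>..\<beta>} \<longrightarrow> finite V \<longrightarrow> card V \<le> Suc n \<longrightarrow> 0 \<le> y \<longrightarrow> y \<le> Y \<longrightarrow>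
    (\<forall>r\<in>set vs. \<bar>r\<bar> \<le> 1 \<and> (\<forall>v\<in>{\<alpha>..\<beta>}. \<delta> \<le> \<bar>v - r\<bar>)) \<longrightarrow>
    (\<exists>W. degree W \<le> 1 + length vs + n \<and> coeff W 0 = 0 \<and> l1_norm W \<le> B ^ (1 + m + length vs) \<and>
      (\<forall>r\<in>set vs. poly W r = 0) \<and> (\<forall>v\<in>V. (v - 1) ^ m * poly W v = v powr y))"
proof -
  define \<delta>' where "\<delta>' = min (min 1 \<delta>) (min a (1 - b))"
  have d: "0 < \<delta>'" "\<delta>' \<le> 1" "\<delta>' \<le> \<delta>" "\<delta>' \<le> a" "\<delta>' \<le> 1 - b" using assms by (auto simp: \<delta>'_def)
  define K1 where "K1 = real (1 + n) ^ n / \<delta>' ^ (1 + n)"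
  define K0 where "K0 = 1 + (Y + real n) ^ n / a ^ n"
  have K1: "1 \<le> K1"
  proof -
    have "\<delta>' ^ (1 + n) \<le> 1" using d by (intro power_le_one) auto
    also have "1 \<le> real (1 + n) ^ n" by (rule one_le_power) simp
    finally show ?thesis using d unfolding K1_def by (simp add: le_divide_eq)
  qed
  have K0: "1 \<le> K0" using assms by (simp add: K0_def)
  define B where "B = 2 * (2 ^ Suc n * 2 ^ n * K0) * (2 ^ n * K1)"
  have c: "1 \<le> 2 ^ Suc n * 2 ^ n * K0" "1 \<le> 2 ^ n * K1"
    using K0 K1 by (auto intro!: mult_ge1_I simp del: power_Suc)
  have "1 \<le> 2 * (2 ^ Suc n * 2 ^ n * K0)" using c(1) by linarith
  then have B: "1 \<le> B" unfolding B_def using c(2) by (rule mult_ge1_I)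
  show ?thesis
  proof (intro exI[of _ B] conjI allI impI B)
    fix m :: nat and vs :: "real list" and \<alpha> \<beta> :: real and V :: "real set" and y :: real
    assume h: "a \<le> \<alpha>" "\<beta> \<le> b" "V \<subseteq> {\<alpha>..\<beta>}" "finite V" "card V \<le> Suc n" "0 \<le> y" "y \<le> Y"
      "\<forall>r\<in>set vs. \<bar>r\<bar> \<le> 1 \<and> (\<forall>v\<in>{\<alpha>..\<beta>}. \<delta> \<le> \<bar>v - r\<bar>)"
    \<comment> \<open>All prescribed roots with multiplicity; each stays at distance \<open>\<delta>'\<close> from the interval.\<close>
    define rs where "rs = 0 # replicate m 1 @ vs"
    let ?l = "1 + m + length vs"
    define g where "g = (\<lambda>v. v powr y * (\<Prod>r\<leftarrow>rs. inverse (v - r) ^ 1))"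
    have sep: "\<delta>' \<le> \<bar>v - r\<bar>" if rv: "r \<in> set rs" "v \<in> {\<alpha>..\<beta>}" for r v
    proof -
      consider "r = 0" | "r = 1" | "r \<in> set vs" using rv(1) by (auto simp: rs_def)
      then show ?thesis
      proof cases
        case 3
        then have "\<delta> \<le> \<bar>v - r\<bar>" using rv(2) h(8) by blast
        then show ?thesis using d by linarith
      qed (use rv(2) h(1,2) d in auto)
    qed
    have "deriv_bound n {\<alpha>..\<beta>} ((2 ^ n * K1) ^ length rs) (\<lambda>v. \<Prod>r\<leftarrow>rs. inverse (v - r) ^ 1)"
      unfolding K1_def using d sep by (intro deriv_bound_prod_list deriv_bound_inverse_power) auto
    moreover have "deriv_bound n {\<alpha>..\<beta>} K0 (\<lambda>v. v powr y)"
    proof (rule deriv_bound_mono)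
      show "deriv_bound n {\<alpha>..\<beta>} ((y + real (0 + n)) ^ n * 1 powr y / a ^ (0 + n)) (\<lambda>v. v powr y)"
        using deriv_bound_powr[of "{\<alpha>..\<beta>}" a 1 y n 0] h assms by auto
      have "(y + real n) ^ n / a ^ n \<le> (Y + real n) ^ n / a ^ n"
        using h assms by (intro divide_right_mono power_mono) auto
      then show "(y + real (0 + n)) ^ n * 1 powr y / a ^ (0 + n) \<le> K0" by (simp add: K0_def)
    qed
    ultimately have "deriv_bound n {\<alpha>..\<beta>} (2 ^ n * K0 * (2 ^ n * K1) ^ ?l) g"
      unfolding g_def using K0 K1 deriv_bound_mult[of n "{\<alpha>..\<beta>}" K0 "\<lambda>v. v powr y" "(2 ^ n * K1) ^ ?l"]
      by (simp add: rs_def)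
    moreover have "0 \<le> 2 ^ n * K0 * (2 ^ n * K1) ^ ?l" using K0 K1 by simp
    ultimately have "\<exists>Q. degree Q \<le> n \<and> (\<forall>v\<in>V. poly Q v = g v) \<and>
        l1_norm Q \<le> 2 ^ Suc n * (2 ^ n * K0 * (2 ^ n * K1) ^ ?l)"
      using h assms by (intro interpolation_poly_exists[where \<alpha> = \<alpha> and \<beta> = \<beta>]) auto
    then obtain Q where Q: "degree Q \<le> n" "\<forall>v\<in>V. poly Q v = g v"
      "l1_norm Q \<le> 2 ^ Suc n * (2 ^ n * K0 * (2 ^ n * K1) ^ ?l)" by blast
    define R where "R = (\<Prod>r\<leftarrow>vs. [:-r, 1::real:])"
    define W where "W = pCons 0 (R * Q)"
    have "degree W \<le> Suc (degree (R * Q))" unfolding W_def by (rule degree_pCons_le)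
    also have "degree (R * Q) \<le> length vs + n"
      using degree_mult_le[of R Q] degree_prod_list_linear[of vs] Q(1) by (simp add: R_def)
    finally have "degree W \<le> 1 + length vs + n" by simp
    moreover have "coeff W 0 = 0" by (simp add: W_def)
    moreover have "poly W r = 0" if "r \<in> set vs" for r
      using that by (auto simp: W_def R_def poly_prod_list_linear prod_list_zero_iff image_iff)
    moreover have "l1_norm W \<le> B ^ ?l"
    proof -
      have "l1_norm W \<le> l1_norm R * l1_norm Q" by (simp add: W_def l1_norm_mult)
      also have "\<dots> \<le> 2 ^ length vs * (2 ^ Suc n * (2 ^ n * K0 * (2 ^ n * K1) ^ ?l))"
        using Q(3) l1_norm_prod_list_linear[of vs] h by (intro mult_mono) (auto simp: R_def)
      also have "\<dots> = 2 ^ length vs * (2 ^ Suc n * 2 ^ n * K0) ^ 1 * (2 ^ n * K1) ^ ?l"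
        by simp
      also have "\<dots> \<le> 2 ^ ?l * (2 ^ Suc n * 2 ^ n * K0) ^ ?l * (2 ^ n * K1) ^ ?l"
        using c K0 K1 by (intro mult_right_mono mult_mono power_increasing) auto
      also have "\<dots> = B ^ ?l" by (simp only: B_def power_mult_distrib)
      finally show ?thesis .
    qed
    moreover have "(v - 1) ^ m * poly W v = v powr y" if "v \<in> V" for v
    proof -
      have "v \<in> {\<alpha>..\<beta>}" using that h by auto
      then have nz: "v - r \<noteq> 0" if "r \<in> set rs" for r using sep[OF that] d by fastforce
      have "(v - 1) ^ m * poly W v = (\<Prod>r\<leftarrow>rs. v - r) * g v"
        using Q(2) that by (simp add: W_def R_def poly_prod_list_linear rs_def)
      also have "\<dots> = v powr y * ((\<Prod>r\<leftarrow>rs. v - r) * (\<Prod>r\<leftarrow>rs. inverse (v - r) ^ 1))"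
        by (simp add: g_def mult_ac)
      also have "(\<Prod>r\<leftarrow>rs. v - r) * (\<Prod>r\<leftarrow>rs. inverse (v - r) ^ 1) = 1"
        using nz by (induction rs) (auto simp: field_simps)
      finally show ?thesis by simp
    qed
    ultimately show "\<exists>W. degree W \<le> 1 + length vs + n \<and> coeff W 0 = 0 \<and> l1_norm W \<le> B ^ (1 + m + length vs) \<and>
      (\<forall>r\<in>set vs. poly W r = 0) \<and> (\<forall>v\<in>V. (v - 1) ^ m * poly W v = v powr y)" by blast
  qed
qed


section \<open>Power means and weights\<close>

lemma geometric_sum_le:
  fixes \<theta> :: real
  assumes "0 \<le> \<theta>" "\<theta> < 1" "finite T" "inj_on f T"
  shows "(\<Sum>j\<in>T. \<theta> ^ f j) \<le> 1 / (1 - \<theta>)"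
proof -
  have "(\<Sum>j\<in>T. \<theta> ^ f j) = (\<Sum>k\<in>f ` T. \<theta> ^ k)"
    using assms by (simp add: sum.reindex)
  also have "\<dots> \<le> (\<Sum>k. \<theta> ^ k)"
    using assms by (intro sum_le_suminf summable_geometric) auto
  finally show ?thesis using assms by (simp add: suminf_geometric)
qed

text \<open>
  Jensen's inequality for the convex function \<open>x powr r\<close>. Points with \<open>y i = 0\<close> are removed first because
  the convexity is available on the open half line.
\<close>

lemma weighted_power_mean:
  fixes w y :: "'a \<Rightarrow> real"
  assumes "finite A" "\<And>i. i \<in> A \<Longrightarrow> 0 \<le> w i" "\<And>i. i \<in> A \<Longrightarrow> 0 \<le> y i" "sum w A \<le> S" "1 \<le> r"
  shows "(\<Sum>i\<in>A. w i * y i) powr r \<le> S powr (r - 1) * (\<Sum>i\<in>A. w i * y i powr r)"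
proof -
  define B where "B = {i\<in>A. 0 < y i}"
  have B: "finite B" "B \<subseteq> A" using assms by (auto simp: B_def)
  define W where "W = sum w B"
  have W: "0 \<le> W" "W \<le> S" unfolding W_def
    using B assms by (auto intro!: sum_nonneg intro: order_trans[OF sum_mono2 assms(4)])
  have e1: "(\<Sum>i\<in>A. w i * y i) = (\<Sum>i\<in>B. w i * y i)"
    using assms by (intro sum.mono_neutral_right) (auto simp: B_def not_less intro: antisym)
  have e2: "(\<Sum>i\<in>B. w i * y i powr r) \<le> (\<Sum>i\<in>A. w i * y i powr r)"
    using B assms by (intro sum_mono2) auto
  have nn: "0 \<le> (\<Sum>i\<in>B. w i * y i powr r)" using B assms by (intro sum_nonneg) auto
  show ?thesis
  proof (cases "W = 0")
    case True
    then have "\<forall>i\<in>B. w i = 0"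
      using B assms by (simp add: W_def sum_nonneg_eq_0_iff subset_eq)
    then have "(\<Sum>i\<in>B. w i * y i) = 0" by simp
    then show ?thesis using e1 e2 nn assms by (simp add: mult_nonneg_nonneg)
  next
    case False
    then have W0: "W > 0" "B \<noteq> {}" using W by (auto simp: W_def)
    have "(\<Sum>i\<in>B. (w i / W) *\<^sub>R y i) powr r \<le> (\<Sum>i\<in>B. (w i / W) * (y i powr r))"
    proof (rule convex_on_sum[OF B(1) W0(2) powr_convex[OF assms(5)]])
      show "(\<Sum>i\<in>B. w i / W) = 1" using W0 by (simp add: sum_divide_distrib[symmetric] W_def[symmetric])
    qed (use B assms W0 in \<open>auto simp: B_def\<close>)
    then have "((\<Sum>i\<in>B. w i * y i) / W) powr r \<le> (\<Sum>i\<in>B. w i * y i powr r) / W"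
      by (simp add: sum_divide_distrib)
    then have "W powr r * ((\<Sum>i\<in>B. w i * y i) / W) powr r \<le> W powr r * ((\<Sum>i\<in>B. w i * y i powr r) / W)"
      by (intro mult_left_mono) auto
    moreover have "W powr r * ((\<Sum>i\<in>B. w i * y i) / W) powr r = (\<Sum>i\<in>B. w i * y i) powr r"
    proof -
      have "0 \<le> (\<Sum>i\<in>B. w i * y i)" using B assms by (intro sum_nonneg) auto
      then show ?thesis using W0 by (subst powr_mult[symmetric]) auto
    qed
    moreover have "W powr r * ((\<Sum>i\<in>B. w i * y i powr r) / W) = W powr (r - 1) * (\<Sum>i\<in>B. w i * y i powr r)"
      using W0 by (simp add: powr_diff)
    moreover have "W powr (r - 1) * (\<Sum>i\<in>B. w i * y i powr r) \<le> S powr (r - 1) * (\<Sum>i\<in>A. w i * y i powr r)"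
      using W W0 assms e2 nn by (intro mult_mono powr_mono2) auto
    ultimately show ?thesis using e1 by simp
  qed
qed

lemma powr_add_le:
  fixes a b r :: real
  assumes "0 \<le> a" "0 \<le> b" "1 \<le> r"
  shows "(a + b) powr r \<le> 2 powr (r - 1) * (a powr r + b powr r)"
  using weighted_power_mean[of "UNIV :: bool set" "\<lambda>_. 1" "\<lambda>x. if x then a else b" 2 r] assms
  by (simp add: UNIV_bool add.commute)

lemma sum_powr_le_powr_sum:
  fixes y :: "'a \<Rightarrow> real"
  assumes "finite A" "\<And>i. i \<in> A \<Longrightarrow> 0 \<le> y i" "1 \<le> s"
  shows "(\<Sum>i\<in>A. y i powr s) \<le> (\<Sum>i\<in>A. y i) powr s"
proof -
  define Y where "Y = (\<Sum>i\<in>A. y i)"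
  have Y: "0 \<le> Y" unfolding Y_def using assms by (intro sum_nonneg) auto
  have split: "x powr s = x * x powr (s - 1)" if "0 \<le> x" for x :: real
    using that by (cases "x = 0") (auto simp: powr_diff)
  have "(\<Sum>i\<in>A. y i powr s) \<le> (\<Sum>i\<in>A. y i * Y powr (s - 1))"
  proof (rule sum_mono)
    fix i assume i: "i \<in> A"
    have "y i \<le> Y" unfolding Y_def using assms i by (intro member_le_sum) auto
    then show "y i powr s \<le> y i * Y powr (s - 1)"
      using assms i by (simp add: split mult_left_mono powr_mono2)
  qed
  also have "\<dots> = Y powr s" using Y by (simp add: split Y_def sum_distrib_right)
  finally show ?thesis by (simp add: Y_def)
qed

definition ratio_min :: "real \<Rightarrow> real \<Rightarrow> real" where
  "ratio_min x y = min (x / y) (y / x)"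

lemma ratio_min_commute: "ratio_min x y = ratio_min y x"
  by (simp add: ratio_min_def min.commute)

lemma nn_integral_weight_measure:
  assumes [measurable]: "\<psi> \<in> borel_measurable borel"
  shows "(\<integral>\<^sup>+t. \<psi> t \<partial>weight_measure a) = (\<integral>\<^sup>+t. ennreal ((1 - t) powr a) * \<psi> t * indicator {0..1} t \<partial>lborel)"
  unfolding weight_measure_def
  by (subst nn_integral_density)
     (auto simp: nn_integral_restrict_space intro!: measurable_restrict_space1)

text \<open>
  With \<open>t = exp (- x)\<close> the weight \<open>(1 - t) powr (\<alpha> - 1) dt\<close> is comparable to \<open>x powr (\<alpha> - 1) dx\<close> for
  bounded \<open>x\<close>, and \<open>\<Lambda>\<close> is comparable to \<open>1 / x\<close>. The exponent \<open>1 - \<alpha>\<close> can have either sign; its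
  absolute value serves both cases.
\<close>

lemma log_scale_weight_bound:
  fixes \<alpha> x k \<Lambda> X :: real
  assumes k: "1 \<le> k" and x: "0 < x" "x \<le> X" and L: "k \<le> \<Lambda> * x" "\<Lambda> * x \<le> 2 * k"
  shows "\<Lambda> powr (1 - \<alpha>) / k \<le> (2 * k) powr \<bar>1 - \<alpha>\<bar> * exp (X * \<bar>1 - \<alpha>\<bar>) * exp X * ((1 - exp (- x)) powr (\<alpha> - 1) * exp (- x))"
proof -
  define u where "u = \<Lambda> * x"
  define e where "e = 1 - exp (- x)"
  have e0: "0 < e" using x by (simp add: e_def)
  have L0: "0 < \<Lambda>" using k x L by (smt (verit) mult_nonpos_nonneg)
  define v where "v = x / e"
  have v1: "1 \<le> v" unfolding v_def e_def using x exp_ge_add_one_self[of "-x"] e0[unfolded e_def]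
    by (simp add: le_divide_eq)
  have v2: "v \<le> exp X"
  proof -
    have "x * exp (- x) \<le> (exp x - 1) * exp (- x)" using exp_ge_add_one_self[of x] by (intro mult_right_mono) (linarith, simp)
    also have "\<dots> = e" by (simp add: e_def algebra_simps exp_minus)
    finally have "x \<le> e * exp x" by (simp add: exp_minus field_simps)
    also have "\<dots> \<le> e * exp X" using x e0 by simp
    finally show ?thesis using e0 by (simp add: v_def field_simps)
  qed
  have u: "1 \<le> u" "u \<le> 2 * k" using k L by (auto simp: u_def)
  have "u powr (1 - \<alpha>) \<le> u powr \<bar>1 - \<alpha>\<bar>" using u by (intro powr_mono) auto
  also have "\<dots> \<le> (2 * k) powr \<bar>1 - \<alpha>\<bar>" using u by (intro powr_mono2) auto
  finally have U: "u powr (1 - \<alpha>) \<le> (2 * k) powr \<bar>1 - \<alpha>\<bar>" .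
  have "v powr (\<alpha> - 1) \<le> v powr \<bar>1 - \<alpha>\<bar>" using v1 by (intro powr_mono) auto
  also have "\<dots> \<le> exp X powr \<bar>1 - \<alpha>\<bar>" using v1 v2 by (intro powr_mono2) auto
  also have "\<dots> = exp (X * \<bar>1 - \<alpha>\<bar>)" by (simp add: powr_def mult.commute)
  finally have V: "v powr (\<alpha> - 1) \<le> exp (X * \<bar>1 - \<alpha>\<bar>)" .
  have "\<Lambda> = u / x" using x by (simp add: u_def)
  then have "\<Lambda> powr (1 - \<alpha>) = u powr (1 - \<alpha>) * x powr (\<alpha> - 1)"
    using u x by (simp add: powr_divide powr_diff)
  also have "x = v * e" using e0 by (simp add: v_def)
  also have "(v * e) powr (\<alpha> - 1) = v powr (\<alpha> - 1) * e powr (\<alpha> - 1)"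
    using v1 e0 by (simp add: powr_mult)
  also have "u powr (1 - \<alpha>) * (v powr (\<alpha> - 1) * e powr (\<alpha> - 1)) \<le>
    (2 * k) powr \<bar>1 - \<alpha>\<bar> * (exp (X * \<bar>1 - \<alpha>\<bar>) * e powr (\<alpha> - 1))"
    using U V by (intro mult_mono) auto
  also have "\<dots> \<le> (2 * k) powr \<bar>1 - \<alpha>\<bar> * (exp (X * \<bar>1 - \<alpha>\<bar>) * e powr (\<alpha> - 1)) * (exp X * exp (- x))"
  proof -
    have "1 \<le> exp X * exp (- x)" using x by (simp add: exp_add[symmetric])
    then show ?thesis using mult_left_mono[of 1 "exp X * exp (- x)"
        "(2 * k) powr \<bar>1 - \<alpha>\<bar> * (exp (X * \<bar>1 - \<alpha>\<bar>) * e powr (\<alpha> - 1))"] by simp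
  qed
  finally have "\<Lambda> powr (1 - \<alpha>) \<le> (2 * k) powr \<bar>1 - \<alpha>\<bar> * exp (X * \<bar>1 - \<alpha>\<bar>) * exp X * (e powr (\<alpha> - 1) * exp (- x))"
    by (simp add: mult_ac)
  moreover have "\<Lambda> powr (1 - \<alpha>) / k \<le> \<Lambda> powr (1 - \<alpha>) / 1" using k by (intro divide_left_mono) auto
  ultimately show ?thesis by (simp add: e_def)
qed

section \<open>Groups of exponents\<close>

text \<open>
  \<open>growth\<close> is quasi-lacunarity: up to the constant \<open>\<rho> ^ M\<close> the exponents grow at least
  geometrically in the index. \<open>G i\<close> is the group of the index \<open>i\<close>. A group has a bounded number of
  elements whose ratios stay below \<open>\<kappa>\<close>, and \<open>G_sep\<close> says that an exponent of another group lies
  entirely on one side of the group, at ratio at least \<open>\<tau>\<close>. Groups are indexed by their members, which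
  avoids enumerating them; sums over indices then count each group a bounded number of times.
\<close>

locale exponent_groups =
  fixes lam :: "nat \<Rightarrow> real" and G :: "nat \<Rightarrow> nat set" and \<rho> \<kappa> \<tau> :: real and M N :: nat
  assumes lam_pos: "\<And>k. 0 < lam k"
    and lam_mono: "strict_mono lam"
    and rho: "1 < \<rho>"
    and growth: "\<And>i j. i \<le> j \<Longrightarrow> \<rho> ^ j * lam i \<le> \<rho> ^ (M + i) * lam j"
    and kappa: "1 < \<kappa>" "\<kappa> \<le> \<rho>"
    and tau: "1 < \<tau>"
    and G_refl: "\<And>i. i \<in> G i"
    and G_eq: "\<And>i j. j \<in> G i \<Longrightarrow> G j = G i"
    and G_finite: "\<And>i. finite (G i)"
    and G_card: "\<And>i. card (G i) \<le> Suc N"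
    and G_ratio: "\<And>i j. j \<in> G i \<Longrightarrow> lam j \<le> \<kappa> * lam i"
    and G_sep: "\<And>i j. j \<notin> G i \<Longrightarrow>
      (\<forall>l\<in>G i. \<tau> * lam l \<le> lam j) \<or> (\<forall>l\<in>G i. \<tau> * lam j \<le> lam l)"
begin

abbreviation scale_ratio :: "nat \<Rightarrow> nat \<Rightarrow> real" where
  "scale_ratio i j \<equiv> ratio_min (lam i) (lam j)"

abbreviation decay :: "real \<Rightarrow> nat \<Rightarrow> real \<Rightarrow> real" where
  "decay \<gamma> i x \<equiv> exp (- (\<gamma> * lam i * x))"

lemma G_sym: "j \<in> G i \<Longrightarrow> i \<in> G j"
  using G_eq G_refl by blast

text \<open>
  A generalised polynomial \<open>\<Sum> a j * t powr lam j\<close> in the variable \<open>x = - ln t\<close>. In this variable the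
  exponentials are the eigenfunctions of the translations \<open>x \<mapsto> x + h\<close>, with eigenvalue
  \<open>exp (- lam j * h)\<close>.
\<close>

definition esum :: "(nat \<Rightarrow> complex) \<Rightarrow> nat set \<Rightarrow> real \<Rightarrow> complex" where
  "esum a S x = (\<Sum>j\<in>S. a j * of_real (exp (- lam j * x)))"

text \<open>
  The sampled values determine the group, since the group spans at most \<open>N + 1\<close> dimensions, and by
  \<open>group_decay\<close> they dominate it on the whole half line. A finite sum of samples is used instead of
  a supremum because the extraction below produces bounds at single points.
\<close>

definition group_size :: "(nat \<Rightarrow> complex) \<Rightarrow> nat \<Rightarrow> real" where
  "group_size a i = (\<Sum>n\<le>N. cmod (esum a (G i) (real n / lam i)))"

abbreviation normalised_size :: "real \<Rightarrow> (nat \<Rightarrow> complex) \<Rightarrow> nat \<Rightarrow> real" where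
  "normalised_size \<sigma> a i \<equiv> lam i powr (- \<sigma>) * group_size a i"

lemma group_size_nonneg: "0 \<le> group_size a i"
  by (simp add: group_size_def sum_nonneg)

abbreviation filtered :: "(nat \<Rightarrow> complex) \<Rightarrow> nat set \<Rightarrow> real poly \<Rightarrow> real \<Rightarrow> complex" where
  "filtered a S P h \<equiv> (\<Sum>l\<in>S. a l * complex_of_real (poly P (exp (- lam l * h))))"

lemma sum_poly_eq_shifts:
  assumes "degree P \<le> d"
  shows "(\<Sum>j\<in>S. a j * of_real (poly P (exp (- lam j * h)))) =
    (\<Sum>k\<le>d. of_real (coeff P k) * esum a S (real k * h))"
proof -
  have "poly P (exp (- lam j * h)) = (\<Sum>k\<le>d. coeff P k * exp (- lam j * (real k * h)))" for j
  proof -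
    have "poly P (exp (- lam j * h)) = (\<Sum>k\<le>degree P. coeff P k * exp (- lam j * h) ^ k)"
      by (rule poly_altdef)
    also have "\<dots> = (\<Sum>k\<le>d. coeff P k * exp (- lam j * h) ^ k)"
      using assms by (intro sum.mono_neutral_left) (auto simp: coeff_eq_0)
    finally show ?thesis by (simp add: exp_of_nat_mult[symmetric] mult_ac)
  qed
  then show ?thesis
    by (simp add: esum_def sum_distrib_left mult_ac sum.swap[of _ S])
qed

text \<open>
  Applying a multiplier \<open>g\<close> to the coefficients of a group is the same as applying a polynomial in the
  translation by \<open>h\<close> that interpolates \<open>g\<close> at the eigenvalues. The bound is uniform in the position
  of the exponents.
\<close>

lemma group_multiplier_bound:
  assumes "deriv_bound N {\<alpha>..\<beta>} K g" "0 \<le> \<alpha>" "\<beta> \<le> 1" "0 \<le> K" "h \<noteq> 0"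
    and "\<And>l. l \<in> G i \<Longrightarrow> exp (- lam l * h) \<in> {\<alpha>..\<beta>}"
  shows "cmod (\<Sum>l\<in>G i. a l * of_real (g (exp (- lam l * h))))
    \<le> 2 ^ Suc N * K * (\<Sum>n\<le>N. cmod (esum a (G i) (real n * h)))"
proof -
  define V where "V = (\<lambda>l. exp (- lam l * h)) ` G i"
  have "card V \<le> Suc N" unfolding V_def using card_image_le[OF G_finite] G_card order_trans by blast
  then obtain p where p: "degree p \<le> N" "\<forall>v\<in>V. poly p v = g v" "l1_norm p \<le> 2 ^ Suc N * K"
    using interpolation_poly_exists[of N \<alpha> \<beta> K g V] assms G_finite unfolding V_def by blast
  have "(\<Sum>l\<in>G i. a l * of_real (g (exp (- lam l * h)))) = (\<Sum>l\<in>G i. a l * of_real (poly p (exp (- lam l * h))))"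
    using p(2) by (intro sum.cong) (auto simp: V_def)
  also have "\<dots> = (\<Sum>k\<le>N. of_real (coeff p k) * esum a (G i) (real k * h))"
    by (rule sum_poly_eq_shifts[OF p(1)])
  also have "cmod \<dots> \<le> (\<Sum>k\<le>N. \<bar>coeff p k\<bar> * cmod (esum a (G i) (real k * h)))"
    by (rule order_trans[OF norm_sum]) (simp add: norm_mult)
  also have "\<dots> \<le> (\<Sum>k\<le>N. 2 ^ Suc N * K * cmod (esum a (G i) (real k * h)))"
    using coeff_le_l1_norm p(3) by (intro sum_mono mult_right_mono) (auto intro: order_trans)
  finally show ?thesis by (simp add: sum_distrib_left mult_ac)
qed

lemma group_node:
  assumes "l \<in> G i" "1 \<le> s" "s \<le> 2"
  shows "exp (- lam l * (s / lam i)) \<in> (node_interval \<kappa>)"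
proof -
  have "lam l * s \<le> (\<kappa> * lam i) * 2"
    using G_ratio[OF assms(1)] assms lam_pos[of i] kappa by (intro mult_mono) auto
  moreover have "lam i * 1 \<le> (\<kappa> * lam l) * s"
    using G_ratio[OF G_sym[OF assms(1)]] assms lam_pos[of l] lam_pos[of i] kappa by (intro mult_mono) auto
  ultimately show ?thesis using lam_pos[of i] kappa by (simp add: field_simps)
qed

lemma group_size_multiplier_bound:
  assumes "deriv_bound N (node_interval \<kappa>) K g" "0 \<le> K"
  shows "cmod (\<Sum>l\<in>G i. a l * of_real (g (exp (- lam l / lam i)))) \<le> 2 ^ Suc N * K * group_size a i"
  using group_multiplier_bound[OF assms(1) _ _ assms(2), of "1 / lam i" i a] group_node[of _ i 1]
    lam_pos[of i] kappa
  by (simp add: group_size_def)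

text \<open>
  The multiplier is \<open>u powr (lam i * x)\<close>. The rate is sharp up to the ratio \<open>\<kappa>\<close>, so it can be brought
  as close to \<open>1\<close> as desired by taking \<open>\<kappa>\<close> close to \<open>1\<close>; this is where the room between \<open>p\<close> and \<open>r\<close>
  will be spent.
\<close>

lemma group_decay:
  assumes "\<gamma> < 1 / \<kappa>"
  shows "\<exists>C>0. \<forall>a i x. 0 \<le> x \<longrightarrow> cmod (esum a (G i) x) \<le> C * decay \<gamma> i x * group_size a i"
proof -
  obtain C where C: "C > 0" "\<And>y. y \<ge> 0 \<Longrightarrow>
     deriv_bound N (node_interval \<kappa>) (C * exp (- (\<gamma> * y))) (\<lambda>u. u powr y)"
    using deriv_bound_powr_decay[of \<kappa> \<gamma> N] assms kappa by auto
  have "cmod (esum a (G i) x) \<le> (2 ^ Suc N * C) * decay \<gamma> i x * group_size a i"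
    if "0 \<le> x" for a i x
  proof -
    have "(\<Sum>l\<in>G i. a l * of_real (exp (- lam l / lam i) powr (lam i * x))) = esum a (G i) x"
      using lam_pos[of i] unfolding esum_def by (intro sum.cong) (auto simp: powr_def)
    then show ?thesis
      using group_size_multiplier_bound[OF C(2)[of "lam i * x"], of a i] that lam_pos[of i] C(1)
      by (simp add: mult_ac)
  qed
  then show ?thesis using C(1) by (intro exI[of _ "2 ^ Suc N * C"]) auto
qed

text \<open>
  At a scale \<open>h = y / lam j\<close> much shorter than that of the group, the function of the group is nearly
  constant, and every factor \<open>X - 1\<close> of the polynomial, being a difference, gains a factor \<open>y\<close>.
\<close>

lemma low_group_filter_bound:
  "\<exists>C>0. \<forall>a j y m W. 0 \<le> y \<longrightarrow> y \<le> 1 \<longrightarrow>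
     cmod (filtered a (G j) ([:-1, 1:] ^ m * W) (y / lam j))
     \<le> C * (C * y) ^ m * l1_norm W * group_size a j"
proof -
  let ?I = "(node_interval \<kappa>)"
  obtain C where C: "C > 0" "\<And>y. y \<ge> 0 \<Longrightarrow> deriv_bound N ?I (C * exp (- (0 * y))) (\<lambda>u. u powr y)"
    using deriv_bound_powr_decay[of \<kappa> 0 N] kappa by auto
  obtain D where D: "D > 0" "\<And>y. y \<in> {0..1} \<Longrightarrow> deriv_bound N ?I (D * y) (\<lambda>u. u powr y - 1)"
    using deriv_bound_powr_minus_one[of \<kappa> N] kappa by auto
  define E where "E = max (2 ^ Suc N * 2 ^ N * C) (2 ^ N * D)"
  have E: "2 ^ Suc N * 2 ^ N * C \<le> E" "2 ^ N * D \<le> E" "0 < E"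
    using C D by (auto simp: E_def less_max_iff_disj)
  have "cmod (filtered a (G j) ([:-1, 1:] ^ m * W) (y / lam j))
     \<le> E * (E * y) ^ m * l1_norm W * group_size a j" if y: "0 \<le> y" "y \<le> 1" for a j y m W
  proof -
    have "deriv_bound N ?I (2 ^ N * (2 ^ N * (D * y)) ^ m * (l1_norm W * C))
       (\<lambda>u. (u powr y - 1) ^ m * poly W (u powr y))"
    proof (intro deriv_bound_mult deriv_bound_power D deriv_bound_poly_powr[where kmin = 0])
      show "deriv_bound N ?I C (\<lambda>u. u powr (real k * y))" for k
        using C(2)[of "real k * y"] y by simp
      show "?I \<subseteq> {0<..}" by (auto intro: less_le_trans[OF exp_gt_zero])
    qed (use y C D in auto)
    then have "cmod (\<Sum>l\<in>G j. a l * of_real ((\<lambda>u. (u powr y - 1) ^ m * poly W (u powr y)) (exp (- lam l / lam j))))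
      \<le> 2 ^ Suc N * (2 ^ N * (2 ^ N * (D * y)) ^ m * (l1_norm W * C)) * group_size a j"
      using y C D by (intro group_size_multiplier_bound) auto
    also have "\<dots> = (2 ^ Suc N * 2 ^ N * C) * (2 ^ N * D * y) ^ m * l1_norm W * group_size a j"
      by (simp add: mult_ac)
    also have "\<dots> \<le> E * (E * y) ^ m * l1_norm W * group_size a j"
      using E y C D group_size_nonneg[of a j] by (intro mult_right_mono mult_mono power_mono) auto
    finally show ?thesis by (simp add: powr_def mult.commute[of y])
  qed
  then show ?thesis using E(3) by blast
qed

text \<open>
  At a scale much longer than that of the group, its function has already decayed after one step;
  the step is enforced by the missing constant term.
\<close>

lemma high_group_filter_bound:
  assumes "0 \<le> \<gamma>" "\<gamma> < 1 / \<kappa>"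
  shows "\<exists>C>0. \<forall>a j y P. 0 \<le> y \<longrightarrow> coeff P 0 = 0 \<longrightarrow>
     cmod (filtered a (G j) P (y / lam j))
     \<le> C * l1_norm P * exp (- (\<gamma> * y)) * group_size a j"
proof -
  let ?I = "(node_interval \<kappa>)"
  obtain C where C: "C > 0" "\<And>y. y \<ge> 0 \<Longrightarrow> deriv_bound N ?I (C * exp (- (\<gamma> * y))) (\<lambda>u. u powr y)"
    using deriv_bound_powr_decay[of \<kappa> \<gamma> N] kappa assms by auto
  have "cmod (filtered a (G j) P (y / lam j))
     \<le> (2 ^ Suc N * C) * l1_norm P * exp (- (\<gamma> * y)) * group_size a j"
    if y: "0 \<le> y" "coeff P 0 = 0" for a j y P
  proof -
    have "deriv_bound N ?I (l1_norm P * (C * exp (- (\<gamma> * y)))) (\<lambda>u. poly P (u powr y))"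
    proof (rule deriv_bound_poly_powr[where kmin = 1])
      show "?I \<subseteq> {0<..}" by (auto intro: less_le_trans[OF exp_gt_zero])
      show "deriv_bound N ?I (C * exp (- (\<gamma> * y))) (\<lambda>u. u powr (real k * y))" if "1 \<le> k" for k
      proof (rule deriv_bound_mono[OF C(2)])
        have "1 * y \<le> real k * y" using that y by (intro mult_right_mono) auto
        then have "\<gamma> * y \<le> \<gamma> * (real k * y)" using assms by (intro mult_left_mono) auto
        then show "C * exp (- (\<gamma> * (real k * y))) \<le> C * exp (- (\<gamma> * y))" using C by simp
      qed (use y in auto)
    qed (use y in auto)
    then have "cmod (\<Sum>l\<in>G j. a l * of_real ((\<lambda>u. poly P (u powr y)) (exp (- lam l / lam j))))
      \<le> 2 ^ Suc N * (l1_norm P * (C * exp (- (\<gamma> * y)))) * group_size a j"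
      using C by (intro group_size_multiplier_bound) auto
    then show ?thesis by (simp add: powr_def mult_ac)
  qed
  then show ?thesis using C(1) by (intro exI[of _ "2 ^ Suc N * C"]) auto
qed

text \<open>
  In terms of the translation by \<open>h = s / lam i\<close>, with \<open>s\<close> between \<open>1\<close> and \<open>2\<close>: a filter that evaluates the
  group of \<open>i\<close> at \<open>n / lam i\<close>, annihilates the exponents in \<open>F\<close>, and damps those that are far lower
  (factor \<open>(X - 1)^m\<close>) or far higher (no constant term). The hull of the eigenvalues of the group is
  separated from the eigenvalue of every other exponent because of \<open>G_sep\<close>.
\<close>

lemma group_filter_exists:
  "\<exists>B\<ge>1. \<forall>i s m n F. 1 \<le> s \<longrightarrow> s \<le> 2 \<longrightarrow> n \<le> N \<longrightarrow> finite F \<longrightarrow> F \<inter> G i = {} \<longrightarrow>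
    (\<exists>W. degree W \<le> 1 + card F + N \<and> coeff W 0 = 0 \<and> l1_norm W \<le> B ^ (1 + m + card F) \<and>
      (\<forall>j\<in>F. poly W (exp (- lam j * (s / lam i))) = 0) \<and>
      (\<forall>l\<in>G i. poly ([:-1, 1:] ^ m * W) (exp (- lam l * (s / lam i))) = exp (- lam l * (real n / lam i))))"
proof -
  define a where "a = exp (- (2 * \<kappa>))"
  define b where "b = exp (- (1 / \<kappa>))"
  \<comment> \<open>The two terms bound the gap to an eigenvalue of a higher and of a lower exponent.\<close>
  define \<delta> where "\<delta> = min (a * (1 - exp (- ((\<tau> - 1) / \<kappa>)))) (a * ((1 - 1 / \<tau>) / \<kappa>))"
  have ab: "0 < a" "a \<le> 1" "b < 1" and d: "0 < \<delta>"
    using kappa tau by (auto simp: a_def b_def \<delta>_def)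
  obtain B where B: "B \<ge> 1" "\<And>m vs \<alpha> \<beta> V y.
    a \<le> \<alpha> \<Longrightarrow> \<beta> \<le> b \<Longrightarrow> V \<subseteq> {\<alpha>..\<beta>} \<Longrightarrow> finite V \<Longrightarrow> card V \<le> Suc N \<Longrightarrow> 0 \<le> y \<Longrightarrow> y \<le> real N \<Longrightarrow>
    (\<forall>r\<in>set vs. \<bar>r\<bar> \<le> 1 \<and> (\<forall>v\<in>{\<alpha>..\<beta>}. \<delta> \<le> \<bar>v - r\<bar>)) \<Longrightarrow>
    (\<exists>W. degree W \<le> 1 + length vs + N \<and> coeff W 0 = 0 \<and> l1_norm W \<le> B ^ (1 + m + length vs) \<and>
      (\<forall>r\<in>set vs. poly W r = 0) \<and> (\<forall>v\<in>V. (v - 1) ^ m * poly W v = v powr y))"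
    using filter_poly_exists[of a b \<delta> "real N" N] ab d by force
  show ?thesis
  proof (intro exI[of _ B] conjI allI impI B(1))
    fix i :: nat and s :: real and m n :: nat and F :: "nat set"
    assume h: "1 \<le> s" "s \<le> 2" "n \<le> N" "finite F" "F \<inter> G i = {}"
    define e where "e = (\<lambda>j. exp (- lam j * (s / lam i)))"
    define V where "V = e ` G i"
    have V: "finite V" "V \<noteq> {}" using G_finite G_refl[of i] by (auto simp: V_def)
    have Vab: "V \<subseteq> {a..b}" using group_node[of _ i s] h by (auto simp: V_def e_def a_def b_def)
    have cV: "card V \<le> Suc N" unfolding V_def using card_image_le[OF G_finite] G_card order_trans by blast
    obtain js where js: "set js = F" "length js = card F"
      using finite_distinct_list[OF h(4)] distinct_card by metis
    have s0: "0 < s / lam i" using lam_pos[of i] h by simp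
    have node: "1 / \<kappa> \<le> lam l * (s / lam i)" "a \<le> e l" if "l \<in> G i" for l
      using group_node[OF that h(1,2)] by (auto simp: a_def e_def)
    have sep: "\<delta> \<le> \<bar>v - e j\<bar>" if j: "j \<in> F" and v: "v \<in> {Min V..Max V}" for j v
    proof -
      have "j \<notin> G i" using j h by auto
      then consider "\<forall>l\<in>G i. \<tau> * lam l \<le> lam j" | "\<forall>l\<in>G i. \<tau> * lam j \<le> lam l" using G_sep by blast
      then show ?thesis
      proof cases
        case 1
        obtain l where l: "l \<in> G i" "Min V = e l" using Min_in[OF V] unfolding V_def by blast
        have "(\<tau> - 1) / \<kappa> = (\<tau> - 1) * (1 / \<kappa>)" by simp
        also have "\<dots> \<le> (\<tau> - 1) * (lam l * (s / lam i))" using node[OF l(1)] tau by (intro mult_left_mono) auto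
        also have "\<dots> = \<tau> * lam l * (s / lam i) - lam l * (s / lam i)"
          by (simp only: left_diff_distrib mult_1 mult.assoc)
        also have "\<dots> \<le> lam j * (s / lam i) - lam l * (s / lam i)"
          using 1 l s0 by (intro diff_right_mono mult_right_mono) auto
        finally have "exp (- (lam j * (s / lam i) - lam l * (s / lam i))) \<le> exp (- ((\<tau> - 1) / \<kappa>))" by simp
        then have "a * (1 - exp (- ((\<tau> - 1) / \<kappa>))) \<le> e l * (1 - exp (- (lam j * (s / lam i) - lam l * (s / lam i))))"
          using node[OF l(1)] kappa tau ab by (intro mult_mono) (auto simp: e_def)
        also have "\<dots> = e l - e j" by (simp add: e_def right_diff_distrib exp_add[symmetric])
        finally show ?thesis using v l by (auto simp: \<delta>_def)
      next
        case 2
        obtain l where l: "l \<in> G i" "Max V = e l" using Max_in[OF V] unfolding V_def by blast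
        have "lam j \<le> 1 / \<tau> * lam l" using 2 l tau by (simp add: field_simps)
        then have jl: "(1 - 1 / \<tau>) * lam l \<le> lam l - lam j" by (simp add: algebra_simps)
        have "(1 - 1 / \<tau>) / \<kappa> = (1 - 1 / \<tau>) * (1 / \<kappa>)" by simp
        also have "\<dots> \<le> (1 - 1 / \<tau>) * (lam l * (s / lam i))" using node[OF l(1)] tau by (intro mult_left_mono) auto
        also have "\<dots> \<le> (lam l - lam j) * (s / lam i)"
          unfolding mult.assoc[symmetric] using jl s0 by (intro mult_right_mono) auto
        also have "\<dots> \<le> exp ((lam l - lam j) * (s / lam i)) - 1"
          using exp_ge_add_one_self[of "(lam l - lam j) * (s / lam i)"] by linarith
        finally have "a * ((1 - 1 / \<tau>) / \<kappa>) \<le> e l * (exp ((lam l - lam j) * (s / lam i)) - 1)"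
          using node[OF l(1)] kappa tau ab by (intro mult_mono) (auto simp: e_def)
        also have "\<dots> = e j - e l" by (simp add: e_def algebra_simps exp_add[symmetric])
        finally show ?thesis using v l by (auto simp: \<delta>_def)
      qed
    qed
    have "real n / s \<le> real n / 1" using h by (intro divide_left_mono) auto
    then have y: "0 \<le> real n / s" "real n / s \<le> real N" using h by auto
    have "Min V \<in> V" "Max V \<in> V" using V by auto
    then have MV: "a \<le> Min V" "Max V \<le> b" "V \<subseteq> {Min V..Max V}" using V Vab by auto
    have "\<forall>r\<in>set (map e js). \<bar>r\<bar> \<le> 1 \<and> (\<forall>v\<in>{Min V..Max V}. \<delta> \<le> \<bar>v - r\<bar>)"
    proof -
      have "0 \<le> lam j * (s / lam i)" for j
        using s0 lam_pos[of j] by (intro mult_nonneg_nonneg) auto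
      then have "\<bar>e j\<bar> \<le> 1" for j by (simp add: e_def)
      then show ?thesis using sep js by simp
    qed
    from B(2)[OF MV V(1) cV y this, of m] js
    obtain W where W: "degree W \<le> 1 + card F + N" "coeff W 0 = 0" "l1_norm W \<le> B ^ (1 + m + card F)"
      "\<forall>j\<in>F. poly W (e j) = 0" "\<forall>v\<in>V. (v - 1) ^ m * poly W v = v powr (real n / s)" by auto
    have "poly ([:-1, 1:] ^ m * W) (e l) = exp (- lam l * (real n / lam i))" if "l \<in> G i" for l
    proof -
      have "poly ([:-1, 1:] ^ m * W) (e l) = (e l - 1) ^ m * poly W (e l)" by (simp add: poly_power)
      also have "\<dots> = e l powr (real n / s)" using W(5) that by (auto simp: V_def)
      also have "\<dots> = exp (- lam l * (real n / lam i))" using h by (simp add: e_def powr_def)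
      finally show ?thesis .
    qed
    then show "\<exists>W. degree W \<le> 1 + card F + N \<and> coeff W 0 = 0 \<and> l1_norm W \<le> B ^ (1 + m + card F) \<and>
      (\<forall>j\<in>F. poly W (exp (- lam j * (s / lam i))) = 0) \<and>
      (\<forall>l\<in>G i. poly ([:-1, 1:] ^ m * W) (exp (- lam l * (s / lam i))) = exp (- lam l * (real n / lam i)))"
      using W unfolding e_def by blast
  qed
qed

section \<open>Lacunary sums\<close>

lemma growth_powr:
  assumes "i \<le> j" "0 \<le> \<theta>"
  shows "(lam i / lam j) powr \<theta> \<le> (\<rho> powr \<theta>) ^ M * (\<rho> powr (- \<theta>)) ^ (j - i)"
proof -
  have "\<rho> ^ i * (\<rho> ^ (j - i) * lam i) \<le> \<rho> ^ i * (\<rho> ^ M * lam j)"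
    using growth[OF assms(1)] assms(1)
    by (simp add: power_add[symmetric] mult.assoc[symmetric] add.commute)
  then have "\<rho> ^ (j - i) * lam i \<le> \<rho> ^ M * lam j" using rho by simp
  then have "lam i / lam j \<le> \<rho> ^ M / \<rho> ^ (j - i)"
    using lam_pos[of j] rho by (simp add: field_simps)
  then have "(lam i / lam j) powr \<theta> \<le> (\<rho> ^ M / \<rho> ^ (j - i)) powr \<theta>"
    using lam_pos[of i] lam_pos[of j] assms by (intro powr_mono2) auto
  also have "\<dots> = (\<rho> powr \<theta>) ^ M * (\<rho> powr (- \<theta>)) ^ (j - i)"
  proof -
    have "(\<rho> ^ n) powr \<theta> = (\<rho> powr \<theta>) ^ n" for n
      using rho by (simp add: powr_realpow[symmetric] powr_powr mult.commute)
    then show ?thesis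
      using rho by (simp add: powr_divide powr_minus inverse_eq_divide power_one_over)
  qed
  finally show ?thesis .
qed

text \<open>
  Two geometric series, one for the exponents above \<open>\<xi>\<close> and one for those below.
\<close>

lemma lacunary_sum_bound:
  assumes "0 < \<theta>"
  shows "\<exists>S>0. \<forall>T \<xi>. finite T \<longrightarrow> 0 < \<xi> \<longrightarrow> (\<Sum>j\<in>T. ratio_min (lam j) \<xi> powr \<theta>) \<le> S"
proof -
  define t where "t = \<rho> powr (- \<theta>)"
  have t: "0 \<le> t" "t < 1" using rho assms by (auto simp: t_def powr_less_one)
  define A where "A = (\<rho> powr \<theta>) ^ M"
  have A: "A > 0" using rho by (simp add: A_def)
  have half: "(\<Sum>j\<in>T. ratio_min (lam j) \<xi> powr \<theta>) \<le> A * (1 / (1 - t))"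
    if T: "finite T" "0 < \<xi>" "inj_on d T"
      and d: "\<And>j. j \<in> T \<Longrightarrow> ratio_min (lam j) \<xi> powr \<theta> \<le> A * t ^ d j" for T \<xi> and d :: "nat \<Rightarrow> nat"
  proof -
    have "(\<Sum>j\<in>T. ratio_min (lam j) \<xi> powr \<theta>) \<le> A * (\<Sum>j\<in>T. t ^ d j)"
      unfolding sum_distrib_left by (rule sum_mono) (rule d)
    also have "\<dots> \<le> A * (1 / (1 - t))" using A t T by (intro mult_left_mono geometric_sum_le) auto
    finally show ?thesis .
  qed
  have step: "ratio_min (lam j) \<xi> powr \<theta> \<le> A * t ^ (k - i)"
    if "i \<le> k" "ratio_min (lam j) \<xi> \<le> lam i / lam k" "0 < \<xi>" for i j k \<xi>
  proof -
    have "0 \<le> ratio_min (lam j) \<xi>" using lam_pos[of j] that(3) by (simp add: ratio_min_def)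
    then have "ratio_min (lam j) \<xi> powr \<theta> \<le> (lam i / lam k) powr \<theta>"
      using assms that by (intro powr_mono2) auto
    also have "\<dots> \<le> A * t ^ (k - i)"
      unfolding A_def t_def using that assms by (intro growth_powr) auto
    finally show ?thesis .
  qed
  have up: "(\<Sum>j\<in>T. ratio_min (lam j) \<xi> powr \<theta>) \<le> A * (1 / (1 - t))"
    if T: "finite T" "\<And>j. j \<in> T \<Longrightarrow> \<xi> \<le> lam j" "0 < \<xi>" for T \<xi>
  proof (rule half[where d = "\<lambda>j. j - Min T"])
    have m: "Min T \<in> T" "Min T \<le> j" if "j \<in> T" for j using T(1) that by (auto intro: Min_in)
    show "inj_on (\<lambda>j. j - Min T) T" using m(2) by (intro inj_onI) (auto simp: eq_diff_iff)
    show "ratio_min (lam j) \<xi> powr \<theta> \<le> A * t ^ (j - Min T)" if j: "j \<in> T" for j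
    proof (rule step[OF m(2)[OF j] _ T(3)])
      show "ratio_min (lam j) \<xi> \<le> lam (Min T) / lam j"
        unfolding ratio_min_def using T(2)[OF m(1)[OF j]] lam_pos[of j]
        by (auto simp: min_le_iff_disj divide_right_mono)
    qed
  qed (use T in auto)
  have down: "(\<Sum>j\<in>T. ratio_min (lam j) \<xi> powr \<theta>) \<le> A * (1 / (1 - t))"
    if T: "finite T" "\<And>j. j \<in> T \<Longrightarrow> lam j \<le> \<xi>" "0 < \<xi>" for T \<xi>
  proof (rule half[where d = "\<lambda>j. Max T - j"])
    have m: "Max T \<in> T" "j \<le> Max T" if "j \<in> T" for j using T(1) that by (auto intro: Max_in)
    show "inj_on (\<lambda>j. Max T - j) T" using m(2) by (intro inj_onI) (metis diff_diff_cancel)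
    show "ratio_min (lam j) \<xi> powr \<theta> \<le> A * t ^ (Max T - j)" if j: "j \<in> T" for j
    proof (rule step[OF m(2)[OF j] _ T(3)])
      show "ratio_min (lam j) \<xi> \<le> lam j / lam (Max T)"
        unfolding ratio_min_def using T(2)[OF m(1)[OF j]] lam_pos[of j] lam_pos[of "Max T"]
        by (auto simp: min_le_iff_disj intro!: divide_left_mono)
    qed
  qed (use T in auto)
  have "(\<Sum>j\<in>T. ratio_min (lam j) \<xi> powr \<theta>) \<le> 2 * (A * (1 / (1 - t)))"
    if "finite T" "0 < \<xi>" for T \<xi>
  proof -
    have "(\<Sum>j\<in>T. ratio_min (lam j) \<xi> powr \<theta>) =
      (\<Sum>j\<in>T \<inter> {j. \<xi> \<le> lam j}. ratio_min (lam j) \<xi> powr \<theta>) + (\<Sum>j\<in>T \<inter> - {j. \<xi> \<le> lam j}. ratio_min (lam j) \<xi> powr \<theta>)"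
      using that by (subst sum.union_disjoint[symmetric]) (auto intro!: sum.cong)
    also have "\<dots> \<le> A * (1 / (1 - t)) + A * (1 / (1 - t))"
      using that by (intro add_mono up down) auto
    finally show ?thesis by simp
  qed
  then show ?thesis using A t by (intro exI[of _ "2 * (A * (1 / (1 - t)))"]) auto
qed

text \<open>
  The number of exponents within a ratio \<open>X\<close> grows only logarithmically in \<open>X\<close>.
\<close>

lemma window_card:
  assumes X: "X \<le> \<rho> ^ L"
  shows "finite {j. lam i \<le> X * lam j \<and> lam j \<le> X * lam i}" (is "finite ?S")
    and "card {j. lam i \<le> X * lam j \<and> lam j \<le> X * lam i} \<le> M + 2 * L + 1"
proof -
  have "\<exists>m. ?S \<subseteq> {m..m + (M + 2 * L)}"
  proof (cases "?S = {}")
    case False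
    define m where "m = (LEAST j. j \<in> ?S)"
    obtain j0 where "j0 \<in> ?S" using False by blast
    then have m: "m \<in> ?S" unfolding m_def by (rule LeastI)
    have m_le: "m \<le> j" if "j \<in> ?S" for j using that unfolding m_def by (rule Least_le)
    have "j \<le> m + (M + 2 * L)" if j: "j \<in> ?S" for j
    proof -
      have "\<rho> ^ j * lam m \<le> \<rho> ^ (M + m) * lam j" using m_le[OF j] by (rule growth)
      also have "\<dots> \<le> \<rho> ^ (M + m) * (\<rho> ^ L * (\<rho> ^ L * lam m))"
      proof -
        have "lam j \<le> X * lam i" using j by simp
        also have "\<dots> \<le> \<rho> ^ L * lam i" using X lam_pos[of i] by (intro mult_right_mono) auto
        also have "lam i \<le> X * lam m" using m by simp
        also have "\<dots> \<le> \<rho> ^ L * lam m" using X lam_pos[of m] by (intro mult_right_mono) auto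
        finally show ?thesis using rho by (intro mult_left_mono) auto
      qed
      also have "\<dots> = \<rho> ^ (M + m + 2 * L) * lam m" by (simp add: power_add mult_2)
      finally have "\<rho> ^ j \<le> \<rho> ^ (M + m + 2 * L)" using lam_pos[of m] by simp
      then show ?thesis using rho by simp
    qed
    then show ?thesis using m_le by (intro exI[of _ m]) auto
  qed (rule exI[of _ 0], auto)
  then obtain m where m: "?S \<subseteq> {m..m + (M + 2 * L)}" by blast
  then show "finite ?S" by (rule finite_subset) simp
  show "card ?S \<le> M + 2 * L + 1" using card_mono[OF _ m] by simp
qed

section \<open>Extraction of a group\<close>

text \<open>
  Each group is hit once by each of its members, and the division compensates for it.
\<close>

lemma sum_by_groups:
  assumes "finite S" "\<And>i. i \<in> S \<Longrightarrow> G i \<subseteq> S"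
  shows "(\<Sum>j\<in>S. \<phi> j) = (\<Sum>i\<in>S. (\<Sum>j\<in>G i. \<phi> j) / of_nat (card (G i)) :: complex)"
proof -
  have "(\<Sum>i\<in>S. (\<Sum>j\<in>G i. \<phi> j) / of_nat (card (G i))) =
    (\<Sum>i\<in>S. \<Sum>j\<in>{j\<in>S. j \<in> G i}. \<phi> j / of_nat (card (G i)))"
    using assms by (intro sum.cong) (auto simp: sum_divide_distrib intro!: sum.cong)
  also have "\<dots> = (\<Sum>j\<in>S. \<Sum>i\<in>{i\<in>S. j \<in> G i}. \<phi> j / of_nat (card (G i)))"
    using assms by (intro sum.swap_restrict) auto
  also have "\<dots> = (\<Sum>j\<in>S. \<Sum>i\<in>G j. \<phi> j / of_nat (card (G j)))"
  proof (intro sum.cong refl)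
    fix j assume j: "j \<in> S"
    show "{i \<in> S. j \<in> G i} = G j" using assms(2)[OF j] G_sym by blast
    show "\<phi> j / of_nat (card (G i)) = \<phi> j / of_nat (card (G j))" if "i \<in> G j" for i
      using G_eq[OF that] by simp
  qed
  also have "\<dots> = (\<Sum>j\<in>S. \<phi> j)"
  proof (intro sum.cong refl)
    fix j
    have "card (G j) \<noteq> 0" using G_finite G_refl[of j] by auto
    then show "(\<Sum>i\<in>G j. \<phi> j / of_nat (card (G j))) = \<phi> j" by simp
  qed
  finally show ?thesis by simp
qed

lemma cmod_sum_by_groups:
  assumes "finite S" "\<And>i. i \<in> S \<Longrightarrow> G i \<subseteq> S"
  shows "cmod (\<Sum>j\<in>S. \<phi> j) \<le> (\<Sum>i\<in>S. cmod (\<Sum>j\<in>G i. \<phi> j))"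
proof -
  have eq: "(\<Sum>j\<in>S. \<phi> j) = (\<Sum>i\<in>S. (\<Sum>j\<in>G i. \<phi> j) / of_nat (card (G i)))"
    by (rule sum_by_groups[OF assms])
  have "cmod (\<Sum>j\<in>S. \<phi> j) \<le> (\<Sum>i\<in>S. cmod ((\<Sum>j\<in>G i. \<phi> j) / of_nat (card (G i))))"
    by (subst eq) (rule norm_sum)
  also have "\<dots> \<le> (\<Sum>i\<in>S. cmod (\<Sum>j\<in>G i. \<phi> j))"
  proof (rule sum_mono)
    fix i
    have "1 \<le> card (G i)" using G_finite G_refl[of i] by (simp add: Suc_le_eq card_gt_0_iff) auto
    then have "1 \<le> real (card (G i))" by simp
    then show "cmod ((\<Sum>j\<in>G i. \<phi> j) / of_nat (card (G i))) \<le> cmod (\<Sum>j\<in>G i. \<phi> j)"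
      using divide_left_mono[of 1 "real (card (G i))" "cmod (\<Sum>j\<in>G i. \<phi> j)"] by (simp add: norm_divide)
  qed
  finally show ?thesis .
qed

text \<open>
  Both kinds of damping, expressed by the same power of the ratio of the scales. The weights
  \<open>lam powr (- \<sigma>)\<close> help for lower groups, and for higher groups they lose a power of the ratio that is
  absorbed by the exponential.
\<close>

lemma far_group_filter_bound:
  assumes "0 < \<sigma>"
  shows "\<exists>E>0. \<forall>a i j s W. 1 \<le> s \<longrightarrow> s \<le> 2 \<longrightarrow> coeff W 0 = 0 \<longrightarrow> 2 * lam j \<le> lam i \<or> lam i \<le> lam j \<longrightarrow>
     lam i powr (- \<sigma>) * cmod (filtered a (G j) ([:-1, 1:] ^ m * W) (s / lam i))
     \<le> E * l1_norm W * scale_ratio i j ^ m * normalised_size \<sigma> a j"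
proof -
  obtain C1 where C1: "C1 > 0" "\<And>a j y W. 0 \<le> y \<Longrightarrow> y \<le> 1 \<Longrightarrow>
     cmod (filtered a (G j) ([:-1, 1:] ^ m * W) (y / lam j))
     \<le> C1 * (C1 * y) ^ m * l1_norm W * group_size a j"
    using low_group_filter_bound by meson
  define \<gamma> where "\<gamma> = 1 / \<kappa> / 2"
  have g: "0 < \<gamma>" "\<gamma> < 1 / \<kappa>" using kappa by (auto simp: \<gamma>_def field_simps)
  obtain C2 where C2: "C2 > 0" "\<And>a j y P. 0 \<le> y \<Longrightarrow> coeff P 0 = 0 \<Longrightarrow>
     cmod (filtered a (G j) P (y / lam j))
     \<le> C2 * l1_norm P * exp (- (\<gamma> * y)) * group_size a j"
    using high_group_filter_bound[of \<gamma>] g by (meson less_imp_le)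
  obtain C3 where C3: "C3 > 0" "\<And>z. z \<ge> 1 \<Longrightarrow> exp (- (\<gamma> * z)) * z powr \<sigma> \<le> C3 * (1 / z) ^ m"
    using powr_exp_le_inverse_power[OF g(1), of \<sigma> m] by auto
  define E where "E = max (C1 * (C1 * 2) ^ m) (C2 * 2 ^ m * C3)"
  have E: "C1 * (C1 * 2) ^ m \<le> E" "C2 * 2 ^ m * C3 \<le> E" "0 < E"
    using C1 C2 C3 by (auto simp: E_def less_max_iff_disj)
  have "lam i powr (- \<sigma>) * cmod (filtered a (G j) ([:-1, 1:] ^ m * W) (s / lam i))
     \<le> E * l1_norm W * scale_ratio i j ^ m * normalised_size \<sigma> a j"
    if h: "1 \<le> s" "s \<le> 2" "coeff W 0 = 0" "2 * lam j \<le> lam i \<or> lam i \<le> lam j" for a i j s W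
  proof -
    define P where "P = [:-1, 1:] ^ m * W"
    define X where "X = cmod (filtered a (G j) P (s / lam i))"
    define y where "y = s * lam j / lam i"
    define z where "z = lam j / lam i"
    have pos: "0 < lam i" "0 < lam j" "0 < z" by (auto simp: lam_pos z_def)
    have yz: "y = s * z" by (simp add: y_def z_def)
    have y: "s / lam i = y / lam j" "0 \<le> y" using pos h by (auto simp: y_def)
    have conv: "lam i powr (- \<sigma>) = z powr \<sigma> * lam j powr (- \<sigma>)"
      using pos by (simp add: z_def powr_divide powr_minus field_simps)
    have gn: "0 \<le> group_size a j" by (rule group_size_nonneg)
    have "z powr \<sigma> * X \<le> E * l1_norm W * scale_ratio i j ^ m * group_size a j"
    proof (cases "2 * lam j \<le> lam i")
      case True
      have z2: "2 * z \<le> 1" using True pos by (simp add: z_def field_simps)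
      have y2: "y \<le> 2 * z" using h pos by (simp add: yz mult_right_mono)
      have rm: "scale_ratio i j = z"
        unfolding ratio_min_def z_def using True pos by (simp add: min_def field_simps) (smt (verit) mult_mono)
      have "X \<le> C1 * (C1 * y) ^ m * l1_norm W * group_size a j"
        unfolding X_def P_def y(1) using y(2) y2 z2 by (intro C1(2)) auto
      also have "\<dots> \<le> C1 * (C1 * (2 * z)) ^ m * l1_norm W * group_size a j"
        using y y2 C1 gn by (intro mult_right_mono mult_left_mono power_mono) auto
      also have "\<dots> = (C1 * (C1 * 2) ^ m) * l1_norm W * z ^ m * group_size a j"
        by (simp add: power_mult_distrib)
      also have "\<dots> \<le> E * l1_norm W * z ^ m * group_size a j"
        using E gn pos by (intro mult_right_mono) auto
      finally have "X \<le> E * l1_norm W * z ^ m * group_size a j" .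
      moreover have "z powr \<sigma> \<le> 1" using z2 pos assms by (intro powr_le1) auto
      moreover have "0 \<le> X" by (simp add: X_def)
      ultimately have "z powr \<sigma> * X \<le> 1 * (E * l1_norm W * z ^ m * group_size a j)"
        by (intro mult_mono) auto
      then show ?thesis by (simp add: rm)
    next
      case False
      then have z1: "1 \<le> z" using h pos by (simp add: z_def)
      have rm: "scale_ratio i j = 1 / z"
        unfolding ratio_min_def z_def using False h pos by (simp add: min_def field_simps) (smt (verit) mult_mono)
      have c0: "coeff P 0 = 0" using h(3) by (simp add: P_def coeff_mult_0)
      have lP: "l1_norm P \<le> 2 ^ m * l1_norm W"
      proof -
        have "l1_norm ([:-1, 1:] ^ m) \<le> 2 ^ m"
          using l1_norm_prod_list_linear[of "replicate m 1"] by simp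
        then show ?thesis unfolding P_def
          by (intro order_trans[OF l1_norm_mult] mult_right_mono) auto
      qed
      have "z \<le> y" using h z1 mult_right_mono[of 1 s z] by (simp add: yz)
      have "X \<le> C2 * l1_norm P * exp (- (\<gamma> * y)) * group_size a j"
        unfolding X_def y(1) using y(2) c0 by (intro C2(2))
      also have "\<dots> \<le> C2 * (2 ^ m * l1_norm W) * exp (- (\<gamma> * z)) * group_size a j"
        using lP C2 g gn \<open>z \<le> y\<close> by (intro mult_right_mono mult_mono mult_left_mono) auto
      finally have "z powr \<sigma> * X \<le> z powr \<sigma> * (C2 * (2 ^ m * l1_norm W) * exp (- (\<gamma> * z)) * group_size a j)"
        by (intro mult_left_mono) auto
      also have "\<dots> = (C2 * 2 ^ m * l1_norm W) * (exp (- (\<gamma> * z)) * z powr \<sigma>) * group_size a j"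
        by (simp add: mult_ac)
      also have "\<dots> \<le> (C2 * 2 ^ m * l1_norm W) * (C3 * (1 / z) ^ m) * group_size a j"
        using C2 gn by (intro mult_right_mono mult_left_mono C3(2) z1) auto
      also have "\<dots> = (C2 * 2 ^ m * C3) * l1_norm W * (1 / z) ^ m * group_size a j"
        by (simp add: mult_ac)
      also have "\<dots> \<le> E * l1_norm W * (1 / z) ^ m * group_size a j"
        using E gn pos by (intro mult_right_mono) auto
      finally show ?thesis by (simp add: rm)
    qed
    from mult_left_mono[OF this, of "lam j powr (- \<sigma>)"]
    show ?thesis unfolding conv X_def P_def by (simp add: mult_ac)
  qed
  then show ?thesis using E(3) by blast
qed

text \<open>
  The filter is applied to the whole sum. Groups within the ratio \<open>\<rho> ^ L\<close> are annihilated and the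
  others are damped by \<open>\<rho> ^ (- L * m)\<close>. Since the window holds about \<open>2 * L\<close> exponents, the
  coefficients of the filter are of the order \<open>B ^ (2 * L)\<close>, up to a factor depending on \<open>m\<close>.
  So \<open>m\<close> is fixed first, with \<open>\<rho> ^ (m - 1)\<close> larger than \<open>2 * B ^ 2\<close>, and then a large \<open>L\<close> makes the
  influence of the remaining groups as small as desired.
\<close>

lemma group_extraction:
  assumes "0 < \<sigma>" "0 < \<epsilon>"
  shows "\<exists>d D. D > 0 \<and> (\<forall>a T i s. finite T \<longrightarrow> (\<forall>j\<in>T. G j \<subseteq> T) \<longrightarrow> i \<in> T \<longrightarrow> 1 \<le> s \<longrightarrow> s \<le> 2 \<longrightarrow>
    normalised_size \<sigma> a i \<le>
      D * (lam i powr (- \<sigma>) * (\<Sum>k=1..d. cmod (esum a T (real k * (s / lam i)))))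
      + \<epsilon> * (\<Sum>j\<in>T. scale_ratio i j * normalised_size \<sigma> a j))"
proof -
  obtain B where B: "B \<ge> 1" "\<And>i s m n F. 1 \<le> s \<Longrightarrow> s \<le> 2 \<Longrightarrow> n \<le> N \<Longrightarrow> finite F \<Longrightarrow> F \<inter> G i = {} \<Longrightarrow>
    \<exists>W. degree W \<le> 1 + card F + N \<and> coeff W 0 = 0 \<and> l1_norm W \<le> B ^ (1 + m + card F) \<and>
      (\<forall>j\<in>F. poly W (exp (- lam j * (s / lam i))) = 0) \<and>
      (\<forall>l\<in>G i. poly ([:-1, 1:] ^ m * W) (exp (- lam l * (s / lam i))) = exp (- lam l * (real n / lam i)))"
    using group_filter_exists by (elim exE conjE) (rule that, assumption, simp)
  \<comment> \<open>Each unit of \<open>L\<close> costs \<open>B\<^sup>2\<close> in the coefficients and gains \<open>\<rho> ^ m0\<close> in the damping.\<close>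
  obtain m0 where m0: "2 * B ^ 2 < \<rho> ^ m0" using real_arch_pow[OF rho] by blast
  define m where "m = Suc m0"
  obtain E where E: "E > 0" "\<And>a i j s W. 1 \<le> s \<Longrightarrow> s \<le> 2 \<Longrightarrow> coeff W 0 = 0 \<Longrightarrow>
     2 * lam j \<le> lam i \<or> lam i \<le> lam j \<Longrightarrow>
     lam i powr (- \<sigma>) * cmod (filtered a (G j) ([:-1, 1:] ^ m * W) (s / lam i))
     \<le> E * l1_norm W * scale_ratio i j ^ m * normalised_size \<sigma> a j"
    using far_group_filter_bound[OF assms(1), of m] by meson
  define Q where "Q = real (Suc N) * E * B ^ (m + M + 4)"
  have Q: "0 < Q" using E B by (simp add: Q_def)
  obtain L1 where L1: "Q / \<epsilon> < 2 ^ L1" using real_arch_pow[of 2] by auto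
  obtain L2 where L2: "2 < \<rho> ^ L2" using real_arch_pow[OF rho] by blast
  define L where "L = L1 + L2"
  have rL: "2 \<le> \<rho> ^ L" "1 \<le> \<rho> ^ L"
  proof -
    have "\<rho> ^ L2 \<le> \<rho> ^ L" using rho by (intro power_increasing) (auto simp: L_def)
    then show "2 \<le> \<rho> ^ L" "1 \<le> \<rho> ^ L" using L2 by auto
  qed
  define F where "F = (\<lambda>T i. {j\<in>T. \<exists>l\<in>G j. lam i \<le> \<rho> ^ L * lam l \<and> lam l \<le> \<rho> ^ L * lam i} - G i)"
  \<comment> \<open>\<open>Suc L\<close> and not \<open>L\<close>: whole groups are annihilated, so the window widens by a factor \<open>\<kappa> \<le> \<rho>\<close>.\<close>
  define w where "w = M + 2 * Suc L + 1"
  define d where "d = m + (1 + w + N)"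
  define D where "D = real (Suc N) * (2 ^ m * B ^ (1 + m + w))"
  have D: "D > 0" using B by (simp add: D_def)
  have eps: "real (Suc N) * E * B ^ (1 + m + w) * (1 / \<rho> ^ L) ^ m0 \<le> \<epsilon>"
  proof -
    have "B ^ (1 + m + w) = B ^ (m + M + 4) * (B ^ 2) ^ L"
    proof -
      have e: "1 + m + w = (m + M + 4) + 2 * L" by (simp add: w_def)
      show ?thesis by (simp only: e power_add power_mult)
    qed
    then have "real (Suc N) * E * B ^ (1 + m + w) * (1 / \<rho> ^ L) ^ m0 = Q * (B ^ 2 / \<rho> ^ m0) ^ L"
      by (simp add: Q_def power_divide power_mult[symmetric] mult.commute)
    also have "\<dots> \<le> Q * (1 / 2) ^ L"
      using m0 B rho Q by (intro mult_left_mono power_mono) (auto simp: field_simps)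
    also have "\<dots> \<le> Q * (1 / 2) ^ L1"
      using Q by (intro mult_left_mono power_decreasing) (auto simp: L_def)
    also have "\<dots> \<le> \<epsilon>" using L1 assms by (simp add: field_simps)
    finally show ?thesis .
  qed
  have "normalised_size \<sigma> a i \<le>
      D * (lam i powr (- \<sigma>) * (\<Sum>k=1..d. cmod (esum a T (real k * (s / lam i)))))
      + \<epsilon> * (\<Sum>j\<in>T. scale_ratio i j * normalised_size \<sigma> a j)"
    if T: "finite T" "\<forall>j\<in>T. G j \<subseteq> T" "i \<in> T" and s: "1 \<le> s" "s \<le> 2" for a T i s
  proof -
    let ?F = "F T i"
    have rm0: "0 \<le> scale_ratio i j" for j
      using lam_pos[of i] lam_pos[of j] by (simp add: ratio_min_def)
    have finF: "finite ?F" and disj: "?F \<inter> G i = {}" using T by (auto simp: F_def)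
    have "card ?F \<le> w"
    proof -
      have X: "\<kappa> * \<rho> ^ L \<le> \<rho> ^ Suc L" using kappa rho by simp
      have "?F \<subseteq> {j. lam i \<le> (\<kappa> * \<rho> ^ L) * lam j \<and> lam j \<le> (\<kappa> * \<rho> ^ L) * lam i}"
      proof
        fix j assume "j \<in> ?F"
        then obtain l where l: "l \<in> G j" "lam i \<le> \<rho> ^ L * lam l" "lam l \<le> \<rho> ^ L * lam i" by (auto simp: F_def)
        have "\<rho> ^ L * lam l \<le> \<rho> ^ L * (\<kappa> * lam j)" using G_ratio[OF l(1)] rho by (intro mult_left_mono) auto
        moreover have "lam j \<le> \<kappa> * lam l" using G_ratio[OF G_sym[OF l(1)]] .
        moreover have "\<kappa> * lam l \<le> \<kappa> * (\<rho> ^ L * lam i)" using l(3) kappa by (intro mult_left_mono) auto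
        ultimately show "j \<in> {j. lam i \<le> (\<kappa> * \<rho> ^ L) * lam j \<and> lam j \<le> (\<kappa> * \<rho> ^ L) * lam i}"
          using l by (simp add: mult_ac)
      qed
      from card_mono[OF window_card(1)[OF X] this] window_card(2)[OF X, of i] show ?thesis
        by (simp add: w_def)
    qed
    \<comment> \<open>The far groups, a union of whole groups again.\<close>
    define Z where "Z = T - ?F - G i"
    have ZG: "G j \<subseteq> Z" if "j \<in> Z" for j
    proof
      fix l assume l: "l \<in> G j"
      then have eq: "G l = G j" by (rule G_eq)
      have "l \<in> T" using l that T by (auto simp: Z_def)
      moreover have "l \<notin> G i" using eq that G_eq[of l i] G_refl[of j] by (auto simp: Z_def)
      ultimately show "l \<in> Z" using that eq by (auto simp: Z_def F_def)
    qed
    have finZ: "finite Z" using T by (simp add: Z_def)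
    have far: "\<rho> ^ L * lam j < lam i \<or> \<rho> ^ L * lam i < lam j" if "j \<in> Z" for j
      using that G_refl[of j] by (auto simp: Z_def F_def not_le)
    have each: "lam i powr (- \<sigma>) * cmod (esum a (G i) (real n / lam i)) \<le>
      2 ^ m * B ^ (1 + m + w) * (lam i powr (- \<sigma>) * (\<Sum>k=1..d. cmod (esum a T (real k * (s / lam i)))))
      + E * B ^ (1 + m + w) * (1 / \<rho> ^ L) ^ m0 * (\<Sum>j\<in>T. scale_ratio i j * normalised_size \<sigma> a j)"
      if n: "n \<le> N" for n
    proof -
      obtain W where W: "degree W \<le> 1 + card ?F + N" "coeff W 0 = 0" "l1_norm W \<le> B ^ (1 + m + card ?F)"
        "\<forall>j\<in>?F. poly W (exp (- lam j * (s / lam i))) = 0"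
        "\<forall>l\<in>G i. poly ([:-1, 1:] ^ m * W) (exp (- lam l * (s / lam i))) = exp (- lam l * (real n / lam i))"
        using B(2)[OF s n finF disj] by blast
      define P where "P = [:-1, 1:] ^ m * W"
      define \<phi> where "\<phi> = (\<lambda>j. a j * of_real (poly P (exp (- lam j * (s / lam i)))) :: complex)"
      have "B ^ (1 + m + card ?F) \<le> B ^ (1 + m + w)" using B \<open>card ?F \<le> w\<close> by (intro power_increasing) auto
      then have lW: "l1_norm W \<le> B ^ (1 + m + w)" using W(3) by linarith
      have lP: "l1_norm P \<le> 2 ^ m * B ^ (1 + m + w)"
      proof -
        have "l1_norm ([:-1, 1:] ^ m) \<le> 2 ^ m"
          using l1_norm_prod_list_linear[of "replicate m 1"] by simp
        then show ?thesis unfolding P_def using lW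
          by (intro order_trans[OF l1_norm_mult] mult_mono) auto
      qed
      have dP: "degree P \<le> d"
      proof -
        have "degree ([:-1, 1::real:] ^ m) \<le> m" using degree_prod_list_linear[of "replicate m 1"] by simp
        then show ?thesis
          using degree_mult_le[of "[:-1, 1::real:] ^ m" W] W(1) \<open>card ?F \<le> w\<close> by (simp add: P_def d_def)
      qed
      have cP: "coeff P 0 = 0" using W(2) by (simp add: P_def coeff_mult_0)
      have "(\<Sum>j\<in>T. \<phi> j) = (\<Sum>j\<in>G i. \<phi> j) + (\<Sum>j\<in>Z. \<phi> j) + (\<Sum>j\<in>?F. \<phi> j)"
      proof -
        have "T = (G i \<union> Z) \<union> ?F" using T by (auto simp: Z_def F_def)
        then have "(\<Sum>j\<in>T. \<phi> j) = (\<Sum>j\<in>(G i \<union> Z) \<union> ?F. \<phi> j)" by simp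
        also have "\<dots> = (\<Sum>j\<in>G i \<union> Z. \<phi> j) + (\<Sum>j\<in>?F. \<phi> j)"
          using finF finZ G_finite disj by (intro sum.union_disjoint) (auto simp: Z_def)
        also have "(\<Sum>j\<in>G i \<union> Z. \<phi> j) = (\<Sum>j\<in>G i. \<phi> j) + (\<Sum>j\<in>Z. \<phi> j)"
          using finZ G_finite by (intro sum.union_disjoint) (auto simp: Z_def)
        finally show ?thesis .
      qed
      moreover have "(\<Sum>j\<in>?F. \<phi> j) = 0"
        using W(4) by (intro sum.neutral) (auto simp: \<phi>_def P_def)
      moreover have "(\<Sum>j\<in>G i. \<phi> j) = esum a (G i) (real n / lam i)"
        using W(5) unfolding \<phi>_def P_def esum_def by (intro sum.cong) auto
      ultimately have "esum a (G i) (real n / lam i) = (\<Sum>j\<in>T. \<phi> j) - (\<Sum>j\<in>Z. \<phi> j)" by simp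
      then have split: "cmod (esum a (G i) (real n / lam i)) \<le> cmod (\<Sum>j\<in>T. \<phi> j) + cmod (\<Sum>j\<in>Z. \<phi> j)"
        using norm_triangle_ineq4 by metis
      have "cmod (\<Sum>j\<in>T. \<phi> j) = cmod (\<Sum>k\<le>d. of_real (coeff P k) * esum a T (real k * (s / lam i)))"
        unfolding \<phi>_def sum_poly_eq_shifts[OF dP] ..
      also have "\<dots> = cmod (\<Sum>k=1..d. of_real (coeff P k) * esum a T (real k * (s / lam i)))"
      proof -
        have "{..d} = insert 0 {1..d}" by auto
        then show ?thesis using cP by simp
      qed
      also have "\<dots> \<le> (\<Sum>k=1..d. \<bar>coeff P k\<bar> * cmod (esum a T (real k * (s / lam i))))"
        by (rule order_trans[OF norm_sum]) (simp add: norm_mult)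
      also have "\<dots> \<le> (\<Sum>k=1..d. (2 ^ m * B ^ (1 + m + w)) * cmod (esum a T (real k * (s / lam i))))"
        using lP coeff_le_l1_norm[of P] by (intro sum_mono mult_right_mono) (auto intro: order_trans)
      finally have main: "cmod (\<Sum>j\<in>T. \<phi> j) \<le> 2 ^ m * B ^ (1 + m + w) * (\<Sum>k=1..d. cmod (esum a T (real k * (s / lam i))))"
        by (simp add: sum_distrib_left)
      have "lam i powr (- \<sigma>) * cmod (\<Sum>j\<in>Z. \<phi> j) \<le> lam i powr (- \<sigma>) * (\<Sum>j\<in>Z. cmod (\<Sum>l\<in>G j. \<phi> l))"
        using finZ ZG by (intro mult_left_mono cmod_sum_by_groups) auto
      also have "\<dots> = (\<Sum>j\<in>Z. lam i powr (- \<sigma>) * cmod (\<Sum>l\<in>G j. \<phi> l))" by (rule sum_distrib_left)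
      also have "\<dots> \<le> (\<Sum>j\<in>Z. E * B ^ (1 + m + w) * (1 / \<rho> ^ L) ^ m0 *
          (scale_ratio i j * normalised_size \<sigma> a j))"
      proof (rule sum_mono)
        fix j assume j: "j \<in> Z"
        have le1: "lam i \<le> \<rho> ^ L * lam i" "2 * lam j \<le> \<rho> ^ L * lam j"
          using rL lam_pos[of i] lam_pos[of j] by auto
        have fr: "2 * lam j \<le> lam i \<or> lam i \<le> lam j" using far[OF j] le1 by linarith
        have rsmall: "scale_ratio i j \<le> 1 / \<rho> ^ L"
        proof (cases "\<rho> ^ L * lam j < lam i")
          case True
          then have "lam j / lam i \<le> 1 / \<rho> ^ L" using lam_pos[of i] rL by (simp add: field_simps)
          then show ?thesis by (simp add: ratio_min_def min_le_iff_disj)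
        next
          case False
          then have "lam i / lam j \<le> 1 / \<rho> ^ L" using far[OF j] lam_pos[of j] rL by (simp add: field_simps)
          then show ?thesis by (simp add: ratio_min_def min_le_iff_disj)
        qed
        have gp: "0 \<le> normalised_size \<sigma> a j" using group_size_nonneg by simp
        have "lam i powr (- \<sigma>) * cmod (\<Sum>l\<in>G j. \<phi> l) \<le>
          E * l1_norm W * scale_ratio i j ^ m * normalised_size \<sigma> a j"
          unfolding \<phi>_def P_def by (rule E(2)[OF s W(2) fr])
        also have "\<dots> \<le> E * B ^ (1 + m + w) * (scale_ratio i j * (1 / \<rho> ^ L) ^ m0) * normalised_size \<sigma> a j"
          unfolding m_def power_Suc using lW E(1) rm0 rsmall gp B
          by (intro mult_right_mono[OF _ gp] mult_mono mult_left_mono power_mono) (auto simp: m_def)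
        finally show "lam i powr (- \<sigma>) * cmod (\<Sum>l\<in>G j. \<phi> l) \<le> E * B ^ (1 + m + w) * (1 / \<rho> ^ L) ^ m0 *
          (scale_ratio i j * normalised_size \<sigma> a j)"
          by (simp add: mult_ac)
      qed
      also have "\<dots> \<le> (\<Sum>j\<in>T. E * B ^ (1 + m + w) * (1 / \<rho> ^ L) ^ m0 *
          (scale_ratio i j * normalised_size \<sigma> a j))"
        using T E B rho rm0 group_size_nonneg by (intro sum_mono2) (auto simp: Z_def)
      finally have "lam i powr (- \<sigma>) * cmod (\<Sum>j\<in>Z. \<phi> j) \<le> E * B ^ (1 + m + w) * (1 / \<rho> ^ L) ^ m0 *
          (\<Sum>j\<in>T. scale_ratio i j * normalised_size \<sigma> a j)"
        by (simp only: sum_distrib_left)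
      moreover have "lam i powr (- \<sigma>) * cmod (\<Sum>j\<in>T. \<phi> j) \<le>
          2 ^ m * B ^ (1 + m + w) * (lam i powr (- \<sigma>) * (\<Sum>k=1..d. cmod (esum a T (real k * (s / lam i)))))"
        using mult_left_mono[OF main, of "lam i powr (- \<sigma>)"] by (simp only: mult_ac powr_ge_zero)
      moreover have "lam i powr (- \<sigma>) * cmod (esum a (G i) (real n / lam i)) \<le>
          lam i powr (- \<sigma>) * cmod (\<Sum>j\<in>T. \<phi> j) + lam i powr (- \<sigma>) * cmod (\<Sum>j\<in>Z. \<phi> j)"
        using mult_left_mono[OF split, of "lam i powr (- \<sigma>)"] by (simp add: distrib_left)
      ultimately show ?thesis by linarith
    qed
    define U where "U = lam i powr (- \<sigma>) * (\<Sum>k=1..d. cmod (esum a T (real k * (s / lam i))))"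
    define R where "R = (\<Sum>j\<in>T. scale_ratio i j * normalised_size \<sigma> a j)"
    have R0: "0 \<le> R" unfolding R_def using rm0 group_size_nonneg by (intro sum_nonneg mult_nonneg_nonneg) auto
    have "normalised_size \<sigma> a i = (\<Sum>n\<le>N. lam i powr (- \<sigma>) * cmod (esum a (G i) (real n / lam i)))"
      by (simp add: group_size_def sum_distrib_left)
    also have "\<dots> \<le> (\<Sum>n\<le>N. 2 ^ m * B ^ (1 + m + w) * U + E * B ^ (1 + m + w) * (1 / \<rho> ^ L) ^ m0 * R)"
      unfolding U_def R_def by (rule sum_mono) (rule each, simp)
    also have "\<dots> = D * U + (real (Suc N) * E * B ^ (1 + m + w) * (1 / \<rho> ^ L) ^ m0) * R"
      by (simp add: D_def algebra_simps)
    also have "\<dots> \<le> D * U + \<epsilon> * R"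
      using eps R0 by (intro add_left_mono mult_right_mono)
    finally show ?thesis unfolding U_def R_def .
  qed
  then show ?thesis using D by blast
qed


section \<open>The weighted norm controls the sizes of the groups\<close>

lemma ratio_min_nonneg [simp]: "0 \<le> scale_ratio i j"
  using lam_pos[of i] lam_pos[of j] by (simp add: ratio_min_def)

lemma lam_ge_lam_0: "lam 0 \<le> lam i"
  using lam_mono by (simp add: strict_mono_less_eq)

abbreviation scale_integral :: "real \<Rightarrow> (real \<Rightarrow> ennreal) \<Rightarrow> nat \<Rightarrow> nat \<Rightarrow> ennreal" where
  "scale_integral \<alpha> \<psi> k i \<equiv>
     \<integral>\<^sup>+s. ennreal (lam i powr (- \<alpha>)) * \<psi> (exp (- (real k * (s / lam i)))) * indicator {1..2} s \<partial>lborel"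

text \<open>
  The dilations of the interval from \<open>1\<close> to \<open>2\<close> by \<open>k / lam i\<close> overlap boundedly often by
  lacunarity, so integrals over them add up to at most a multiple of the whole integral.
\<close>

lemma scale_integrals_bound:
  fixes k :: nat
  assumes "1 \<le> k" "0 < \<alpha>"
  shows "\<exists>C>0. \<forall>T \<psi>. finite T \<longrightarrow> \<psi> \<in> borel_measurable borel \<longrightarrow>
    (\<Sum>i\<in>T. scale_integral \<alpha> \<psi> k i)
    \<le> ennreal C * (\<integral>\<^sup>+t. \<psi> t \<partial>weight_measure (\<alpha> - 1))"
proof -
  obtain S where S: "S > 0" "\<And>T \<xi>. finite T \<Longrightarrow> 0 < \<xi> \<Longrightarrow> (\<Sum>j\<in>T. ratio_min (lam j) \<xi> powr 1) \<le> S"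
    using lacunary_sum_bound[of 1] by auto
  define X where "X = 2 * real k / lam 0"
  define C where "C = (2 * real k) powr \<bar>1 - \<alpha>\<bar> * exp (X * \<bar>1 - \<alpha>\<bar>) * exp X"
  have C: "C > 0" using assms by (simp add: C_def)
  define w where "w = (\<lambda>z::real. (1 - exp z) powr (\<alpha> - 1) * exp z)"
  have w0: "0 \<le> w z" for z by (simp add: w_def)
  have [measurable]: "w \<in> borel_measurable borel" unfolding w_def by measurable
  define I where "I = (\<lambda>i. {- (2 * real k / lam i)..- (real k / lam i)})"
  have "(\<Sum>i\<in>T. scale_integral \<alpha> \<psi> k i)
    \<le> ennreal (2 * S * C) * (\<integral>\<^sup>+t. \<psi> t \<partial>weight_measure (\<alpha> - 1))"
    if T: "finite T" and [measurable]: "\<psi> \<in> borel_measurable borel" for T \<psi>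
  proof (cases "T = {}")
    case False
    have one: "(scale_integral \<alpha> \<psi> k i)
      \<le> (\<integral>\<^sup>+z. ennreal C * (\<psi> (exp z) * ennreal (w z)) * indicator (I i) z \<partial>lborel)" for i
    proof -
      define H where "H = (\<lambda>z. \<psi> (exp z) * indicator (I i) z)"
      have [measurable]: "H \<in> borel_measurable borel" unfolding H_def I_def by measurable
      define c where "c = - (real k / lam i)"
      have c: "c \<noteq> 0" "\<bar>c\<bar> = real k / lam i" "0 < real k / lam i" using assms lam_pos[of i] by (auto simp: c_def)
      have H: "H (0 + c * s) = \<psi> (exp (- (real k * (s / lam i)))) * indicator {1..2} s" for s
      proof -
        have "c * s \<in> I i \<longleftrightarrow> s \<in> {1..2}"
          using assms lam_pos[of i] by (auto simp: I_def c_def field_simps)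
        then show ?thesis by (simp add: H_def indicator_def c_def)
      qed
      have "(\<integral>\<^sup>+z. H z \<partial>lborel) = ennreal \<bar>c\<bar> * (\<integral>\<^sup>+s. H (0 + c * s) \<partial>lborel)"
        by (rule nn_integral_real_affine) (use c in auto)
      then have eq: "(\<integral>\<^sup>+z. H z \<partial>lborel) = ennreal (real k / lam i) *
         (\<integral>\<^sup>+s. \<psi> (exp (- (real k * (s / lam i)))) * indicator {1..2} s \<partial>lborel)"
        unfolding H c .
      have split: "ennreal (lam i powr (- \<alpha>)) = ennreal (lam i powr (1 - \<alpha>) / real k) * ennreal (real k / lam i)"
      proof -
        have "lam i powr (- \<alpha>) = lam i powr (1 - \<alpha>) / real k * (real k / lam i)"
          using assms lam_pos[of i] by (simp add: powr_diff powr_minus field_simps)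
        then show ?thesis using assms lam_pos[of i] by (simp add: ennreal_mult[symmetric])
      qed
      have "(scale_integral \<alpha> \<psi> k i)
        = ennreal (lam i powr (- \<alpha>)) * (\<integral>\<^sup>+s. \<psi> (exp (- (real k * (s / lam i)))) * indicator {1..2} s \<partial>lborel)"
        by (simp add: nn_integral_cmult mult.assoc)
      also have "\<dots> = ennreal (lam i powr (1 - \<alpha>) / real k) * (\<integral>\<^sup>+z. H z \<partial>lborel)"
        unfolding eq split by (simp only: mult.assoc)
      also have "\<dots> = (\<integral>\<^sup>+z. ennreal (lam i powr (1 - \<alpha>) / real k) * H z \<partial>lborel)"
        by (simp add: nn_integral_cmult)
      also have "\<dots> \<le> (\<integral>\<^sup>+z. ennreal C * (\<psi> (exp z) * ennreal (w z)) * indicator (I i) z \<partial>lborel)"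
      proof (rule nn_integral_mono)
        fix z :: real
        show "ennreal (lam i powr (1 - \<alpha>) / real k) * H z \<le> ennreal C * (\<psi> (exp z) * ennreal (w z)) * indicator (I i) z"
        proof (cases "z \<in> I i")
          case True
          have "2 * real k / lam i \<le> X"
            unfolding X_def using lam_ge_lam_0[of i] lam_pos[of 0] by (intro divide_left_mono) auto
          then have "lam i powr (1 - \<alpha>) / real k \<le> C * ((1 - exp (- (- z))) powr (\<alpha> - 1) * exp (- (- z)))"
            unfolding C_def
          proof (intro log_scale_weight_bound)
            have b: "- (2 * real k / lam i) \<le> z" "z \<le> - (real k / lam i)" using True by (auto simp: I_def)
            show "0 < - z" "- z \<le> X" using b c(3) \<open>2 * real k / lam i \<le> X\<close> by linarith+
            show "real k \<le> lam i * - z" "lam i * - z \<le> 2 * real k"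
              using b lam_pos[of i] by (auto simp: field_simps)
          qed (use assms in simp)
          then have "ennreal (lam i powr (1 - \<alpha>) / real k) \<le> ennreal C * ennreal (w z)"
            using C w0 by (simp add: w_def ennreal_mult[symmetric] ennreal_leI)
          from mult_right_mono[OF this, of "\<psi> (exp z)"] show ?thesis
            using True by (simp add: H_def mult_ac)
        qed (simp add: H_def)
      qed
      finally show ?thesis .
    qed
    define x0 where "x0 = real k / lam (Max T)"
    have x0: "0 < x0" using assms lam_pos by (simp add: x0_def)
    have overlap: "(\<Sum>i\<in>T. indicator (I i) z :: ennreal) \<le> ennreal (2 * S) * indicator {- (X + x0)..- x0} z" for z
    proof (cases "\<exists>i\<in>T. z \<in> I i")
      case True
      then obtain i where i: "i \<in> T" "z \<in> I i" by blast
      have "x0 \<le> real k / lam i"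
      proof -
        have "lam i \<le> lam (Max T)" using T i lam_mono by (simp add: strict_mono_less_eq)
        then show ?thesis unfolding x0_def using lam_pos[of i] by (intro divide_left_mono) auto
      qed
      moreover have "2 * real k / lam i \<le> X"
        unfolding X_def using lam_ge_lam_0[of i] lam_pos[of 0] by (intro divide_left_mono) auto
      ultimately have z: "z \<in> {- (X + x0)..- x0}" "z < 0" using i x0 by (auto simp: I_def)
      define \<xi> where "\<xi> = real k / - z"
      have \<xi>: "0 < \<xi>" "real k = \<xi> * - z"
      proof -
        have "0 < real k" "0 < - z" using z(2) assms by auto
        then show "0 < \<xi>" unfolding \<xi>_def by (rule divide_pos_pos)
        show "real k = \<xi> * - z" using z(2) by (simp add: \<xi>_def)
      qed
      have "(\<Sum>i\<in>T. indicator (I i) z :: real) \<le> (\<Sum>i\<in>T. 2 * (ratio_min (lam i) \<xi> powr 1))"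
      proof (rule sum_mono)
        fix j
        have rm: "0 \<le> ratio_min (lam j) \<xi>" using lam_pos[of j] \<xi> by (simp add: ratio_min_def)
        show "indicator (I j) z \<le> 2 * (ratio_min (lam j) \<xi> powr 1)"
        proof (cases "z \<in> I j")
          case True
          have "\<xi> * - z \<le> lam j * - z" "lam j * - z \<le> (2 * \<xi>) * - z"
            using True lam_pos[of j] \<xi>(2) by (auto simp: I_def field_simps)
          then have "\<xi> \<le> lam j" "lam j \<le> 2 * \<xi>"
            using z(2) by (simp_all only: mult_le_cancel_right)
          then have "1 / 2 \<le> lam j / \<xi>" "1 / 2 \<le> \<xi> / lam j"
            using \<xi> lam_pos[of j] by (auto simp: field_simps)
          then have "1 / 2 \<le> ratio_min (lam j) \<xi>" unfolding ratio_min_def by (rule min.boundedI)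
          then show ?thesis using True rm by simp
        qed (use rm in auto)
      qed
      also have "\<dots> \<le> 2 * S"
        unfolding sum_distrib_left[symmetric] using S(2)[OF T, of \<xi>] \<xi> by simp
      finally have "ennreal (\<Sum>i\<in>T. indicator (I i) z) \<le> ennreal (2 * S)" by (rule ennreal_leI)
      then show ?thesis using z by (simp add: sum_ennreal[symmetric] ennreal_indicator del: sum_ennreal)
    qed auto
    have "(\<Sum>i\<in>T. scale_integral \<alpha> \<psi> k i)
      \<le> (\<Sum>i\<in>T. \<integral>\<^sup>+z. ennreal C * (\<psi> (exp z) * ennreal (w z)) * indicator (I i) z \<partial>lborel)"
      by (intro sum_mono one)
    also have "\<dots> = (\<integral>\<^sup>+z. (\<Sum>i\<in>T. ennreal C * (\<psi> (exp z) * ennreal (w z)) * indicator (I i) z) \<partial>lborel)"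
      by (intro nn_integral_sum[symmetric]) (simp add: I_def)
    also have "\<dots> = (\<integral>\<^sup>+z. ennreal C * (\<psi> (exp z) * ennreal (w z)) * (\<Sum>i\<in>T. indicator (I i) z) \<partial>lborel)"
      by (simp add: sum_distrib_left)
    also have "\<dots> \<le> (\<integral>\<^sup>+z. ennreal C * (\<psi> (exp z) * ennreal (w z)) * (ennreal (2 * S) * indicator {- (X + x0)..- x0} z) \<partial>lborel)"
      by (intro nn_integral_mono mult_left_mono overlap) auto
    also have "\<dots> = (\<integral>\<^sup>+z. ennreal (2 * S * C) * (\<psi> (exp z) * ennreal (w z) * indicator {- (X + x0)..- x0} z) \<partial>lborel)"
      using S C by (simp add: ennreal_mult mult_ac)
    also have "\<dots> = ennreal (2 * S * C) * (\<integral>\<^sup>+z. \<psi> (exp z) * ennreal (w z) * indicator {- (X + x0)..- x0} z \<partial>lborel)"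
      by (rule nn_integral_cmult) measurable
    also have "(\<integral>\<^sup>+z. \<psi> (exp z) * ennreal (w z) * indicator {- (X + x0)..- x0} z \<partial>lborel)
      = (\<integral>\<^sup>+z. (\<lambda>t. \<psi> t * ennreal ((1 - t) powr (\<alpha> - 1))) (exp z) * ennreal (exp z) * indicator {- (X + x0)..- x0} z \<partial>lborel)"
      by (simp add: w_def ennreal_mult mult.assoc)
    also have "\<dots> = (\<integral>\<^sup>+t. \<psi> t * ennreal ((1 - t) powr (\<alpha> - 1)) * indicator {exp (- (X + x0))..exp (- x0)} t \<partial>lborel)"
    proof (rule nn_integral_substitution_aux[symmetric])
      have "0 < X" unfolding X_def using assms lam_pos[of 0] by simp
      then show "- (X + x0) < - x0" by simp
    qed (auto intro!: continuous_intros derivative_eq_intros)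
    also have "\<dots> \<le> (\<integral>\<^sup>+t. ennreal ((1 - t) powr (\<alpha> - 1)) * \<psi> t * indicator {0..1} t \<partial>lborel)"
    proof (intro nn_integral_mono)
      fix t :: real
      have "0 \<le> t" if "exp (- (X + x0)) \<le> t" using that exp_gt_zero[of "- (X + x0)"] by linarith
      moreover have "t \<le> 1" if "t \<le> exp (- x0)" using that x0 by (smt (verit) exp_le_one_iff)
      ultimately show "\<psi> t * ennreal ((1 - t) powr (\<alpha> - 1)) * indicator {exp (- (X + x0))..exp (- x0)} t
        \<le> ennreal ((1 - t) powr (\<alpha> - 1)) * \<psi> t * indicator {0..1} t"
        by (auto simp: indicator_def mult.commute)
    qed
    also have "\<dots> = (\<integral>\<^sup>+t. \<psi> t \<partial>weight_measure (\<alpha> - 1))"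
      by (rule nn_integral_weight_measure[symmetric]) measurable
    finally show ?thesis by (simp add: mult_left_mono)
  qed simp
  then show ?thesis using S C by (intro exI[of _ "2 * S * C"]) auto
qed


text \<open>
  The extraction with error factor \<open>1 / (2 * S)\<close>, raised to the power \<open>q\<close>, averaged over the free
  scale \<open>s\<close> and summed over all indices. The errors then sum up to at most half of the left-hand
  side, which is finite, and are absorbed.
\<close>

lemma group_sizes_bounded_by_norm:
  assumes \<alpha>: "0 < \<alpha>" and q: "1 \<le> q"
  shows "\<exists>C>0. \<forall>a T f X. finite T \<longrightarrow> (\<forall>j\<in>T. G j \<subseteq> T) \<longrightarrow> f \<in> borel_measurable borel \<longrightarrow>
    (\<forall>x\<ge>0. f (exp (- x)) = esum a T x) \<longrightarrow> 0 \<le> X \<longrightarrow>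
    (\<integral>\<^sup>+t. ennreal (cmod (f t) powr q) \<partial>weight_measure (\<alpha> - 1)) = ennreal X \<longrightarrow>
    (\<Sum>i\<in>T. (lam i powr (- (\<alpha> / q)) * group_size a i) powr q) \<le> C * X"
proof -
  define \<sigma> where "\<sigma> = \<alpha> / q"
  have \<sigma>: "0 < \<sigma>" "\<sigma> * q = \<alpha>" using assms by (auto simp: \<sigma>_def)
  obtain S where S: "S > 0" "\<And>T \<xi>. finite T \<Longrightarrow> 0 < \<xi> \<Longrightarrow> (\<Sum>j\<in>T. ratio_min (lam j) \<xi> powr 1) \<le> S"
    using lacunary_sum_bound[of 1] by auto
  have S': "(\<Sum>j\<in>T. scale_ratio j i) \<le> S" if "finite T" for T i
    using S(2)[OF that lam_pos[of i]] by simp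
  obtain d D where D: "D > 0" "\<And>a T i s. finite T \<Longrightarrow> (\<forall>j\<in>T. G j \<subseteq> T) \<Longrightarrow> i \<in> T \<Longrightarrow> 1 \<le> s \<Longrightarrow> s \<le> 2 \<Longrightarrow>
    normalised_size \<sigma> a i \<le>
      D * (lam i powr (- \<sigma>) * (\<Sum>k=1..d. cmod (esum a T (real k * (s / lam i)))))
      + 1 / (2 * S) * (\<Sum>j\<in>T. scale_ratio i j * normalised_size \<sigma> a j)"
  proof -
    have "0 < 1 / (2 * S)" using S(1) by simp
    from group_extraction[OF \<sigma>(1) this] show thesis
      by (elim exE conjE) (rule that, assumption, blast)
  qed
  let ?Q = "\<lambda>k Ck. 1 \<le> k \<longrightarrow> Ck > 0 \<and> (\<forall>T \<psi>. finite T \<longrightarrow> \<psi> \<in> borel_measurable borel \<longrightarrow>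
    (\<Sum>i\<in>T. scale_integral \<alpha> \<psi> k i)
    \<le> ennreal Ck * (\<integral>\<^sup>+t. \<psi> t \<partial>weight_measure (\<alpha> - 1)))"
  have "\<exists>Ck. ?Q k Ck" for k
  proof (cases "1 \<le> k")
    case True
    show ?thesis by (rule ex_forward[OF scale_integrals_bound[OF True \<alpha>]]) (rule impI)
  qed simp
  then have "\<exists>Ck. \<forall>k. ?Q k (Ck k)" by (intro choice allI)
  then obtain Ck where Ck0: "\<forall>k. ?Q k (Ck k)" by (elim exE) (rule that)
  have Ck: "\<And>k. 1 \<le> k \<Longrightarrow> 0 < Ck k"
    "\<And>k T \<psi>. 1 \<le> k \<Longrightarrow> finite T \<Longrightarrow> \<psi> \<in> borel_measurable borel \<Longrightarrow>
    (\<Sum>i\<in>T. scale_integral \<alpha> \<psi> k i)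
    \<le> ennreal (Ck k) * (\<integral>\<^sup>+t. \<psi> t \<partial>weight_measure (\<alpha> - 1))"
    using Ck0 by blast+
  define A where "A = 2 powr (q - 1) * D powr q * (real d + 1) powr (q - 1)"
  have A: "0 \<le> A" by (simp add: A_def)
  define CK where "CK = (\<Sum>k=1..d. Ck k)"
  have CK: "0 \<le> CK" unfolding CK_def using Ck(1) by (intro sum_nonneg) (simp add: less_imp_le)
  have "(\<Sum>i\<in>T. normalised_size \<sigma> a i powr q) \<le> (2 * A * CK + 1) * X"
    if T: "finite T" "\<forall>j\<in>T. G j \<subseteq> T" and fm: "f \<in> borel_measurable borel"
      and fe: "\<forall>x\<ge>0. f (exp (- x)) = esum a T x" and X: "0 \<le> X"
      and fX: "(\<integral>\<^sup>+t. ennreal (cmod (f t) powr q) \<partial>weight_measure (\<alpha> - 1)) = ennreal X" for a T f X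
  proof -
    define c where "c = (\<lambda>i. normalised_size \<sigma> a i)"
    have c0: "0 \<le> c i" for i by (simp add: c_def group_size_nonneg)
    define \<psi> where "\<psi> = (\<lambda>t. ennreal (cmod (f t) powr q))"
    have \<psi>m [measurable]: "\<psi> \<in> borel_measurable borel" unfolding \<psi>_def using fm by measurable
    define V where "V = (\<lambda>i. 1 / (2 * S) * (\<Sum>j\<in>T. scale_ratio i j * c j powr q))"
    have V0: "0 \<le> V i" for i unfolding V_def using S by (intro mult_nonneg_nonneg sum_nonneg) auto
    have pw: "c i powr q \<le> A * (lam i powr (- \<alpha>) * (\<Sum>k=1..d. cmod (f (exp (- (real k * (s / lam i))))) powr q)) + V i"
      if i: "i \<in> T" and s: "1 \<le> s" "s \<le> 2" for i s
    proof -
      define g where "g = (\<lambda>k. cmod (f (exp (- (real k * (s / lam i))))))"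
      define U where "U = lam i powr (- \<sigma>) * (\<Sum>k=1..d. g k)"
      define R where "R = (\<Sum>j\<in>T. scale_ratio i j * c j)"
      have U0: "0 \<le> U" unfolding U_def g_def by (intro mult_nonneg_nonneg sum_nonneg) auto
      have R0: "0 \<le> R" unfolding R_def using c0 by (intro mult_nonneg_nonneg sum_nonneg) auto
      have "g k = cmod (esum a T (real k * (s / lam i)))" for k
        unfolding g_def using fe s lam_pos[of i] by simp
      then have "c i \<le> D * U + 1 / (2 * S) * R"
        using D(2)[OF T i s, of a] by (simp add: c_def U_def R_def)
      then have "c i powr q \<le> (D * U + 1 / (2 * S) * R) powr q"
        using c0 q by (intro powr_mono2) auto
      also have "\<dots> \<le> 2 powr (q - 1) * ((D * U) powr q + (1 / (2 * S) * R) powr q)"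
        using U0 R0 D S q by (intro powr_add_le) auto
      also have "(D * U) powr q \<le> D powr q * (lam i powr (- \<alpha>) * ((real d + 1) powr (q - 1) * (\<Sum>k=1..d. g k powr q)))"
      proof -
        have "U powr q = (lam i powr (- \<sigma>)) powr q * (\<Sum>k=1..d. 1 * g k) powr q"
          unfolding U_def by (subst powr_mult) (auto simp: g_def intro!: sum_nonneg)
        also have "(lam i powr (- \<sigma>)) powr q = lam i powr (- \<alpha>)" using \<sigma> by (simp add: powr_powr)
        also have "lam i powr (- \<alpha>) * (\<Sum>k=1..d. 1 * g k) powr q \<le>
            lam i powr (- \<alpha>) * ((real d + 1) powr (q - 1) * (\<Sum>k=1..d. 1 * g k powr q))"
          using q by (intro mult_left_mono weighted_power_mean) (auto simp: g_def)
        finally show ?thesis using D U0 by (simp add: powr_mult mult_left_mono)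
      qed
      also have "(1 / (2 * S) * R) powr q \<le> 2 powr (- q) * (1 / S) * (\<Sum>j\<in>T. scale_ratio i j * c j powr q)"
      proof -
        have "R powr q \<le> S powr (q - 1) * (\<Sum>j\<in>T. scale_ratio i j * c j powr q)"
          unfolding R_def using T c0 q S'[OF T(1), of i]
          by (intro weighted_power_mean) (auto simp: ratio_min_commute[of "lam i"])
        then have "(1 / (2 * S)) powr q * R powr q \<le>
          (1 / (2 * S)) powr q * (S powr (q - 1) * (\<Sum>j\<in>T. scale_ratio i j * c j powr q))"
          by (intro mult_left_mono) auto
        also have "\<dots> = ((1 / (2 * S)) powr q * S powr (q - 1)) * (\<Sum>j\<in>T. scale_ratio i j * c j powr q)"
          by simp
        also have "(1 / (2 * S)) powr q * S powr (q - 1) = 2 powr (- q) * (1 / S)"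
          using S(1) by (simp add: powr_divide powr_mult powr_diff powr_minus field_simps)
        finally show ?thesis using R0 S by (subst powr_mult) auto
      qed
      finally have "c i powr q \<le> 2 powr (q - 1) *
        (D powr q * (lam i powr (- \<alpha>) * ((real d + 1) powr (q - 1) * (\<Sum>k=1..d. g k powr q)))
         + 2 powr (- q) * (1 / S) * (\<Sum>j\<in>T. scale_ratio i j * c j powr q))"
        by (simp add: mult_left_mono add_mono)
      also have "\<dots> = A * (lam i powr (- \<alpha>) * (\<Sum>k=1..d. g k powr q)) +
         (2 powr (q - 1) * 2 powr (- q)) * (1 / S) * (\<Sum>j\<in>T. scale_ratio i j * c j powr q)"
        by (simp add: A_def algebra_simps)
      also have "(2::real) powr (q - 1) * 2 powr (- q) = 1 / 2"
        unfolding powr_add[symmetric] by (simp add: powr_neg_one)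
      finally show ?thesis by (simp add: V_def g_def)
    qed
    have int1: "ennreal (c i powr q) \<le> (\<Sum>k=1..d. ennreal A * (scale_integral \<alpha> \<psi> k i)) + ennreal (V i)" if i: "i \<in> T" for i
    proof -
      let ?h = "\<lambda>k s. ennreal A * (ennreal (lam i powr (- \<alpha>)) * \<psi> (exp (- (real k * (s / lam i)))) * indicator {1..2} s)"
      have "ennreal (c i powr q) = (\<integral>\<^sup>+s. ennreal (c i powr q) * indicator {1..2::real} s \<partial>lborel)"
        by (simp add: nn_integral_cmult)
      also have "\<dots> \<le> (\<integral>\<^sup>+s. (\<Sum>k=1..d. ?h k s) + ennreal (V i) * indicator {1..2} s \<partial>lborel)"
      proof (rule nn_integral_mono)
        fix s :: real
        show "ennreal (c i powr q) * indicator {1..2} s \<le> (\<Sum>k=1..d. ?h k s) + ennreal (V i) * indicator {1..2} s"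
        proof (cases "s \<in> {1..2}")
          case True
          have "ennreal (c i powr q) \<le> ennreal (A * (lam i powr (- \<alpha>) * (\<Sum>k=1..d. cmod (f (exp (- (real k * (s / lam i))))) powr q)) + V i)"
            using pw[OF i] True by (intro ennreal_leI) auto
          also have "\<dots> = (\<Sum>k=1..d. ennreal A * (ennreal (lam i powr (- \<alpha>)) *
            \<psi> (exp (- (real k * (s / lam i)))))) + ennreal (V i)"
            unfolding \<psi>_def using A V0[of i]
            by (simp add: ennreal_mult[symmetric] sum_distrib_left ennreal_plus[symmetric] sum_nonneg del: ennreal_plus)
          finally show ?thesis using True by simp
        qed simp
      qed
      also have "\<dots> = (\<integral>\<^sup>+s. (\<Sum>k=1..d. ?h k s) \<partial>lborel) + (\<integral>\<^sup>+s. ennreal (V i) * indicator {1..2::real} s \<partial>lborel)"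
        by (rule nn_integral_add) measurable
      also have "(\<integral>\<^sup>+s. ennreal (V i) * indicator {1..2::real} s \<partial>lborel) = ennreal (V i)"
        by (simp add: nn_integral_cmult)
      also have "(\<integral>\<^sup>+s. (\<Sum>k=1..d. ?h k s) \<partial>lborel) =
        (\<Sum>k=1..d. \<integral>\<^sup>+s. ?h k s \<partial>lborel)"
        by (rule nn_integral_sum) measurable
      also have "\<dots> = (\<Sum>k=1..d. ennreal A * (scale_integral \<alpha> \<psi> k i))"
        by (intro sum.cong refl nn_integral_cmult) measurable
      finally show ?thesis .
    qed
    define Y where "Y = (\<Sum>i\<in>T. c i powr q)"
    have Y0: "0 \<le> Y" by (simp add: Y_def sum_nonneg)
    have sumV: "(\<Sum>i\<in>T. V i) \<le> Y / 2"
    proof -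
      have "(\<Sum>i\<in>T. V i) = 1 / (2 * S) * (\<Sum>j\<in>T. (\<Sum>i\<in>T. scale_ratio i j) * c j powr q)"
        unfolding V_def sum_distrib_left[symmetric] sum_distrib_right by (subst sum.swap) simp
      also have "\<dots> \<le> 1 / (2 * S) * (\<Sum>j\<in>T. S * c j powr q)"
        using S(1) S'[OF T(1)] by (intro mult_left_mono sum_mono mult_right_mono) auto
      also have "\<dots> = Y / 2" using S(1) by (simp add: Y_def sum_distrib_left[symmetric])
      finally show ?thesis .
    qed
    have "ennreal Y = (\<Sum>i\<in>T. ennreal (c i powr q))" by (simp add: Y_def)
    also have "\<dots> \<le> (\<Sum>i\<in>T. (\<Sum>k=1..d. ennreal A * (scale_integral \<alpha> \<psi> k i)) + ennreal (V i))"
      by (intro sum_mono int1)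
    also have "\<dots> = (\<Sum>k=1..d. ennreal A * (\<Sum>i\<in>T. scale_integral \<alpha> \<psi> k i)) + (\<Sum>i\<in>T. ennreal (V i))"
      by (simp add: sum.distrib sum_distrib_left sum.swap[of _ T])
    also have "\<dots> \<le> (\<Sum>k=1..d. ennreal A * (ennreal (Ck k) * ennreal X)) + ennreal (\<Sum>i\<in>T. V i)"
    proof (intro add_mono sum_mono mult_left_mono)
      fix k assume "k \<in> {1..d}"
      then have "1 \<le> k" by simp
      from Ck(2)[OF this T(1) \<psi>m] show "(\<Sum>i\<in>T. scale_integral \<alpha> \<psi> k i) \<le> ennreal (Ck k) * ennreal X"
        using fX by (simp only: \<psi>_def)
    qed (use V0 in auto)
    also have "\<dots> = ennreal (A * CK * X + (\<Sum>i\<in>T. V i))"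
    proof -
      have "(\<Sum>k=1..d. ennreal A * (ennreal (Ck k) * ennreal X)) = (\<Sum>k=1..d. ennreal (A * (Ck k * X)))"
        using A Ck(1) X by (intro sum.cong) (auto simp: ennreal_mult less_imp_le)
      also have "\<dots> = ennreal (\<Sum>k=1..d. A * (Ck k * X))"
        using A Ck(1) X by (intro sum_ennreal) (auto simp: less_imp_le)
      also have "(\<Sum>k=1..d. A * (Ck k * X)) = A * CK * X"
        by (simp add: CK_def sum_distrib_left sum_distrib_right mult_ac)
      finally show ?thesis using A CK X V0 by (simp add: ennreal_plus sum_nonneg)
    qed
    finally have "ennreal Y \<le> ennreal (A * CK * X + (\<Sum>i\<in>T. V i))" .
    then have "Y \<le> A * CK * X + (\<Sum>i\<in>T. V i)"
      using A CK X V0 by (subst (asm) ennreal_le_iff) (auto intro!: add_nonneg_nonneg sum_nonneg)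
    then have "Y \<le> 2 * A * CK * X" using sumV by linarith
    also have "\<dots> \<le> (2 * A * CK + 1) * X" using X by (simp add: distrib_right)
    finally show ?thesis by (simp add: Y_def c_def)
  qed
  moreover have "0 < 2 * A * CK + 1" using A CK by (simp add: add_nonneg_pos)
  ultimately show ?thesis unfolding \<sigma>_def by blast
qed

section \<open>Powers of lacunary exponential sums\<close>

text \<open>
  For given \<open>x\<close> the terms with \<open>lam i * x > 1\<close> keep the rate \<open>\<gamma>'\<close> after spending \<open>\<gamma> - \<gamma>'\<close> on the
  convergence of the sum. The others do not decay; their sum is at most the partial sum \<open>P k\<close> up to the
  largest index \<open>k\<close> with \<open>lam k * x \<le> 1\<close>, and the \<open>k\<close>-th exponential is bounded below there. Replacing
  the unknown \<open>k\<close> by a sum over all indices is harmless because the weighted \<open>P k\<close> satisfy a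
  discrete Hardy inequality. In this form the majorant can be integrated term by term against any
  measure, even one that is very unevenly distributed between the scales of the exponents.
\<close>

lemma exponential_sum_power_majorant:
  assumes r: "1 \<le> r" and g: "0 < \<gamma>'" "\<gamma>' < \<gamma>" and \<sigma>: "0 < \<sigma>"
  shows "\<exists>C>0. \<forall>T c. finite T \<longrightarrow> (\<forall>i. 0 \<le> c i) \<longrightarrow> (\<exists>A. (\<forall>i. 0 \<le> A i) \<and>
    (\<forall>x\<ge>0. (\<Sum>i\<in>T. c i * lam i powr \<sigma> * decay \<gamma> i x) powr r
       \<le> (\<Sum>i\<in>T. A i * exp (- (\<gamma>' * r * lam i * x)))) \<and>
    (\<Sum>i\<in>T. A i * lam i powr (- (\<sigma> * r))) \<le> C * (\<Sum>i\<in>T. c i powr r))"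
proof -
  obtain S where S: "S > 0" "\<And>T \<xi>. finite T \<Longrightarrow> 0 < \<xi> \<Longrightarrow> (\<Sum>j\<in>T. ratio_min (lam j) \<xi> powr 1) \<le> S"
    using lacunary_sum_bound[of 1] by auto
  obtain S' where S': "S' > 0" "\<And>T \<xi>. finite T \<Longrightarrow> 0 < \<xi> \<Longrightarrow> (\<Sum>j\<in>T. ratio_min (lam j) \<xi> powr \<sigma>) \<le> S'"
    using lacunary_sum_bound[OF \<sigma>] by auto
  define \<eta> where "\<eta> = \<gamma> - \<gamma>'"
  have \<eta>: "\<eta> > 0" using g by (simp add: \<eta>_def)
  define C1 where "C1 = 2 powr (r - 1) * (S / \<eta>) powr (r - 1)"
  define C2 where "C2 = 2 powr (r - 1) * exp (\<gamma>' * r)"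
  define C where "C = C1 + C2 * (S' powr (r - 1) * S')"
  have C12: "0 < C1" "0 < C2" using S \<eta> by (auto simp: C1_def C2_def)
  have C: "C > 0" using C12 S' by (simp add: C_def add_pos_nonneg)
  have "\<exists>A. (\<forall>i. 0 \<le> A i) \<and>
    (\<forall>x\<ge>0. (\<Sum>i\<in>T. c i * lam i powr \<sigma> * decay \<gamma> i x) powr r
       \<le> (\<Sum>i\<in>T. A i * exp (- (\<gamma>' * r * lam i * x)))) \<and>
    (\<Sum>i\<in>T. A i * lam i powr (- (\<sigma> * r))) \<le> C * (\<Sum>i\<in>T. c i powr r)"
    if T: "finite T" and c: "\<forall>i. 0 \<le> c i" for T c
  proof -
    define b where "b = (\<lambda>i. c i * lam i powr \<sigma>)"
    have b0: "0 \<le> b i" for i using c by (simp add: b_def)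
    define P where "P = (\<lambda>i. \<Sum>j\<in>{j\<in>T. lam j \<le> lam i}. b j)"
    have P0: "0 \<le> P i" for i using b0 by (simp add: P_def sum_nonneg)
    define A where "A = (\<lambda>i. C1 * b i powr r + C2 * P i powr r)"
    have A0: "0 \<le> A i" for i using C12 by (simp add: A_def)
    have main: "(\<Sum>i\<in>T. c i * lam i powr \<sigma> * decay \<gamma> i x) powr r
       \<le> (\<Sum>i\<in>T. A i * exp (- (\<gamma>' * r * lam i * x)))" if x: "0 \<le> x" for x
    proof -
      \<comment> \<open>The exponents that have started to decay at \<open>x\<close>, and the others.\<close>
      define H where "H = {i\<in>T. 1 < lam i * x}"
      define L where "L = {i\<in>T. lam i * x \<le> 1}"
      have HL: "T = H \<union> L" "H \<inter> L = {}" "finite H" "finite L" using T by (auto simp: H_def L_def)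
      define e where "e = (\<lambda>i. exp (- (\<gamma>' * r * lam i * x)))"
      have eP: "decay \<gamma>' i x powr r = e i" for i by (simp add: e_def powr_def mult_ac)
      have high: "(\<Sum>i\<in>H. b i * decay \<gamma> i x) powr r \<le> (S / \<eta>) powr (r - 1) * (\<Sum>i\<in>T. b i powr r * e i)"
      proof -
        have "(\<Sum>i\<in>H. decay \<eta> i x) \<le> S / \<eta>"
        proof (cases "x = 0")
          case True
          then have "H = {}" by (simp add: H_def)
          then show ?thesis using S \<eta> by simp
        next
          case False
          then have x0: "0 < x" using x by simp
          have "(\<Sum>i\<in>H. decay \<eta> i x) \<le> (\<Sum>i\<in>H. 1 / \<eta> * (ratio_min (lam i) (1 / x) powr 1))"
          proof (rule sum_mono)
            fix i assume "i \<in> H"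
            then have i: "1 < lam i * x" by (simp add: H_def)
            then have pos: "0 < lam i * x" by simp
            have "(1 / x) / lam i \<le> lam i / (1 / x)"
            proof -
              have "1 / (lam i * x) \<le> 1" using i by simp
              then have "1 / (lam i * x) \<le> lam i * x" using i by linarith
              then show ?thesis by (simp add: mult.commute)
            qed
            then have rm: "ratio_min (lam i) (1 / x) = 1 / (lam i * x)"
              by (simp add: ratio_min_def min_def mult.commute)
            have "\<eta> * lam i * x < exp (\<eta> * lam i * x)" using exp_ge_add_one_self[of "\<eta> * lam i * x"] by linarith
            then have "decay \<eta> i x \<le> 1 / (\<eta> * lam i * x)"
              using \<eta> pos by (simp add: exp_minus field_simps)
            then show "decay \<eta> i x \<le> 1 / \<eta> * (ratio_min (lam i) (1 / x) powr 1)"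
              using pos by (simp add: rm mult.assoc)
          qed
          also have "\<dots> \<le> 1 / \<eta> * S"
            unfolding sum_distrib_left[symmetric] using S(2)[OF HL(3), of "1 / x"] x0 \<eta> by (intro mult_left_mono) auto
          finally show ?thesis by simp
        qed
        then have "(\<Sum>i\<in>H. decay \<eta> i x * (b i * decay \<gamma>' i x)) powr r \<le>
          (S / \<eta>) powr (r - 1) * (\<Sum>i\<in>H. decay \<eta> i x * (b i * decay \<gamma>' i x) powr r)"
          using HL r b0 by (intro weighted_power_mean) auto
        also have "(\<Sum>i\<in>H. decay \<eta> i x * (b i * decay \<gamma>' i x) powr r) \<le> (\<Sum>i\<in>H. 1 * (b i powr r * e i))"
        proof (rule sum_mono)
          fix i
          have "0 \<le> \<eta> * lam i * x" using \<eta> x lam_pos[of i] by simp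
          then have "decay \<eta> i x \<le> 1" by simp
          then show "decay \<eta> i x * (b i * decay \<gamma>' i x) powr r \<le> 1 * (b i powr r * e i)"
          proof -
            have "(b i * decay \<gamma>' i x) powr r = b i powr r * e i"
              using b0 by (subst powr_mult) (auto simp: eP)
            moreover have "0 \<le> b i powr r * e i" by (simp add: e_def)
            ultimately show ?thesis using \<open>decay \<eta> i x \<le> 1\<close> by (simp only: mult_right_mono)
          qed
        qed
        also have "\<dots> \<le> (\<Sum>i\<in>T. b i powr r * e i)"
          using HL T by (simp, intro sum_mono2) (auto simp: e_def)
        finally have "(\<Sum>i\<in>H. decay \<eta> i x * (b i * decay \<gamma>' i x)) powr r \<le>
          (S / \<eta>) powr (r - 1) * (\<Sum>i\<in>T. b i powr r * e i)" by (simp add: mult_left_mono)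
        moreover have "decay \<eta> i x * (b i * decay \<gamma>' i x) = b i * decay \<gamma> i x" for i
        proof -
          have "decay \<eta> i x * decay \<gamma>' i x = decay \<gamma> i x"
            by (simp add: \<eta>_def exp_add[symmetric] algebra_simps)
          then show ?thesis by (simp add: mult.left_commute)
        qed
        ultimately show ?thesis by simp
      qed
      have low: "(\<Sum>i\<in>L. b i * decay \<gamma> i x) powr r \<le> exp (\<gamma>' * r) * (\<Sum>i\<in>T. P i powr r * e i)"
      proof (cases "L = {}")
        case False
        define k where "k = Max L"
        have k: "k \<in> L" "\<And>i. i \<in> L \<Longrightarrow> i \<le> k" using False HL by (auto simp: k_def)
        have "(\<Sum>i\<in>L. b i * decay \<gamma> i x) \<le> (\<Sum>i\<in>L. b i * 1)"
          using b0 g x lam_pos by (intro sum_mono mult_left_mono) (auto simp: less_imp_le)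
        also have "\<dots> \<le> P k"
          unfolding P_def using k T b0 lam_mono
          by (simp, intro sum_mono2) (auto simp: L_def strict_mono_less_eq)
        finally have "(\<Sum>i\<in>L. b i * decay \<gamma> i x) powr r \<le> P k powr r * 1"
          using b0 r by (simp, intro powr_mono2 sum_nonneg) auto
        also have "\<dots> \<le> P k powr r * (exp (\<gamma>' * r) * e k)"
        proof -
          have "\<gamma>' * r * (lam k * x) \<le> \<gamma>' * r * 1" using k g r by (intro mult_left_mono) (auto simp: L_def)
          then have "1 \<le> exp (\<gamma>' * r) * e k" by (simp add: e_def exp_add[symmetric] mult.assoc)
          then show ?thesis by (intro mult_left_mono) auto
        qed
        also have "\<dots> = exp (\<gamma>' * r) * (P k powr r * e k)" by simp
        also have "P k powr r * e k \<le> (\<Sum>i\<in>T. P i powr r * e i)"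
          using k T by (intro member_le_sum) (auto simp: L_def e_def)
        finally show ?thesis by simp
      qed (use r in \<open>auto intro!: mult_nonneg_nonneg sum_nonneg simp: e_def\<close>)
      have "(\<Sum>i\<in>T. c i * lam i powr \<sigma> * decay \<gamma> i x) =
        (\<Sum>i\<in>H. b i * decay \<gamma> i x) + (\<Sum>i\<in>L. b i * decay \<gamma> i x)"
        unfolding b_def by (subst HL(1), rule sum.union_disjoint) (use HL in auto)
      then have "(\<Sum>i\<in>T. c i * lam i powr \<sigma> * decay \<gamma> i x) powr r \<le>
        2 powr (r - 1) * ((\<Sum>i\<in>H. b i * decay \<gamma> i x) powr r + (\<Sum>i\<in>L. b i * decay \<gamma> i x) powr r)"
        using b0 r by (simp, intro powr_add_le sum_nonneg) auto
      also have "\<dots> \<le> 2 powr (r - 1) * ((S / \<eta>) powr (r - 1) * (\<Sum>i\<in>T. b i powr r * e i) + exp (\<gamma>' * r) * (\<Sum>i\<in>T. P i powr r * e i))"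
        using high low by (intro mult_left_mono add_mono) auto
      also have "\<dots> = (\<Sum>i\<in>T. A i * e i)"
        by (simp add: A_def C1_def C2_def distrib_left distrib_right sum.distrib sum_distrib_left mult_ac)
      finally show ?thesis by (simp add: e_def)
    qed
    have "(\<Sum>i\<in>T. A i * lam i powr (- (\<sigma> * r))) \<le> C * (\<Sum>i\<in>T. c i powr r)"
    proof -
      have cb: "b i powr r * lam i powr (- (\<sigma> * r)) = c i powr r" for i
        using c lam_pos[of i] by (simp add: b_def powr_mult powr_powr powr_add[symmetric])
      have cP: "P i powr r * lam i powr (- (\<sigma> * r)) \<le> S' powr (r - 1) * (\<Sum>j\<in>T. scale_ratio j i powr \<sigma> * c j powr r)" for i
      proof -
        let ?J = "{j\<in>T. lam j \<le> lam i}"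
        have rm: "scale_ratio j i powr \<sigma> = lam j powr \<sigma> * lam i powr (- \<sigma>)" if "j \<in> ?J" for j
        proof -
          have "lam j / lam i \<le> 1" "1 \<le> lam i / lam j" using that lam_pos[of j] lam_pos[of i] by auto
          then have eq: "scale_ratio j i = lam j / lam i" by (simp add: ratio_min_def)
          have "(lam j / lam i) powr \<sigma> = lam j powr \<sigma> / lam i powr \<sigma>"
            using lam_pos[of j] lam_pos[of i] by (simp add: powr_divide)
          then show ?thesis unfolding eq by (simp add: powr_minus divide_inverse)
        qed
        have "P i powr r * lam i powr (- (\<sigma> * r)) = (P i * lam i powr (- \<sigma>)) powr r"
          using P0 by (subst powr_mult) (auto simp: powr_powr)
        also have "P i * lam i powr (- \<sigma>) = (\<Sum>j\<in>?J. scale_ratio j i powr \<sigma> * c j)"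
          unfolding P_def sum_distrib_right using rm by (intro sum.cong) (auto simp: b_def mult_ac)
        also have "\<dots> powr r \<le> S' powr (r - 1) * (\<Sum>j\<in>?J. scale_ratio j i powr \<sigma> * c j powr r)"
          using T c r S'(2)[of ?J "lam i"] lam_pos[of i] by (intro weighted_power_mean) auto
        also have "\<dots> \<le> S' powr (r - 1) * (\<Sum>j\<in>T. scale_ratio j i powr \<sigma> * c j powr r)"
          using T c by (intro mult_left_mono sum_mono2) auto
        finally show ?thesis .
      qed
      have "(\<Sum>i\<in>T. A i * lam i powr (- (\<sigma> * r))) =
        C1 * (\<Sum>i\<in>T. c i powr r) + C2 * (\<Sum>i\<in>T. P i powr r * lam i powr (- (\<sigma> * r)))"
        by (simp add: A_def distrib_right sum.distrib sum_distrib_left cb mult.assoc)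
      also have "\<dots> \<le> C1 * (\<Sum>i\<in>T. c i powr r) + C2 * (\<Sum>i\<in>T. S' powr (r - 1) * (\<Sum>j\<in>T. scale_ratio j i powr \<sigma> * c j powr r))"
        using C12 cP by (intro add_left_mono mult_left_mono sum_mono) auto
      also have "(\<Sum>i\<in>T. S' powr (r - 1) * (\<Sum>j\<in>T. scale_ratio j i powr \<sigma> * c j powr r)) =
        S' powr (r - 1) * (\<Sum>j\<in>T. (\<Sum>i\<in>T. scale_ratio i j powr \<sigma>) * c j powr r)"
        unfolding sum_distrib_left[symmetric] sum_distrib_right
        by (subst sum.swap) (simp add: ratio_min_commute)
      also have "\<dots> \<le> S' powr (r - 1) * (\<Sum>j\<in>T. S' * c j powr r)"
        using S'(2)[OF T] lam_pos by (intro mult_left_mono sum_mono mult_right_mono) auto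
      finally have "(\<Sum>i\<in>T. A i * lam i powr (- (\<sigma> * r))) \<le> C1 * (\<Sum>i\<in>T. c i powr r) + C2 * (S' powr (r - 1) * (\<Sum>j\<in>T. S' * c j powr r))"
        using C12 by (simp add: mult_left_mono)
      then show ?thesis by (simp add: C_def distrib_right sum_distrib_left[symmetric] mult.assoc)
    qed
    then show ?thesis using A0 main by blast
  qed
  then show ?thesis using C by blast
qed

end

section \<open>Quasi-lacunary sequences split into groups\<close>

lemma decomposition_index_lower_bound:
  fixes n :: "nat \<Rightarrow> int"
  assumes "strict_mono n" "n 0 = -1"
  shows "int k - 1 \<le> n k"
proof (induction k)
  case (Suc k)
  have "n k < n (Suc k)" using assms by (simp add: strict_mono_Suc_iff)
  then show ?case using Suc by simp
qed (use assms in simp)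

lemma block_between:
  fixes n :: "nat \<Rightarrow> int"
  assumes "strict_mono n" "n 0 = -1" "-1 < j"
  obtains k where "n k < j" "j \<le> n (Suc k)"
proof -
  have ex: "\<exists>k. j \<le> n k"
    using decomposition_index_lower_bound[OF assms(1,2), of "nat (j + 1)"] assms(3)
    by (intro exI[of _ "nat (j + 1)"]) simp
  define m where "m = (LEAST k. j \<le> n k)"
  have m: "j \<le> n m" unfolding m_def using ex by (rule LeastI_ex)
  then have "m \<noteq> 0" using assms by (intro notI) simp
  then obtain k where k: "m = Suc k" using not0_implies_Suc by blast
  have "\<not> j \<le> n k" using not_less_Least[of k "\<lambda>k. j \<le> n k"] k unfolding m_def by simp
  then show ?thesis using m k by (intro that[of k]) auto
qed

text \<open>
  Two blocks after the block of \<open>j\<close>, at most \<open>2 * N\<close> indices later, the exponent has grown by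
  the factor \<open>q\<close>, because the last elements of consecutive blocks do. The finitely many indices before this holds
  are taken care of by enlarging the shift.
\<close>

lemma quasi_lacunary_shift_growth:
  assumes lam: "strict_mono lam" "\<And>k. 0 < lam k" and dec: "quasi_lacunary_decomposition lam n"
  shows "\<exists>M\<ge>1. \<exists>q>1. \<forall>j. q * lam j \<le> lam (j + M)"
proof -
  from dec obtain N q where n: "strict_mono n" "n 0 = -1" and N: "1 \<le> N" and q: "1 < q"
    and card: "\<And>k. card (block lam n k) \<le> N"
    and ev: "\<forall>\<^sub>F k in sequentially. lam (nat (n (Suc k))) / lam (nat (n k)) > q"
    unfolding quasi_lacunary_decomposition_def by blast
  obtain K where K: "\<And>k. K \<le> k \<Longrightarrow> lam (nat (n (Suc k))) / lam (nat (n k)) > q"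
    using ev unfolding eventually_sequentially by blast
  have step: "n (Suc k) \<le> n k + int N" for k
  proof -
    have "inj_on (\<lambda>j. lam (nat j)) {n k + 1..n (Suc k)}"
    proof (rule inj_onI)
      fix x y assume xy: "x \<in> {n k + 1..n (Suc k)}" "y \<in> {n k + 1..n (Suc k)}" "lam (nat x) = lam (nat y)"
      have "nat x = nat y" using strict_mono_eq[OF lam(1)] xy by blast
      moreover have "0 \<le> x" "0 \<le> y" using xy decomposition_index_lower_bound[OF n, of k] by auto
      ultimately show "x = y" by simp
    qed
    then have "card (block lam n k) = nat (n (Suc k) - n k)"
      unfolding block_def by (simp add: card_image)
    then show ?thesis using card[of k] by simp
  qed
  define J where "J = nat (n (Suc K))"
  have far: "q * lam j \<le> lam (j + 2 * N)" if j: "J \<le> j" for j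
  proof -
    obtain k where k: "n k < int j + 1" "int j + 1 \<le> n (Suc k)"
      using block_between[OF n, of "int j + 1"] by auto
    have "n (Suc K) < n (Suc k)"
    proof -
      have "0 \<le> n (Suc K)" using decomposition_index_lower_bound[OF n, of "Suc K"] by simp
      then show ?thesis using j k(2) by (simp add: J_def)
    qed
    then have "K < k" using n(1) by (simp add: strict_mono_less)
    then have "q < lam (nat (n (Suc (Suc k)))) / lam (nat (n (Suc k)))" by (intro K) simp
    then have "q * lam (nat (n (Suc k))) < lam (nat (n (Suc (Suc k))))"
      using lam(2)[of "nat (n (Suc k))"] by (simp add: field_simps)
    moreover have "lam j \<le> lam (nat (n (Suc k)))"
      using lam(1) k(2) by (simp add: strict_mono_less_eq)
    then have "q * lam j \<le> q * lam (nat (n (Suc k)))" using q by simp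
    moreover have "lam (nat (n (Suc (Suc k)))) \<le> lam (j + 2 * N)"
      using lam(1) k(1) step[of k] step[of "Suc k"] by (simp add: strict_mono_less_eq)
    ultimately show ?thesis by linarith
  qed
  have "q * lam j \<le> lam (j + (J + 2 * N))" for j
  proof -
    have "lam j \<le> lam (max j J)" using lam(1) by (simp add: strict_mono_less_eq)
    then have "q * lam j \<le> q * lam (max j J)" using q by simp
    also have "\<dots> \<le> lam (max j J + 2 * N)" by (rule far) simp
    also have "\<dots> \<le> lam (j + (J + 2 * N))" using lam(1) by (simp add: strict_mono_less_eq)
    finally show ?thesis .
  qed
  then show ?thesis using q N by (intro exI[of _ "J + 2 * N"]) auto
qed

lemma quasi_lacunary_growth:
  assumes lam: "strict_mono lam" "\<And>k. 0 < lam k" and dec: "quasi_lacunary_decomposition lam n"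
  shows "\<exists>\<rho>>1. \<exists>M. \<forall>i j. i \<le> j \<longrightarrow> \<rho> ^ j * lam i \<le> \<rho> ^ (M + i) * lam j"
proof -
  obtain M q where M: "1 \<le> M" and q: "1 < q" and step: "\<And>j. q * lam j \<le> lam (j + M)"
    using quasi_lacunary_shift_growth[OF assms] by blast
  define \<rho> where "\<rho> = q powr (1 / real M)"
  have \<rho>: "1 < \<rho>" "\<rho> ^ M = q"
    using M q by (auto simp: \<rho>_def powr_powr powr_realpow[symmetric] gr_one_powr)
  have iter: "q ^ t * lam i \<le> lam (i + M * t)" for i t
  proof (induction t)
    case (Suc t)
    have "q ^ Suc t * lam i \<le> q * lam (i + M * t)" using Suc q by simp
    also have "\<dots> \<le> lam (i + M * t + M)" by (rule step)
    finally show ?case by (simp add: add_ac)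
  qed simp
  have "\<rho> ^ j * lam i \<le> \<rho> ^ (M + i) * lam j" if ij: "i \<le> j" for i j
  proof -
    define t where "t = (j - i) div M"
    have t: "i + M * t \<le> j" "j \<le> i + M * t + M"
    proof -
      have "(j - i) mod M < M" using M by (intro mod_less_divisor) simp
      moreover have "j - i = M * t + (j - i) mod M" by (simp add: t_def)
      ultimately show "i + M * t \<le> j" "j \<le> i + M * t + M" using ij by linarith+
    qed
    have "\<rho> ^ j * lam i \<le> \<rho> ^ (i + M * t + M) * lam i"
      using t(2) \<rho> lam(2)[of i] by (intro mult_right_mono power_increasing) auto
    also have "\<dots> = \<rho> ^ (M + i) * (q ^ t * lam i)"
      by (simp add: power_add power_mult \<rho>(2) mult_ac)
    also have "\<dots> \<le> \<rho> ^ (M + i) * lam (i + M * t)"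
      using \<rho> iter by (intro mult_left_mono) auto
    also have "\<dots> \<le> \<rho> ^ (M + i) * lam j"
      using \<rho> lam(1) t(1) by (intro mult_left_mono) (auto simp: strict_mono_less_eq)
    finally show ?thesis .
  qed
  then show ?thesis using \<rho>(1) by blast
qed

text \<open>
  The blocks of the given decomposition cannot serve as groups: only the last elements of
  consecutive blocks are separated, and a block can be adjacent to the next one. Instead the
  sequence is cut at every ratio of at least \<open>\<tau>\<close>. As \<open>\<tau>\<close> is so close to \<open>1\<close> that \<open>\<tau>\<^sup>2 \<le> \<rho>\<close>, geometric
  growth limits the length of the uncut runs to \<open>2 * M\<close> steps, and the ratio along a run
  to \<open>\<tau> ^ (2 * M) \<le> \<kappa>\<close>.
\<close>

lemma exponent_groups_exist:
  assumes lam: "strict_mono lam" "\<And>k. 0 < lam k" and rho: "1 < \<rho>"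
    and growth: "\<And>i j. i \<le> j \<Longrightarrow> \<rho> ^ j * lam i \<le> \<rho> ^ (M + i) * lam j"
    and kappa: "1 < \<kappa>" "\<kappa> \<le> \<rho>"
  shows "\<exists>G \<tau> N. exponent_groups lam G \<rho> \<kappa> \<tau> M N"
proof -
  define E where "E = 2 * M + 2"
  have E: "0 < E" by (simp add: E_def)
  \<comment> \<open>A single root serves both conditions on \<open>\<tau>\<close>, since \<open>\<kappa> \<le> \<rho>\<close>.\<close>
  define \<tau> where "\<tau> = \<kappa> powr (1 / real E)"
  have \<tau>: "1 < \<tau>" "\<tau> ^ E = \<kappa>"
    using kappa E by (auto simp: \<tau>_def powr_powr powr_realpow[symmetric] gr_one_powr)
  have \<tau>2: "\<tau> ^ 2 \<le> \<rho>" "\<tau> ^ (2 * M) \<le> \<kappa>"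
  proof -
    have "\<tau> ^ 2 \<le> \<tau> ^ E" "\<tau> ^ (2 * M) \<le> \<tau> ^ E"
      using \<tau>(1) by (intro power_increasing; simp add: E_def)+
    then show "\<tau> ^ 2 \<le> \<rho>" "\<tau> ^ (2 * M) \<le> \<kappa>" using \<tau>(2) kappa by auto
  qed
  define G where "G = (\<lambda>i. {j. \<forall>l. min i j \<le> l \<and> l < max i j \<longrightarrow> lam (Suc l) < \<tau> * lam l})"
  have mono: "lam i \<le> lam j" if "i \<le> j" for i j using lam(1) that by (simp add: strict_mono_less_eq)
  have sym: "j \<in> G i \<longleftrightarrow> i \<in> G j" for i j by (simp add: G_def min.commute max.commute)
  have trans: "k \<in> G i" if jk: "j \<in> G i" "k \<in> G j" for i j k
  proof -
    have "lam (Suc l) < \<tau> * lam l" if "min i k \<le> l" "l < max i k" for l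
    proof -
      have "(min i j \<le> l \<and> l < max i j) \<or> (min j k \<le> l \<and> l < max j k)" using that by linarith
      then show ?thesis using jk by (auto simp: G_def)
    qed
    then show ?thesis by (simp add: G_def)
  qed
  have run: "j - i \<le> 2 * M \<and> lam j \<le> \<kappa> * lam i" if ij: "i \<le> j" "j \<in> G i" for i j
  proof -
    have le: "lam (i + d) \<le> \<tau> ^ d * lam i" if "i + d \<le> j" for d
      using that
    proof (induction d)
      case (Suc d)
      have "lam (Suc (i + d)) < \<tau> * lam (i + d)" using ij Suc.prems by (simp add: G_def)
      also have "\<dots> \<le> \<tau> * (\<tau> ^ d * lam i)" using Suc \<tau> by (intro mult_left_mono) auto
      finally show ?case by (simp add: mult.assoc)
    qed simp
    define d where "d = j - i"
    have j: "j = i + d" using ij by (simp add: d_def)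
    have 1: "lam j \<le> \<tau> ^ d * lam i" using le[of d] j by simp
    have "\<rho> ^ i * (\<rho> ^ d * lam i) \<le> \<rho> ^ i * (\<rho> ^ M * lam j)"
      using growth[OF ij(1)] by (simp add: j power_add mult_ac)
    then have "\<rho> ^ d * lam i \<le> \<rho> ^ M * lam j" using rho by simp
    also have "\<dots> \<le> \<rho> ^ M * (\<tau> ^ d * lam i)" using 1 rho by (intro mult_left_mono) auto
    finally have "\<rho> ^ d \<le> \<rho> ^ M * \<tau> ^ d" using lam(2)[of i] by (simp add: mult.assoc[symmetric])
    then have "(\<rho> ^ d) ^ 2 \<le> (\<rho> ^ M * \<tau> ^ d) ^ 2" using rho by (intro power_mono) auto
    also have "\<dots> = \<rho> ^ (2 * M) * (\<tau> ^ 2) ^ d"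
      by (simp add: power_mult_distrib power_mult[symmetric] mult.commute)
    also have "\<dots> \<le> \<rho> ^ (2 * M) * \<rho> ^ d" using \<tau>2 \<tau> rho by (intro mult_left_mono power_mono) auto
    finally have "\<rho> ^ d * \<rho> ^ d \<le> \<rho> ^ (2 * M) * \<rho> ^ d" by (simp add: power2_eq_square)
    then have "\<rho> ^ d \<le> \<rho> ^ (2 * M)" using rho by simp
    then have d: "d \<le> 2 * M" using rho by simp
    have "\<tau> ^ d \<le> \<tau> ^ (2 * M)" using d \<tau> by (intro power_increasing) auto
    then have "\<tau> ^ d * lam i \<le> \<kappa> * lam i" using \<tau>2(2) lam(2)[of i] by (intro mult_right_mono) auto
    then show ?thesis using 1 d by (simp add: d_def)
  qed
  have sub: "G i \<subseteq> {i - 2 * M..i + 2 * M}" for i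
  proof
    fix j assume j: "j \<in> G i"
    show "j \<in> {i - 2 * M..i + 2 * M}"
    proof (cases "i \<le> j")
      case True
      then show ?thesis using run[OF True j] by auto
    next
      case False
      then show ?thesis using run[of j i] j sym[of j i] by auto
    qed
  qed
  \<comment> \<open>A group lies within \<open>2 * M\<close> indices on either side of each of its members.\<close>
  have "exponent_groups lam G \<rho> \<kappa> \<tau> M (4 * M)"
  proof
    show "i \<in> G i" for i by (simp add: G_def)
    show "G j = G i" if "j \<in> G i" for i j using that sym trans by blast
    show "finite (G i)" for i using sub[of i] by (rule finite_subset) simp
    have "card {i - 2 * M..i + 2 * M} \<le> Suc (4 * M)" for i by simp
    then show "card (G i) \<le> Suc (4 * M)" for i
      using card_mono[OF _ sub[of i]] by (meson finite_atLeastAtMost order_trans)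
    show "lam j \<le> \<kappa> * lam i" if "j \<in> G i" for i j
    proof (cases "i \<le> j")
      case False
      then have "lam j \<le> 1 * lam i" using mono by simp
      also have "\<dots> \<le> \<kappa> * lam i" using kappa lam(2)[of i] by (intro mult_right_mono) auto
      finally show ?thesis .
    qed (use run that in blast)
    show "(\<forall>l\<in>G i. \<tau> * lam l \<le> lam j) \<or> (\<forall>l\<in>G i. \<tau> * lam j \<le> lam l)" if ji: "j \<notin> G i" for i j
    proof -
      obtain m where m: "min i j \<le> m" "m < max i j" "\<tau> * lam m \<le> lam (Suc m)"
        using ji by (auto simp: G_def not_less)
      show ?thesis
      proof (cases "i < j")
        case True
        have "\<tau> * lam l \<le> lam j" if l: "l \<in> G i" for l
        proof -
          have "l \<le> m"
          proof (rule ccontr)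
            assume "\<not> l \<le> m"
            then have "lam (Suc m) < \<tau> * lam m" using l m True by (simp add: G_def)
            then show False using m by simp
          qed
          then have "\<tau> * lam l \<le> \<tau> * lam m" using \<tau> mono by (intro mult_left_mono) auto
          moreover have "lam (Suc m) \<le> lam j" using m True by (intro mono) simp
          ultimately show ?thesis using m by linarith
        qed
        then show ?thesis by blast
      next
        case False
        have "\<tau> * lam j \<le> lam l" if l: "l \<in> G i" for l
        proof -
          have "m < l"
          proof (rule ccontr)
            assume "\<not> m < l"
            then have "lam (Suc m) < \<tau> * lam m" using l m False by (simp add: G_def)
            then show False using m by simp
          qed
          then have "lam (Suc m) \<le> lam l" by (intro mono) simp
          moreover have "\<tau> * lam j \<le> \<tau> * lam m" using m False \<tau> by (intro mult_left_mono mono) auto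
          ultimately show ?thesis using m by linarith
        qed
        then show ?thesis by blast
      qed
    qed
  qed (use lam rho growth kappa \<tau> in auto)
  then show ?thesis by blast
qed

section \<open>Monomials and the weak type inequality\<close>

lemma ennreal_powr_le:
  assumes "x \<le> ennreal y" "0 \<le> y" "0 < a"
  shows "ennreal_powr x a \<le> ennreal (y powr a)"
proof -
  have "x \<noteq> \<infinity>" using assms(1) by (auto simp: top_unique)
  moreover have "enn2real x \<le> y" using enn2real_mono[OF assms(1)] assms(2) by simp
  ultimately show ?thesis
    using assms by (auto simp: ennreal_powr_def intro!: ennreal_leI powr_mono2)
qed

text \<open>
  Substituting \<open>t = 1 - v\<close> and using \<open>1 - v \<le> exp (- v)\<close> reduces the Beta integral to a Gamma integral.
\<close>

lemma monomial_weight_integral_le: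
  assumes "0 < \<alpha>" "0 < \<theta>"
  shows "(\<integral>\<^sup>+t. ennreal (t powr \<theta>) \<partial>weight_measure (\<alpha> - 1)) \<le> ennreal (Gamma \<alpha> * \<theta> powr (- \<alpha>))"
proof -
  define h where "h = (\<lambda>u::real. indicator {0..} u * u powr (\<alpha> - 1) / exp u)"
  have [measurable]: "h \<in> borel_measurable borel" unfolding h_def by measurable
  have h0: "0 \<le> h u" for u by (simp add: h_def)
  have "(\<integral>\<^sup>+t. ennreal (t powr \<theta>) \<partial>weight_measure (\<alpha> - 1))
    = (\<integral>\<^sup>+t. ennreal ((1 - t) powr (\<alpha> - 1)) * ennreal (t powr \<theta>) * indicator {0..1} t \<partial>lborel)"
    by (rule nn_integral_weight_measure) measurable
  also have "\<dots> = ennreal \<bar>-1\<bar> * (\<integral>\<^sup>+v. ennreal ((1 - (1 + (-1) * v)) powr (\<alpha> - 1)) * ennreal ((1 + (-1) * v) powr \<theta>)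
       * indicator {0..1} (1 + (-1) * v) \<partial>lborel)"
    by (rule nn_integral_real_affine) measurable
  also have "\<dots> \<le> ennreal \<bar>-1\<bar> * (\<integral>\<^sup>+v. ennreal (\<theta> powr (1 - \<alpha>)) * ennreal (h (0 + \<theta> * v)) \<partial>lborel)"
  proof (intro mult_left_mono nn_integral_mono)
    fix v :: real
    show "ennreal ((1 - (1 + (-1) * v)) powr (\<alpha> - 1)) * ennreal ((1 + (-1) * v) powr \<theta>)
       * indicator {0..1} (1 + (-1) * v) \<le> ennreal (\<theta> powr (1 - \<alpha>)) * ennreal (h (0 + \<theta> * v))"
    proof (cases "v \<in> {0..1}")
      case True
      have "(1 - v) powr \<theta> \<le> exp (- v) powr \<theta>"
        using True assms exp_ge_add_one_self[of "-v"] by (intro powr_mono2) auto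
      then have "v powr (\<alpha> - 1) * (1 - v) powr \<theta> \<le> v powr (\<alpha> - 1) * exp (- (\<theta> * v))"
        by (intro mult_left_mono) (auto simp: powr_def)
      also have "\<dots> = \<theta> powr (1 - \<alpha>) * h (\<theta> * v)"
      proof -
        have "\<theta> powr (1 - \<alpha>) * (\<theta> * v) powr (\<alpha> - 1) = v powr (\<alpha> - 1)"
          using True assms by (simp add: powr_mult powr_add[symmetric] mult.assoc[symmetric])
        then show ?thesis using True assms by (simp add: h_def exp_minus divide_inverse)
      qed
      finally show ?thesis using h0 True by (simp add: ennreal_mult[symmetric] ennreal_leI)
    qed auto
  qed simp
  also have "\<dots> = ennreal (\<theta> powr (1 - \<alpha>)) * (\<integral>\<^sup>+v. ennreal (h (0 + \<theta> * v)) \<partial>lborel)"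
    by (simp add: nn_integral_cmult)
  also have "\<dots> = ennreal (\<theta> powr (- \<alpha>)) * (ennreal \<bar>\<theta>\<bar> * (\<integral>\<^sup>+v. ennreal (h (0 + \<theta> * v)) \<partial>lborel))"
  proof -
    have "\<theta> powr (1 - \<alpha>) = \<theta> powr (- \<alpha>) * \<bar>\<theta>\<bar>" using assms by (simp add: powr_diff powr_minus field_simps)
    then show ?thesis by (simp add: ennreal_mult mult.assoc)
  qed
  also have "ennreal \<bar>\<theta>\<bar> * (\<integral>\<^sup>+v. ennreal (h (0 + \<theta> * v)) \<partial>lborel) = (\<integral>\<^sup>+u. ennreal (h u) \<partial>lborel)"
    by (rule nn_integral_real_affine[symmetric]) (use assms in auto)
  also have "\<dots> = ennreal (Gamma \<alpha>)" unfolding h_def by (rule Gamma_conv_nn_integral_real[OF assms(1), symmetric])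
  finally show ?thesis using assms by (simp add: ennreal_mult[symmetric] mult.commute Gamma_real_pos less_imp_le)
qed

text \<open>
  A function bounded by \<open>1\<close> that is in weak \<open>L^p\<close> is in \<open>L^e\<close> for \<open>e > p\<close>, with linear dependence on the
  weak type constant; the proof sums over dyadic levels.
\<close>

lemma weak_type_imp_power_integral_bound:
  assumes "0 \<le> p" "p < e"
  shows "\<exists>C>0. \<forall>M g K. (g :: 'a \<Rightarrow> real) \<in> borel_measurable M \<longrightarrow> (\<forall>t\<in>space M. 0 \<le> g t \<and> g t \<le> 1) \<longrightarrow> 0 \<le> K \<longrightarrow>
    (\<forall>s>0. emeasure M {t \<in> space M. s < g t} \<le> ennreal (K * s powr (- p))) \<longrightarrow>
    (\<integral>\<^sup>+t. ennreal (g t powr e) \<partial>M) \<le> ennreal (C * K)"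
proof -
  define \<theta> where "\<theta> = (2::real) powr (p - e)"
  have \<theta>: "0 < \<theta>" "\<theta> < 1" using assms by (auto simp: \<theta>_def powr_less_one)
  define C where "C = 2 powr p / (1 - \<theta>)"
  have C: "C > 0" using \<theta> by (simp add: C_def)
  have "(\<integral>\<^sup>+t. ennreal (g t powr e) \<partial>M) \<le> ennreal (C * K)"
    if g [measurable]: "g \<in> borel_measurable M" and g01: "\<forall>t\<in>space M. 0 \<le> g t \<and> g t \<le> 1" and K: "0 \<le> K"
      and weak: "\<forall>s>0. emeasure M {t \<in> space M. s < g t} \<le> ennreal (K * s powr (- p))"
    for M :: "'a measure" and g K
  proof -
    \<comment> \<open>Dyadic levels; \<open>g t\<close> lies between two consecutive ones unless it vanishes.\<close>
    define s where "s = (\<lambda>k::nat. (1 / 2) ^ k :: real)"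
    have s: "0 < s k" "s k = 2 powr (- real k)" for k
      by (auto simp: s_def powr_minus powr_realpow power_one_over inverse_eq_divide)
    have pw: "ennreal (g t powr e) \<le> (\<Sum>k. ennreal (s k powr e) * indicator {t \<in> space M. s (Suc k) < g t} t)"
      if t: "t \<in> space M" for t
    proof (cases "g t = 0")
      case False
      then have gt: "0 < g t" "g t \<le> 1" using g01 t by (auto simp: less_le)
      obtain k0 where k0: "s k0 < g t" using real_arch_pow_inv[of "g t" "1 / 2"] gt by (auto simp: s_def)
      define m where "m = (LEAST k. s k < g t)"
      have m: "s m < g t" unfolding m_def using k0 by (rule LeastI)
      have "m \<noteq> 0" using m gt by (intro notI) (simp add: s_def)
      then obtain k where k: "m = Suc k" using not0_implies_Suc by blast
      have "\<not> s k < g t" using not_less_Least[of k "\<lambda>k. s k < g t"] k unfolding m_def by simp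
      then have "g t powr e \<le> s k powr e" using gt assms by (intro powr_mono2) auto
      then have "ennreal (g t powr e) \<le> (\<Sum>k\<in>{k}. ennreal (s k powr e) * indicator {t \<in> space M. s (Suc k) < g t} t)"
        using m k t by (simp add: ennreal_leI)
      also have "\<dots> \<le> (\<Sum>k. ennreal (s k powr e) * indicator {t \<in> space M. s (Suc k) < g t} t)"
        by (intro sum_le_suminf) auto
      finally show ?thesis .
    qed (use assms in simp)
    have "(\<integral>\<^sup>+t. ennreal (g t powr e) \<partial>M) \<le> (\<integral>\<^sup>+t. (\<Sum>k. ennreal (s k powr e) * indicator {t \<in> space M. s (Suc k) < g t} t) \<partial>M)"
      by (intro nn_integral_mono pw)
    also have "\<dots> = (\<Sum>k. \<integral>\<^sup>+t. ennreal (s k powr e) * indicator {t \<in> space M. s (Suc k) < g t} t \<partial>M)"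
      by (intro nn_integral_suminf) measurable
    also have "\<dots> = (\<Sum>k. ennreal (s k powr e) * emeasure M {t \<in> space M. s (Suc k) < g t})"
      by (intro suminf_cong nn_integral_cmult_indicator) measurable
    also have "\<dots> \<le> (\<Sum>k. ennreal (K * 2 powr p * \<theta> ^ k))"
    proof (intro suminf_le summableI)
      fix k
      have "ennreal (s k powr e) * emeasure M {t \<in> space M. s (Suc k) < g t} \<le>
        ennreal (s k powr e) * ennreal (K * s (Suc k) powr (- p))"
        using weak s(1) by (intro mult_left_mono) auto
      also have "\<dots> = ennreal (K * (s k powr e * s (Suc k) powr (- p)))"
        using K by (simp add: ennreal_mult[symmetric] mult_ac)
      also have "s k powr e * s (Suc k) powr (- p) = 2 powr p * \<theta> ^ k"
        unfolding s(2) \<theta>_def by (simp add: powr_powr powr_realpow[symmetric] powr_add[symmetric] algebra_simps)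
      finally show "ennreal (s k powr e) * emeasure M {t \<in> space M. s (Suc k) < g t} \<le> ennreal (K * 2 powr p * \<theta> ^ k)"
        by (simp add: mult.assoc)
    qed
    also have "\<dots> = ennreal (\<Sum>k. K * 2 powr p * \<theta> ^ k)"
      using K \<theta> by (intro suminf_ennreal2 summable_mult summable_geometric) auto
    also have "(\<Sum>k. K * 2 powr p * \<theta> ^ k) = C * K"
      using \<theta> by (simp add: suminf_mult suminf_geometric summable_geometric C_def)
    finally show ?thesis .
  qed
  then show ?thesis using C by blast
qed

section \<open>The strong type inequality\<close>

context exponent_groups
begin

text \<open>
  All that is used of \<open>\<mu>\<close> is how it integrates powers of monomials. Pointwise, \<open>f\<close> is dominated by the groups and these by
  \<open>c i * lam i powr \<sigma> * exp (- \<gamma> * lam i * x)\<close> with the normalised sizes \<open>c i\<close>; the majorant is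
  integrated termwise, and the result is compared with the norm. The exponents match because
  \<open>\<sigma> * r = \<alpha> * \<beta>\<close>, and \<open>\<beta> \<ge> 1\<close> is used to pass from \<open>\<Sum> c i powr r\<close> to a power of \<open>\<Sum> c i powr q\<close>.
\<close>

lemma strong_type_of_monomial_bounds:
  assumes "0 < \<alpha>" "1 \<le> \<beta>" "\<beta> \<le> r" and g: "0 < \<gamma>'" "\<gamma>' < \<gamma>" "\<gamma> < 1 / \<kappa>"
    and \<mu>: "sets \<mu> = sets (restrict_space borel {0..1})" and K: "0 \<le> K"
    and mass: "\<And>i. (\<integral>\<^sup>+t. ennreal (t powr (\<gamma>' * r * lam i)) \<partial>\<mu>) \<le> ennreal (K * lam i powr (- (\<alpha> * \<beta>)))"
  shows "strong_type lam \<alpha> \<beta> \<mu> (\<lambda>f. f) r"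
proof -
  define q where "q = r / \<beta>"
  define \<sigma> where "\<sigma> = \<alpha> / q"
  have r: "1 \<le> r" using assms by simp
  have q: "1 \<le> q" "q * \<beta> = r" using assms by (auto simp: q_def)
  have \<sigma>: "0 < \<sigma>" "\<sigma> * r = \<alpha> * \<beta>" using assms(1) q r by (auto simp: \<sigma>_def q(2)[symmetric])
  obtain C1 where C1: "C1 > 0" "\<And>a i x. 0 \<le> x \<Longrightarrow> cmod (esum a (G i) x) \<le> C1 * decay \<gamma> i x * group_size a i"
    using group_decay[OF g(3)] by (elim exE conjE) (rule that, assumption, simp)
  obtain C2 where C2: "C2 > 0" "\<forall>a T f X. finite T \<longrightarrow> (\<forall>j\<in>T. G j \<subseteq> T) \<longrightarrow> f \<in> borel_measurable borel \<longrightarrow>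
    (\<forall>x\<ge>0. f (exp (- x)) = esum a T x) \<longrightarrow> 0 \<le> X \<longrightarrow>
    (\<integral>\<^sup>+t. ennreal (cmod (f t) powr q) \<partial>weight_measure (\<alpha> - 1)) = ennreal X \<longrightarrow>
    (\<Sum>i\<in>T. normalised_size \<sigma> a i powr q) \<le> C2 * X"
    using group_sizes_bounded_by_norm[OF assms(1) q(1), folded \<sigma>_def] by (elim exE conjE) (rule that)
  obtain C3 where C3: "C3 > 0" "\<forall>T c. finite T \<longrightarrow> (\<forall>i. 0 \<le> c i) \<longrightarrow> (\<exists>A. (\<forall>i. 0 \<le> A i) \<and>
    (\<forall>x\<ge>0. (\<Sum>i\<in>T. c i * lam i powr \<sigma> * decay \<gamma> i x) powr r
       \<le> (\<Sum>i\<in>T. A i * exp (- (\<gamma>' * r * lam i * x)))) \<and>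
    (\<Sum>i\<in>T. A i * lam i powr (- (\<sigma> * r))) \<le> C3 * (\<Sum>i\<in>T. c i powr r))"
    using exponential_sum_power_majorant[OF r g(1,2) \<sigma>(1)] by (elim exE conjE) (rule that)
  define C4 where "C4 = C1 powr r * K * C3 * C2 powr \<beta>"
  have C4: "0 \<le> C4" using K C3 by (simp add: C4_def)
  define C where "C = C4 powr (1 / r) + 1"
  have C: "0 < C" by (simp add: C_def add_nonneg_pos)
  have space: "space \<mu> = {0..1}" using sets_eq_imp_space_eq[OF \<mu>] by simp
  have "f \<in> borel_measurable \<mu> \<and> Lp_norm r \<mu> f \<le> ennreal C * Lp_norm (r / \<beta>) (weight_measure (\<alpha> - 1)) f"
    if f: "f \<in> muntz_space lam" for f
  proof -
    obtain n a0 where fa: "f = (\<lambda>t. \<Sum>k\<le>(n::nat). a0 k * complex_of_real (t powr lam k))"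
      using f by (auto simp: muntz_space_def)
    have fm [measurable]: "f \<in> borel_measurable borel" unfolding fa by measurable
    have meas: "f \<in> borel_measurable \<mu>"
      unfolding measurable_cong_sets[OF \<mu> refl] by (rule measurable_restrict_space1[OF fm])
    \<comment> \<open>The support is completed to a union of groups, with zero coefficients.\<close>
    define T where "T = (\<Union>i\<le>n. G i)"
    define a where "a = (\<lambda>k. if k \<le> n then a0 k else 0)"
    have T: "finite T" "\<forall>j\<in>T. G j \<subseteq> T" using G_finite G_eq by (auto simp: T_def)
    have nT: "{..n} \<subseteq> T" using G_refl by (auto simp: T_def)
    have fe: "\<forall>x\<ge>0. f (exp (- x)) = esum a T x"
    proof (intro allI impI)
      fix x :: real
      have "esum a T x = (\<Sum>j\<le>n. a j * of_real (exp (- lam j * x)))"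
        unfolding esum_def using T nT by (intro sum.mono_neutral_right) (auto simp: a_def)
      also have "\<dots> = f (exp (- x))" unfolding fa by (intro sum.cong) (auto simp: a_def powr_def)
      finally show "f (exp (- x)) = esum a T x" by simp
    qed
    have f0: "f 0 = 0" by (simp add: fa)
    define c where "c = (\<lambda>i. normalised_size \<sigma> a i)"
    have c0: "\<forall>i. 0 \<le> c i" by (simp add: c_def group_size_nonneg)
    obtain A where A: "\<forall>i. 0 \<le> A i"
      "\<And>x. 0 \<le> x \<Longrightarrow> (\<Sum>i\<in>T. c i * lam i powr \<sigma> * decay \<gamma> i x) powr r
       \<le> (\<Sum>i\<in>T. A i * exp (- (\<gamma>' * r * lam i * x)))"
      "(\<Sum>i\<in>T. A i * lam i powr (- (\<alpha> * \<beta>))) \<le> C3 * (\<Sum>i\<in>T. c i powr r)"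
      using C3(2)[THEN spec, THEN spec, THEN mp, OF T(1), THEN mp, OF c0] unfolding \<sigma>(2)
      by (elim exE conjE) (rule that, assumption, simp, assumption)
    have pw: "cmod (f t) powr r \<le> (\<Sum>i\<in>T. C1 powr r * A i * t powr (\<gamma>' * r * lam i))" if t: "t \<in> {0..1}" for t
    proof (cases "t = 0")
      case True
      then show ?thesis using f0 A C1 by (auto intro!: sum_nonneg)
    next
      case False
      define x where "x = - ln t"
      have x: "0 \<le> x" "t = exp (- x)" using t False by (auto simp: x_def)
      have "cmod (f t) = cmod (esum a T x)" using fe x by simp
      also have "\<dots> \<le> (\<Sum>i\<in>T. cmod (esum a (G i) x))"
        unfolding esum_def using T by (intro cmod_sum_by_groups) auto
      also have "\<dots> \<le> (\<Sum>i\<in>T. C1 * (c i * lam i powr \<sigma> * decay \<gamma> i x))"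
      proof (rule sum_mono)
        fix i
        have "c i * lam i powr \<sigma> = group_size a i"
          using lam_pos[of i] by (simp add: c_def powr_minus field_simps)
        then show "cmod (esum a (G i) x) \<le> C1 * (c i * lam i powr \<sigma> * decay \<gamma> i x)"
          using C1(2)[OF x(1), of a i] by (simp add: mult_ac)
      qed
      also have "\<dots> = C1 * (\<Sum>i\<in>T. c i * lam i powr \<sigma> * decay \<gamma> i x)"
        by (simp add: sum_distrib_left)
      finally have "cmod (f t) powr r \<le> (C1 * (\<Sum>i\<in>T. c i * lam i powr \<sigma> * decay \<gamma> i x)) powr r"
        using r by (intro powr_mono2) auto
      also have "\<dots> = C1 powr r * (\<Sum>i\<in>T. c i * lam i powr \<sigma> * decay \<gamma> i x) powr r"
        using C1 c0 by (simp add: powr_mult sum_nonneg)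
      also have "\<dots> \<le> C1 powr r * (\<Sum>i\<in>T. A i * exp (- (\<gamma>' * r * lam i * x)))"
        using A(2)[OF x(1)] by (intro mult_left_mono) auto
      also have "\<dots> = (\<Sum>i\<in>T. C1 powr r * A i * t powr (\<gamma>' * r * lam i))"
        by (simp add: sum_distrib_left x(2) powr_def mult_ac)
      finally show ?thesis .
    qed
    define I where "I = (\<integral>\<^sup>+t. ennreal (cmod (f t) powr r) \<partial>\<mu>)"
    have "I \<le> (\<integral>\<^sup>+t. (\<Sum>i\<in>T. ennreal (C1 powr r * A i) * ennreal (t powr (\<gamma>' * r * lam i))) \<partial>\<mu>)"
      unfolding I_def
    proof (rule nn_integral_mono)
      fix t assume "t \<in> space \<mu>"
      then have "ennreal (cmod (f t) powr r) \<le> ennreal (\<Sum>i\<in>T. C1 powr r * A i * t powr (\<gamma>' * r * lam i))"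
        using pw space by (intro ennreal_leI) auto
      also have "\<dots> = (\<Sum>i\<in>T. ennreal (C1 powr r * A i) * ennreal (t powr (\<gamma>' * r * lam i)))"
        using A(1) by (simp add: ennreal_mult[symmetric] sum_ennreal)
      finally show "ennreal (cmod (f t) powr r) \<le> (\<Sum>i\<in>T. ennreal (C1 powr r * A i) * ennreal (t powr (\<gamma>' * r * lam i)))" .
    qed
    also have "\<dots> = (\<Sum>i\<in>T. ennreal (C1 powr r * A i) * (\<integral>\<^sup>+t. ennreal (t powr (\<gamma>' * r * lam i)) \<partial>\<mu>))"
    proof -
      have "(\<lambda>t. t powr e) \<in> borel_measurable \<mu>" for e :: real
      proof -
        have "(\<lambda>t::real. t powr e) \<in> borel_measurable borel" by measurable
        then show ?thesis unfolding measurable_cong_sets[OF \<mu> refl] by (rule measurable_restrict_space1)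
      qed
      then show ?thesis by (simp add: nn_integral_sum nn_integral_cmult)
    qed
    also have "\<dots> \<le> (\<Sum>i\<in>T. ennreal (C1 powr r * A i) * ennreal (K * lam i powr (- (\<alpha> * \<beta>))))"
      by (intro sum_mono mult_left_mono mass) auto
    also have "\<dots> = ennreal (C1 powr r * K * (\<Sum>i\<in>T. A i * lam i powr (- (\<alpha> * \<beta>))))"
      using A(1) K by (simp add: ennreal_mult[symmetric] sum_ennreal sum_distrib_left mult_ac)
    also have "\<dots> \<le> ennreal (C1 powr r * K * (C3 * (\<Sum>i\<in>T. c i powr r)))"
      using A(3) K by (intro ennreal_leI mult_left_mono) auto
    finally have I1: "I \<le> ennreal (C1 powr r * K * (C3 * (\<Sum>i\<in>T. c i powr r)))" .
    have "Lp_norm r \<mu> f \<le> ennreal C * Lp_norm (r / \<beta>) (weight_measure (\<alpha> - 1)) f"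
    proof (cases "(\<integral>\<^sup>+t. ennreal (cmod (f t) powr q) \<partial>weight_measure (\<alpha> - 1))")
      case top
      then have "Lp_norm (r / \<beta>) (weight_measure (\<alpha> - 1)) f = \<infinity>"
        by (simp add: Lp_norm_def ennreal_powr_def q_def)
      then show ?thesis using C by (simp add: ennreal_mult_top)
    next
      case (real X)
      then have X: "0 \<le> X" "(\<integral>\<^sup>+t. ennreal (cmod (f t) powr q) \<partial>weight_measure (\<alpha> - 1)) = ennreal X" by auto
      have "(\<Sum>i\<in>T. c i powr r) = (\<Sum>i\<in>T. (c i powr q) powr \<beta>)" using q by (simp add: powr_powr)
      also have "\<dots> \<le> (\<Sum>i\<in>T. c i powr q) powr \<beta>" using T assms by (intro sum_powr_le_powr_sum) auto
      also have "\<dots> \<le> (C2 * X) powr \<beta>"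
      proof (intro powr_mono2 sum_nonneg)
        show "(\<Sum>i\<in>T. c i powr q) \<le> C2 * X"
          unfolding c_def using C2(2)[THEN spec, THEN spec, THEN spec, THEN spec, THEN mp, OF T(1),
              THEN mp, OF T(2), THEN mp, OF fm, THEN mp, OF fe, THEN mp, OF X(1), THEN mp, OF X(2)] .
      qed (use assms in auto)
      also have "\<dots> = C2 powr \<beta> * X powr \<beta>" by (simp add: powr_mult)
      finally have "(\<Sum>i\<in>T. c i powr r) \<le> C2 powr \<beta> * X powr \<beta>" .
      then have "C1 powr r * K * (C3 * (\<Sum>i\<in>T. c i powr r)) \<le> C1 powr r * K * (C3 * (C2 powr \<beta> * X powr \<beta>))"
        using K C3 by (intro mult_left_mono) auto
      also have "\<dots> = C4 * X powr \<beta>" by (simp add: C4_def)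
      finally have "I \<le> ennreal (C4 * X powr \<beta>)" by (rule order_trans[OF I1 ennreal_leI])
      then have "Lp_norm r \<mu> f \<le> ennreal ((C4 * X powr \<beta>) powr (1 / r))"
        unfolding Lp_norm_def I_def using C4 r by (intro ennreal_powr_le) auto
      also have "(C4 * X powr \<beta>) powr (1 / r) = C4 powr (1 / r) * X powr (\<beta> / r)"
        using C4 by (simp add: powr_mult powr_powr)
      also have "ennreal (C4 powr (1 / r) * X powr (\<beta> / r)) \<le> ennreal (C * X powr (\<beta> / r))"
        by (intro ennreal_leI mult_right_mono) (auto simp: C_def)
      also have "\<dots> = ennreal C * Lp_norm (r / \<beta>) (weight_measure (\<alpha> - 1)) f"
        using C real by (simp add: Lp_norm_def ennreal_powr_def q_def ennreal_mult)
      finally show ?thesis .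
    qed
    then show ?thesis using meas by blast
  qed
  then show ?thesis unfolding strong_type_def using C by blast
qed

end

lemma monomial_in_some_block_space:
  assumes "strict_mono n" "n 0 = -1"
  shows "\<exists>k. (\<lambda>t. complex_of_real (t powr lam i)) \<in> block_space lam n k"
proof -
  obtain k where k: "n k < int i" "int i \<le> n (Suc k)" using block_between[OF assms, of "int i"] by auto
  have mem: "lam i \<in> block lam n k" unfolding block_def using k by (intro image_eqI[of _ _ "int i"]) auto
  have fin: "finite (block lam n k)" by (simp add: block_def)
  have "(\<lambda>t. complex_of_real (t powr lam i)) =
    (\<lambda>t. \<Sum>x\<in>block lam n k. (if x = lam i then 1 else 0) * complex_of_real (t powr x))"
  proof
    fix t
    have "(\<Sum>x\<in>block lam n k. (if x = lam i then 1 else 0) * complex_of_real (t powr x)) =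
      (\<Sum>x\<in>block lam n k. if x = lam i then complex_of_real (t powr x) else 0)"
      by (intro sum.cong) auto
    also have "\<dots> = complex_of_real (t powr lam i)" using mem fin by (simp add: sum.delta)
    finally show "complex_of_real (t powr lam i) =
      (\<Sum>x\<in>block lam n k. (if x = lam i then 1 else 0) * complex_of_real (t powr x))" by simp
  qed
  then show ?thesis unfolding block_space_def
    by (intro exI[of _ k] CollectI exI[of _ "\<lambda>x. if x = lam i then 1 else 0"])
qed

text \<open>
  Each monomial lies in a block space, and its norm is a Beta integral of order \<open>lam i powr (- \<alpha>)\<close>
  before taking the root.
\<close>

lemma restricted_weak_type_monomial_bound:
  assumes "0 < \<alpha>" "1 \<le> \<beta>" "\<beta> \<le> p" and lam: "\<And>k. 0 < lam k" and n: "strict_mono n" "n 0 = -1"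
    and weak: "restricted_weak_type lam n \<alpha> \<beta> \<mu> (\<lambda>f. f) p C" and bdd: "bdd_above (range C)"
  shows "\<exists>K\<ge>0. \<forall>i. \<forall>s>0. emeasure \<mu> {t \<in> space \<mu>. s < t powr lam i} \<le> ennreal (K * lam i powr (- (\<alpha> * \<beta>)) * s powr (- p))"
proof -
  obtain B where B: "\<And>k. C k \<le> B" using bdd by (auto simp: bdd_above_def)
  define Y where "Y = Gamma \<alpha> * (p / \<beta>) powr (- \<alpha>)"
  have Y: "0 \<le> Y" using assms by (simp add: Y_def Gamma_real_pos less_imp_le)
  have p: "0 < p" using assms by simp
  have "emeasure \<mu> {t \<in> space \<mu>. s < t powr lam i} \<le> ennreal (B powr p * Y powr \<beta> * lam i powr (- (\<alpha> * \<beta>)) * s powr (- p))"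
    if s: "0 < s" for i s
  proof -
    define f where "f = (\<lambda>t. complex_of_real (t powr lam i))"
    obtain k where "f \<in> block_space lam n k"
      using monomial_in_some_block_space[OF n, of lam i] unfolding f_def by blast
    then have w: "emeasure \<mu> {t \<in> space \<mu>. s < cmod (f t)} \<le>
        ennreal (C k powr p * s powr (- p)) * ennreal_powr (Lp_norm (p / \<beta>) (weight_measure (\<alpha> - 1)) f) p"
      and Ck: "0 < C k"
      using weak s unfolding restricted_weak_type_def by blast+
    define X where "X = Gamma \<alpha> * (lam i * (p / \<beta>)) powr (- \<alpha>)"
    have "(lam i * (p / \<beta>)) powr (- \<alpha>) = lam i powr (- \<alpha>) * (p / \<beta>) powr (- \<alpha>)"
      by (simp only: powr_mult)
    then have XY: "X = Y * lam i powr (- \<alpha>)" by (simp only: X_def Y_def mult_ac)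
    have X: "0 \<le> X" unfolding XY using Y by simp
    have "(\<integral>\<^sup>+t. ennreal (cmod (f t) powr (p / \<beta>)) \<partial>weight_measure (\<alpha> - 1)) =
      (\<integral>\<^sup>+t. ennreal (t powr (lam i * (p / \<beta>))) \<partial>weight_measure (\<alpha> - 1))"
      by (simp add: f_def powr_powr)
    also have "\<dots> \<le> ennreal X"
      unfolding X_def using assms lam[of i] by (intro monomial_weight_integral_le) auto
    finally have "Lp_norm (p / \<beta>) (weight_measure (\<alpha> - 1)) f \<le> ennreal (X powr (1 / (p / \<beta>)))"
      unfolding Lp_norm_def using X assms by (intro ennreal_powr_le) auto
    then have "ennreal_powr (Lp_norm (p / \<beta>) (weight_measure (\<alpha> - 1)) f) p \<le> ennreal ((X powr (1 / (p / \<beta>))) powr p)"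
      using p by (intro ennreal_powr_le) auto
    also have "(X powr (1 / (p / \<beta>))) powr p = X powr \<beta>" using p by (simp add: powr_powr)
    also have "X powr \<beta> = Y powr \<beta> * lam i powr (- (\<alpha> * \<beta>))" unfolding XY using Y by (simp add: powr_mult powr_powr)
    finally have L: "ennreal_powr (Lp_norm (p / \<beta>) (weight_measure (\<alpha> - 1)) f) p \<le> ennreal (Y powr \<beta> * lam i powr (- (\<alpha> * \<beta>)))" .
    have CB: "C k powr p \<le> B powr p" using Ck B[of k] p by (intro powr_mono2) auto
    have "emeasure \<mu> {t \<in> space \<mu>. s < t powr lam i} = emeasure \<mu> {t \<in> space \<mu>. s < cmod (f t)}"
      by (simp add: f_def)
    also note w
    also have "ennreal (C k powr p * s powr (- p)) * ennreal_powr (Lp_norm (p / \<beta>) (weight_measure (\<alpha> - 1)) f) p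
      \<le> ennreal (B powr p * s powr (- p)) * ennreal (Y powr \<beta> * lam i powr (- (\<alpha> * \<beta>)))"
      using CB L by (intro mult_mono ennreal_leI mult_right_mono) auto
    also have "\<dots> = ennreal (B powr p * Y powr \<beta> * lam i powr (- (\<alpha> * \<beta>)) * s powr (- p))"
      by (simp add: ennreal_mult[symmetric] mult_ac)
    finally show ?thesis .
  qed
  then show ?thesis by (intro exI[of _ "B powr p * Y powr \<beta>"]) auto
qed

theorem corollary1p5:
  fixes \<alpha> \<beta> p :: real
    and lam :: "nat \<Rightarrow> real" and n :: "nat \<Rightarrow> int"
    and \<mu> :: "real measure"
    and C :: "nat \<Rightarrow> real"
  assumes "\<alpha> > 0" and "\<beta> \<ge> 1" and "p \<ge> \<beta>"
    and "strict_mono lam" and "\<And>k. lam k > 0" and "summable (\<lambda>k. 1 / lam k)"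
    and "quasi_lacunary_decomposition lam n"
    and "sets \<mu> = sets (restrict_space borel {0..1})"
    and "restricted_weak_type lam n \<alpha> \<beta> \<mu> (\<lambda>f. f) p C"
    and "bdd_above (range C)"
  shows "\<forall>r>p. strong_type lam \<alpha> \<beta> \<mu> (\<lambda>f. f) r"
proof (intro allI impI)
  fix r assume r: "p < r"
  have p: "0 < p" using assms by simp
  have n: "strict_mono n" "n 0 = -1" using assms(7) by (auto simp: quasi_lacunary_decomposition_def)
  \<comment> \<open>Rates \<open>p / r < \<gamma>' < \<gamma> < 1\<close>: \<open>\<gamma>' * r > p\<close> makes powers of monomials integrable, and \<open>\<gamma> < 1 / \<kappa>\<close> is the decay of the groups.\<close>
  define \<theta> where "\<theta> = p / r"
  define \<gamma>' where "\<gamma>' = (2 * \<theta> + 1) / 3"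
  define \<gamma> where "\<gamma> = (\<theta> + 2) / 3"
  have \<theta>: "0 < \<theta>" "\<theta> < 1" using p r by (auto simp: \<theta>_def)
  have g: "0 < \<gamma>'" "\<gamma>' < \<gamma>" "0 < \<gamma>" "\<gamma> < 1" "\<theta> < \<gamma>'"
    using \<theta> unfolding \<gamma>'_def \<gamma>_def by auto
  have e: "p < \<gamma>' * r" using g(5) p r by (simp add: \<theta>_def field_simps)
  obtain \<rho> M where \<rho>: "1 < \<rho>" and growth: "\<And>i j. i \<le> j \<Longrightarrow> \<rho> ^ j * lam i \<le> \<rho> ^ (M + i) * lam j"
    using quasi_lacunary_growth[OF assms(4,5,7)] by blast
  define \<kappa> where "\<kappa> = min \<rho> ((1 / \<gamma> + 1) / 2)"
  have g1: "1 < 1 / \<gamma>" using g by simp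
  have \<kappa>: "1 < \<kappa>" "\<kappa> \<le> \<rho>" "\<kappa> < 1 / \<gamma>"
    using g1 \<rho> by (auto simp: \<kappa>_def min_less_iff_disj)
  then have \<kappa>\<gamma>: "\<gamma> < 1 / \<kappa>" using g by (simp add: field_simps)
  obtain G \<tau> N where "exponent_groups lam G \<rho> \<kappa> \<tau> M N"
    using exponent_groups_exist[OF assms(4,5) \<rho> growth \<kappa>(1,2)] by blast
  then interpret exponent_groups lam G \<rho> \<kappa> \<tau> M N .
  obtain K where K: "0 \<le> K" "\<And>i s. 0 < s \<Longrightarrow> emeasure \<mu> {t \<in> space \<mu>. s < t powr lam i} \<le>
      ennreal (K * lam i powr (- (\<alpha> * \<beta>)) * s powr (- p))"
    using restricted_weak_type_monomial_bound[OF assms(1,2,3,5) n assms(9,10)] by blast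
  obtain D where D: "0 < D" "\<forall>M g K. (g :: real \<Rightarrow> real) \<in> borel_measurable M \<longrightarrow>
    (\<forall>t\<in>space M. 0 \<le> g t \<and> g t \<le> 1) \<longrightarrow> 0 \<le> K \<longrightarrow>
    (\<forall>s>0. emeasure M {t \<in> space M. s < g t} \<le> ennreal (K * s powr (- p))) \<longrightarrow>
    (\<integral>\<^sup>+t. ennreal (g t powr (\<gamma>' * r)) \<partial>M) \<le> ennreal (D * K)"
    using weak_type_imp_power_integral_bound[OF less_imp_le[OF p] e] by (elim exE conjE) (rule that)
  have space: "space \<mu> = {0..1}" using sets_eq_imp_space_eq[OF assms(8)] by simp
  have "(\<integral>\<^sup>+t. ennreal (t powr (\<gamma>' * r * lam i)) \<partial>\<mu>) \<le> ennreal (D * K * lam i powr (- (\<alpha> * \<beta>)))" for i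
  proof -
    have m: "(\<lambda>t. t powr lam i) \<in> borel_measurable \<mu>"
    proof -
      have "(\<lambda>t::real. t powr lam i) \<in> borel_measurable borel" by measurable
      then show ?thesis unfolding measurable_cong_sets[OF assms(8) refl] by (rule measurable_restrict_space1)
    qed
    have "(\<integral>\<^sup>+t. ennreal ((t powr lam i) powr (\<gamma>' * r)) \<partial>\<mu>) \<le> ennreal (D * (K * lam i powr (- (\<alpha> * \<beta>))))"
    proof (rule D(2)[THEN spec, THEN spec, THEN spec, THEN mp, OF m, THEN mp, THEN mp, THEN mp])
      show "\<forall>t\<in>space \<mu>. 0 \<le> t powr lam i \<and> t powr lam i \<le> 1"
        using lam_pos[of i] by (auto simp: space intro: powr_le1)
      show "0 \<le> K * lam i powr (- (\<alpha> * \<beta>))" using K(1) by simp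
    qed (use K(2) in blast)
    then show ?thesis by (simp add: powr_powr mult_ac)
  qed
  then show "strong_type lam \<alpha> \<beta> \<mu> (\<lambda>f. f) r"
    using assms(1-3,8) g(1,2) \<kappa>\<gamma> K(1) D(1) r
    by (intro strong_type_of_monomial_bounds[where K = "D * K" and \<gamma> = \<gamma> and \<gamma>' = \<gamma>']) auto
qed

end
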